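(* Let $q\neq 3$ be a power of an odd prime and let $H=\mathbb{F}_{q^2}(x,y)$ be the Hermitian function field over $\mathbb{F}_{q^2}$, defined by $y^q+y=x^{q+1}$. Let $\delta\in\mathbb{F}_{q^2}$ be an element of order $2(q-1)$ and put $c=\delta-\delta^{-1}$ (so $c^q+c=0$). Let $\sigma$ be the $\mathbb{F}_{q^2}$-automorphism of $H$ given by $\sigma(x)=\frac{x}{y+c}$, $\sigma(y)=\frac{1}{y+c}$ (it has order $2(q-1)$). Let $m$ be a positive divisor of $2(q-1)$ and let $\mathcal G=\langle\sigma^{\frac{2(q-1)}{m}}\rangle$. Then $$g(H^{\mathcal G})=\begin{cases} \frac{q^2-q}{2m} & \text{if } m \text{ is odd},\\ \frac{q^2-4q+3}{2m} & \text{if } 4\mid m \text{ and } q\equiv 3 \pmod 4,\\ \frac{q^2-2q+1}{2m} & \text{otherwise}.\end{cases}$$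
   Context: $H^{\mathcal G}$ denotes the subfield of $H$ fixed by every element of $\mathcal G$, regarded as a function field over $\mathbb{F}_{q^2}$. *)

theory Defs
  imports Complex_Main "HOL-Library.Cardinality" "HOL-Computational_Algebra.Polynomial"
    "HOL-Computational_Algebra.Primes"
begin

text \<open>
  The ambient field is a type \<open>'h\<close>, and the field of constants is a type \<open>'k\<close> that is embedded
  into it by a homomorphism \<open>\<iota>\<close>. Intermediate fields are subsets of \<open>'h\<close> that contain
  \<open>range \<iota>\<close>. The theory of places, divisors and the genus follows Stichtenoth,
  Algebraic Function Fields and Codes, Chapter 1.
\<close>

definition const_embedding :: "('k::field \<Rightarrow> 'h::field) \<Rightarrow> bool" where
  "const_embedding \<iota> \<longleftrightarrow>
     (\<forall>a b. \<iota> (a + b) = \<iota> a + \<iota> b) \<and> (\<forall>a b. \<iota> (a * b) = \<iota> a * \<iota> b) \<and> \<iota> 1 = 1"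

definition is_subfield :: "'h::field set \<Rightarrow> bool" where
  "is_subfield F \<longleftrightarrow>
     1 \<in> F \<and> (\<forall>a\<in>F. \<forall>b\<in>F. a - b \<in> F \<and> a * b \<in> F) \<and> (\<forall>a\<in>F. inverse a \<in> F)"

definition transcendental_over :: "('k::field \<Rightarrow> 'h::field) \<Rightarrow> 'h \<Rightarrow> bool" where
  "transcendental_over \<iota> x \<longleftrightarrow> (\<forall>p. p \<noteq> 0 \<longrightarrow> poly (map_poly \<iota> p) x \<noteq> 0)"

definition has_mult_order :: "'a::field \<Rightarrow> nat \<Rightarrow> bool" where
  "has_mult_order a n \<longleftrightarrow> n > 0 \<and> a ^ n = 1 \<and> (\<forall>k. 0 < k \<and> k < n \<longrightarrow> a ^ k \<noteq> 1)"

lemma vector_space_const_embedding: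
  "const_embedding \<iota> \<Longrightarrow> vector_space (\<lambda>a z. \<iota> a * z)"
  by unfold_locales (auto simp: const_embedding_def algebra_simps)


section \<open>Places and valuations\<close>

definition is_subring :: "'h::field set \<Rightarrow> bool" where
  "is_subring R \<longleftrightarrow> 1 \<in> R \<and> (\<forall>a\<in>R. \<forall>b\<in>R. a - b \<in> R \<and> a * b \<in> R)"

definition valuation_rings :: "('k::field \<Rightarrow> 'h::field) \<Rightarrow> 'h set \<Rightarrow> 'h set set" where
  "valuation_rings \<iota> F =
     {R. is_subring R \<and> range \<iota> \<subset> R \<and> R \<subset> F \<and> (\<forall>z\<in>F. z \<in> R \<or> inverse z \<in> R)}"

text \<open>The unique maximal ideal of a valuation ring is the set of its non-units.\<close>

definition nonunits :: "'h::field set \<Rightarrow> 'h set" where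
  "nonunits R = {z \<in> R. z = 0 \<or> inverse z \<notin> R}"

definition places :: "('k::field \<Rightarrow> 'h::field) \<Rightarrow> 'h set \<Rightarrow> 'h set set" where
  "places \<iota> F = nonunits ` valuation_rings \<iota> F"

text \<open>The valuation ring of a place \<open>P\<close>; the case \<open>z = 0\<close> is needed because \<open>inverse 0 = 0 \<in> P\<close>.\<close>

definition val_ring :: "'h::field set \<Rightarrow> 'h set \<Rightarrow> 'h set" where
  "val_ring F P = {z \<in> F. z = 0 \<or> inverse z \<notin> P}"

lemma val_ring_nonunits:
  assumes "R \<in> valuation_rings \<iota> F"
  shows "val_ring F (nonunits R) = R"
proof -
  have R: "R \<subseteq> F" "1 \<in> R" "\<And>a b. a \<in> R \<Longrightarrow> b \<in> R \<Longrightarrow> a - b \<in> R"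
    "\<And>z. z \<in> F \<Longrightarrow> z \<in> R \<or> inverse z \<in> R"
    using assms by (auto simp: valuation_rings_def is_subring_def)
  from R(2) R(3)[of 1 1] have "0 \<in> R" by simp
  with R show ?thesis by (auto simp: val_ring_def nonunits_def)
qed

definition prime_element :: "'h::field set \<Rightarrow> 'h set \<Rightarrow> 'h \<Rightarrow> bool" where
  "prime_element F P t \<longleftrightarrow> P = (\<lambda>u. t * u) ` val_ring F P"

text \<open>Only meaningful for \<open>z \<noteq> 0\<close>; mathematically, the valuation of \<open>0\<close> is infinite.\<close>

definition valuation :: "'h::field set \<Rightarrow> 'h set \<Rightarrow> 'h \<Rightarrow> int" where
  "valuation F P z =
     (THE n. \<exists>t u. prime_element F P t \<and> u \<in> val_ring F P - P \<and> z = t powi n * u)"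

text \<open>The residue classes of the elements of \<open>B\<close> form a basis of the residue field
  (valuation ring modulo \<open>P\<close>) over the constants.\<close>

definition residue_basis :: "('k::field \<Rightarrow> 'h::field) \<Rightarrow> 'h set \<Rightarrow> 'h set \<Rightarrow> 'h set \<Rightarrow> bool" where
  "residue_basis \<iota> F P B \<longleftrightarrow>
     B \<subseteq> val_ring F P \<and> finite B \<and>
     (\<forall>z\<in>val_ring F P. \<exists>a. z - (\<Sum>b\<in>B. \<iota> (a b) * b) \<in> P) \<and>
     (\<forall>a. (\<Sum>b\<in>B. \<iota> (a b) * b) \<in> P \<longrightarrow> (\<forall>b\<in>B. a b = 0))"

definition place_degree :: "('k::field \<Rightarrow> 'h::field) \<Rightarrow> 'h set \<Rightarrow> 'h set \<Rightarrow> nat" where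
  "place_degree \<iota> F P = (THE n. \<exists>B. residue_basis \<iota> F P B \<and> card B = n)"


section \<open>Divisors and the genus\<close>

definition divisors :: "('k::field \<Rightarrow> 'h::field) \<Rightarrow> 'h set \<Rightarrow> ('h set \<Rightarrow> int) set" where
  "divisors \<iota> F = {D. finite {P. D P \<noteq> 0} \<and> {P. D P \<noteq> 0} \<subseteq> places \<iota> F}"

definition div_degree :: "('k::field \<Rightarrow> 'h::field) \<Rightarrow> 'h set \<Rightarrow> ('h set \<Rightarrow> int) \<Rightarrow> int" where
  "div_degree \<iota> F D = (\<Sum>P | D P \<noteq> 0. D P * int (place_degree \<iota> F P))"

definition riemann_roch_space ::
    "('k::field \<Rightarrow> 'h::field) \<Rightarrow> 'h set \<Rightarrow> ('h set \<Rightarrow> int) \<Rightarrow> 'h set" where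
  "riemann_roch_space \<iota> F D =
     {z \<in> F. z = 0 \<or> (\<forall>P\<in>places \<iota> F. valuation F P z \<ge> - D P)}"

definition ell :: "('k::field \<Rightarrow> 'h::field) \<Rightarrow> 'h set \<Rightarrow> ('h set \<Rightarrow> int) \<Rightarrow> nat" where
  "ell \<iota> F D = vector_space.dim (\<lambda>a z. \<iota> a * z) (riemann_roch_space \<iota> F D)"

text \<open>The genus of \<open>F\<close> over the constants is the maximum of \<open>deg D - \<ell>(D) + 1\<close> over all divisors.\<close>

definition genus :: "('k::field \<Rightarrow> 'h::field) \<Rightarrow> 'h set \<Rightarrow> int" where
  "genus \<iota> F = (GREATEST g. \<exists>D\<in>divisors \<iota> F. g = div_degree \<iota> F D - int (ell \<iota> F D) + 1)"


section \<open>The Hermitian function field and automorphisms\<close>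

text \<open>As \<open>Y^q + Y - x^(q+1)\<close> is irreducible over \<open>K(x)\<close>, these conditions determine the type \<open>'h\<close>
  as an extension of \<open>K\<close> up to isomorphism. Here \<open>'k\<close> is the field with \<open>q\<^sup>2\<close> elements.\<close>

definition hermitian_function_field ::
    "nat \<Rightarrow> ('k::{field,finite} \<Rightarrow> 'h::field) \<Rightarrow> 'h \<Rightarrow> 'h \<Rightarrow> bool" where
  "hermitian_function_field q \<iota> x y \<longleftrightarrow>
     CARD('k) = q ^ 2 \<and> const_embedding \<iota> \<and>
     transcendental_over \<iota> x \<and> y ^ q + y = x ^ (q + 1) \<and>
     is_subfield hull (range \<iota> \<union> {x, y}) = UNIV"

definition is_automorphism :: "('k::field \<Rightarrow> 'h::field) \<Rightarrow> ('h \<Rightarrow> 'h) \<Rightarrow> bool" where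
  "is_automorphism \<iota> \<sigma> \<longleftrightarrow>
     bij \<sigma> \<and> (\<forall>u v. \<sigma> (u + v) = \<sigma> u + \<sigma> v) \<and> (\<forall>u v. \<sigma> (u * v) = \<sigma> u * \<sigma> v) \<and>
     (\<forall>a. \<sigma> (\<iota> a) = \<iota> a)"

definition cyclic_group :: "('h \<Rightarrow> 'h) \<Rightarrow> ('h \<Rightarrow> 'h) set" where
  "cyclic_group \<tau> = range (\<lambda>n. \<tau> ^^ n) \<union> range (\<lambda>n. inv \<tau> ^^ n)"

definition fixed_field :: "('h \<Rightarrow> 'h) set \<Rightarrow> 'h set" where
  "fixed_field G = {z. \<forall>\<tau>\<in>G. \<tau> z = z}"

end

theory Submission
  imports Defs "HOL-Library.FuncSet"
begin

text \<open>
  The automorphism \<^term>\<open>\<sigma>\<close> fixes two rational points of the Hermitian curve. Moving them to infinity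
  and to the origin gives coordinates with \<^term>\<open>w ^ q + w = u ^ (q + 1)\<close> on which the group acts
  diagonally. The functions with poles at most at infinity form the ring \<^term>\<open>K[u, w]\<close>, with basis
  \<^term>\<open>u ^ i * w ^ j\<close>, \<^term>\<open>j < q\<close>, of pairwise distinct pole orders \<^term>\<open>q * i + (q + 1) * j\<close>;
  its fixed ring is spanned by the monomials with \<^term>\<open>m dvd i + (q + 1) * j\<close>. Infinity is totally
  ramified, so the genus of the fixed field is the number of gaps of the semigroup of the numbers
  \<^term>\<open>(q * i + (q + 1) * j) div m\<close> for these monomials.

  That the genus (a maximum over all divisors) equals the number of gaps holds for every normal ring with
  a degree function. As the constants are finite, all dimension arguments are done by counting:
  finiteness and discreteness of places, and the bound of the zeros of a function by its degree, follow by
  comparing the number of digit expansions in powers of the function with the number of elements of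
  bounded degree.
\<close>

section \<open>Subrings, subfields and valuation rings\<close>

text \<open>The genus is a maximum over all divisors, so its upper bound involves every place of the
  fixed field, of every degree, while only infinity is explicit. The other places are controlled
  through two properties alone: their valuation rings contain \<open>A\<close>, and a set pairwise
  incongruent modulo \<open>f\<close> in \<open>A\<close> has at most \<open>CARD('k) ^ d f\<close>
  elements. Discreteness, finite residue fields and the bound on zeros all come from the latter.

  Two facts about \<open>K[u, w]\<close> usually come from irreducibility and smoothness of the
  curve. Here independence of the monomials comes from size: a relation would make the ring finite,
  hence a field, hence all of the infinite function field. Normality comes from iterating the
  \<open>q\<close>-Frobenius, which sends \<open>w\<close> to an affine function of \<open>w\<close>
  over \<open>K[u]\<close>: a denominator that stays bounded in all powers of an integral element
  must cancel.

  The gap count sums an Apery set and uses the symmetry between \<open>j\<close> and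
  \<open>q - 1 - j\<close>; it yields \<open>2 * m * g = (q - 1) * (q + 1 - gcd m (q + 1))\<close>.
  The gcd divides 4, which is the source of the three cases.\<close>

lemma subring_diff: "is_subring R \<Longrightarrow> a \<in> R \<Longrightarrow> b \<in> R \<Longrightarrow> a - b \<in> R"
  and subring_mult: "is_subring R \<Longrightarrow> a \<in> R \<Longrightarrow> b \<in> R \<Longrightarrow> a * b \<in> R"
  and subring_1: "is_subring R \<Longrightarrow> 1 \<in> R"
  by (auto simp: is_subring_def)

lemma subring_0: "is_subring R \<Longrightarrow> 0 \<in> R"
  using subring_diff[of R 1 1] subring_1[of R] by simp

lemma subring_uminus: "is_subring R \<Longrightarrow> a \<in> R \<Longrightarrow> - a \<in> R"
  using subring_diff[of R 0 a] subring_0[of R] by simp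

lemma subring_add: "is_subring R \<Longrightarrow> a \<in> R \<Longrightarrow> b \<in> R \<Longrightarrow> a + b \<in> R"
  using subring_diff[of R a "- b"] subring_uminus[of R b] by simp

lemma subring_power: "is_subring R \<Longrightarrow> a \<in> R \<Longrightarrow> a ^ n \<in> R"
  by (induction n) (auto intro: subring_1 subring_mult)

lemma subring_sum: "is_subring R \<Longrightarrow> (\<And>i. i \<in> I \<Longrightarrow> f i \<in> R) \<Longrightarrow> sum f I \<in> R"
  by (induction I rule: infinite_finite_induct) (auto intro: subring_0 subring_add)

lemma subring_prod: "is_subring R \<Longrightarrow> (\<And>i. i \<in> I \<Longrightarrow> f i \<in> R) \<Longrightarrow> prod f I \<in> R"
  by (induction I rule: infinite_finite_induct) (auto intro: subring_1 subring_mult)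

lemmas subring_intros = subring_0 subring_1 subring_diff subring_mult subring_uminus subring_add
  subring_power subring_sum subring_prod

lemma subfield_subring: "is_subfield F \<Longrightarrow> is_subring F"
  by (auto simp: is_subfield_def is_subring_def)

lemma subfield_inverse: "is_subfield F \<Longrightarrow> a \<in> F \<Longrightarrow> inverse a \<in> F"
  by (auto simp: is_subfield_def)

lemma subfield_divide: "is_subfield F \<Longrightarrow> a \<in> F \<Longrightarrow> b \<in> F \<Longrightarrow> a / b \<in> F"
  by (simp add: divide_inverse subfield_inverse subring_mult[OF subfield_subring])

lemma subfield_powi: "is_subfield F \<Longrightarrow> a \<in> F \<Longrightarrow> a powi n \<in> F"
  by (auto simp: power_int_def subfield_inverse subring_power[OF subfield_subring])

lemmas subfield_intros = subring_intros[OF subfield_subring] subfield_inverse subfield_divide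
  subfield_powi

lemma const_embedding_0: "const_embedding \<iota> \<Longrightarrow> \<iota> 0 = 0"
  unfolding const_embedding_def by (metis add_cancel_right_left)

lemma const_embedding_uminus: "const_embedding \<iota> \<Longrightarrow> \<iota> (- a) = - \<iota> a"
  using const_embedding_0[of \<iota>] unfolding const_embedding_def
  by (metis add_eq_0_iff2 add.right_inverse)

lemma const_embedding_diff: "const_embedding \<iota> \<Longrightarrow> \<iota> (a - b) = \<iota> a - \<iota> b"
  using const_embedding_uminus[of \<iota> b] unfolding const_embedding_def
  by (metis add_uminus_conv_diff)

lemma const_embedding_eq_0: "const_embedding \<iota> \<Longrightarrow> \<iota> a = 0 \<longleftrightarrow> a = 0"
proof
  assume "const_embedding \<iota>" "\<iota> a = 0"
  then have "\<iota> (a * inverse a) = 0"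
    by (simp add: const_embedding_def)
  with \<open>const_embedding \<iota>\<close> show "a = 0"
    by (metis const_embedding_def right_inverse zero_neq_one)
qed (simp add: const_embedding_0)

lemma const_embedding_inj: "const_embedding \<iota> \<Longrightarrow> \<iota> a = \<iota> b \<longleftrightarrow> a = b"
  using const_embedding_eq_0[of \<iota> "a - b"] const_embedding_diff[of \<iota> a b] by simp

lemma const_embedding_inverse: "const_embedding \<iota> \<Longrightarrow> \<iota> (inverse a) = inverse (\<iota> a)"
proof (cases "a = 0")
  case False
  assume *: "const_embedding \<iota>"
  then have "\<iota> a * \<iota> (inverse a) = 1"
    using False unfolding const_embedding_def by (metis right_inverse)
  then show ?thesis
    by (metis inverse_unique)
qed (simp add: const_embedding_0)

lemma const_embedding_divide: "const_embedding \<iota> \<Longrightarrow> \<iota> (a / b) = \<iota> a / \<iota> b"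
  using const_embedding_inverse[of \<iota> b] by (simp add: divide_inverse const_embedding_def)

lemma const_embedding_power: "const_embedding \<iota> \<Longrightarrow> \<iota> (a ^ n) = \<iota> a ^ n"
  by (induction n) (auto simp: const_embedding_def)

lemma const_embedding_1: "const_embedding \<iota> \<Longrightarrow> \<iota> 1 = 1"
  and const_embedding_add: "const_embedding \<iota> \<Longrightarrow> \<iota> (a + b) = \<iota> a + \<iota> b"
  and const_embedding_mult: "const_embedding \<iota> \<Longrightarrow> \<iota> (a * b) = \<iota> a * \<iota> b"
  by (auto simp: const_embedding_def)

lemmas const_embedding_simps = const_embedding_0 const_embedding_1 const_embedding_add
  const_embedding_mult const_embedding_diff const_embedding_uminus const_embedding_inverse
  const_embedding_divide const_embedding_power const_embedding_eq_0 const_embedding_inj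

section \<open>Adjoining an element, and valuation rings by Zorn's lemma\<close>

definition adjoin :: "'h::field set \<Rightarrow> 'h \<Rightarrow> 'h set" where
  "adjoin S y = {poly p y | p. \<forall>i. coeff p i \<in> S}"

lemma adjoin_subring:
  assumes "is_subring S"
  shows "is_subring (adjoin S y)"
  unfolding is_subring_def
proof (intro conjI ballI)
  show "1 \<in> adjoin S y"
    unfolding adjoin_def using assms
    by (intro CollectI exI[of _ "[:1:]"]) (auto simp: coeff_pCons subring_intros split: nat.splits)
next
  fix a b assume "a \<in> adjoin S y" "b \<in> adjoin S y"
  then obtain p r where pr: "a = poly p y" "b = poly r y" "\<And>i. coeff p i \<in> S" "\<And>i. coeff r i \<in> S"
    unfolding adjoin_def by auto
  show "a - b \<in> adjoin S y"
    unfolding adjoin_def using assms pr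
    by (intro CollectI exI[of _ "p - r"]) (auto simp: subring_intros)
  show "a * b \<in> adjoin S y"
    unfolding adjoin_def using assms pr
    by (intro CollectI exI[of _ "p * r"]) (auto simp: coeff_mult intro!: subring_intros)
qed

lemma subset_adjoin:
  assumes "is_subring S"
  shows "S \<subseteq> adjoin S y" "y \<in> adjoin S y"
proof -
  have "coeff [:0, 1:] i \<in> S" for i
    using assms by (auto simp: coeff_pCons subring_intros split: nat.splits)
  then show "y \<in> adjoin S y"
    unfolding adjoin_def by (intro CollectI exI[of _ "[:0, 1:]"]) auto
  have "coeff [:a:] i \<in> S" if "a \<in> S" for i a
    using assms that by (auto simp: coeff_pCons subring_intros split: nat.splits)
  then show "S \<subseteq> adjoin S y"
    unfolding adjoin_def by (auto intro!: exI[of _ "[:_:]"])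
qed

lemma adjoin_subset: "is_subring R \<Longrightarrow> S \<subseteq> R \<Longrightarrow> y \<in> R \<Longrightarrow> adjoin S y \<subseteq> R"
  unfolding adjoin_def by (auto simp: poly_altdef intro!: subring_intros)

text \<open>The descent step in the construction of a valuation ring that avoids a non-integral element.\<close>

lemma unit_relation_descent:
  fixes y :: "'h::field"
  assumes J: "\<And>a b. a \<in> J \<Longrightarrow> b \<in> J \<Longrightarrow> a - b \<in> J" "\<And>a b. a \<in> J \<Longrightarrow> b \<in> J \<Longrightarrow> a * b \<in> J"
    and a: "\<And>i. a i \<in> J" "1 = (\<Sum>i\<le>Suc k. a i * y ^ i)"
    and b: "\<And>i. b i \<in> J" "1 = (\<Sum>i\<le>Suc k. b i * inverse y ^ i)"
    and y: "y \<noteq> 0"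
  shows "\<exists>c. (\<forall>i. c i \<in> J) \<and> 1 = (\<Sum>i\<le>k. c i * y ^ i)"
proof -
  have J0: "0 \<in> J" using J(1)[OF a(1)[of 0] a(1)[of 0]] by simp
  have Jadd: "s + t \<in> J" if "s \<in> J" "t \<in> J" for s t
    using J(1)[OF that(1) J(1)[OF J0 that(2)]] by simp
  \<comment> \<open>Multiply the \<open>a\<close> relation by \<open>1 - b 0\<close>. The
    \<open>b\<close> relation times \<open>y ^ Suc k\<close> expresses
    \<open>(1 - b 0) * y ^ Suc k\<close> by lower powers; inserting this gives these
    coefficients.\<close>
  define c where "c i = ((if i = 0 then b 0 else 0) + (a i - b 0 * a i)) + b (Suc k - i) * a (Suc k)" for i
  have "c i \<in> J" for i
    unfolding c_def by (intro Jadd J a b) (auto simp: J0 b)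
  have "y ^ Suc k = (\<Sum>i\<le>Suc k. b i * y ^ (Suc k - i))"
  proof -
    have "y ^ Suc k = y ^ Suc k * (\<Sum>i\<le>Suc k. b i * inverse y ^ i)"
      using b(2) by simp
    also have "\<dots> = (\<Sum>i\<le>Suc k. b i * y ^ (Suc k - i))"
      unfolding sum_distrib_left using y
      by (intro sum.cong) (auto simp: power_diff divide_simps)
    finally show ?thesis .
  qed
  also have "\<dots> = (\<Sum>i\<le>Suc k. b (Suc k - i) * y ^ i)"
    using sum.nat_diff_reindex[of "\<lambda>i. b i * y ^ (Suc k - i)" "Suc (Suc k)"]
    unfolding lessThan_Suc_atMost[symmetric] by (auto intro!: sum.cong)
  also have "\<dots> = (\<Sum>i\<le>k. b (Suc k - i) * y ^ i) + b 0 * y ^ Suc k"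
    by simp
  finally have *: "(\<Sum>i\<le>k. b (Suc k - i) * y ^ i) = (1 - b 0) * y ^ Suc k"
    unfolding left_diff_distrib mult_1 by (metis add_diff_cancel_right')
  have **: "(\<Sum>i\<le>k. a i * y ^ i) = 1 - a (Suc k) * y ^ Suc k"
    using a(2) by (simp add: eq_diff_eq del: power_Suc)
  have "(\<Sum>i\<le>k. c i * y ^ i) = (\<Sum>i\<le>k. (if i = 0 then b 0 else 0) * y ^ i)
      + (1 - b 0) * (\<Sum>i\<le>k. a i * y ^ i) + a (Suc k) * (\<Sum>i\<le>k. b (Suc k - i) * y ^ i)"
    unfolding c_def sum_distrib_left sum.distrib[symmetric]
    by (intro sum.cong) (auto simp: algebra_simps)
  also have "(\<Sum>i\<le>k. (if i = 0 then b 0 else 0) * y ^ i) = (\<Sum>i\<le>k. if i = 0 then b 0 else 0)"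
    by (intro sum.cong) auto
  also have "\<dots> = b 0" by simp
  also have "b 0 + (1 - b 0) * (\<Sum>i\<le>k. a i * y ^ i) + a (Suc k) * (\<Sum>i\<le>k. b (Suc k - i) * y ^ i) = 1"
    unfolding * ** by (simp add: algebra_simps)
  finally show ?thesis
    using \<open>\<And>i. c i \<in> J\<close> by (intro exI[of _ c]) auto
qed

text \<open>The longer of the two relations can be shortened by the descent, the shorter one being
  padded with zeros, until one of them has length 0 and puts 1 into \<open>J\<close>.\<close>

lemma unit_relations_contradiction:
  fixes y :: "'h::field"
  assumes J: "\<And>a b. a \<in> J \<Longrightarrow> b \<in> J \<Longrightarrow> a - b \<in> J" "\<And>a b. a \<in> J \<Longrightarrow> b \<in> J \<Longrightarrow> a * b \<in> J"
    and "1 \<notin> J" "y \<noteq> 0"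
    and a: "\<And>i. a i \<in> J" "1 = (\<Sum>i\<le>n. a i * y ^ i)"
    and b: "\<And>i. b i \<in> J" "1 = (\<Sum>i\<le>m. b i * inverse y ^ i)"
  shows False
proof -
  define G where "G y n \<longleftrightarrow> (\<exists>a. (\<forall>i. a i \<in> J) \<and> 1 = (\<Sum>i\<le>n. a i * y ^ i))" for y :: 'h and n
  have J0: "0 \<in> J" using J(1)[OF a(1)[of 0] a(1)[of 0]] by simp
  have mono: "G y n'" if "G y n" "n \<le> n'" for y n n'
  proof -
    obtain a where a: "\<And>i. a i \<in> J" "1 = (\<Sum>i\<le>n. a i * y ^ i)"
      using \<open>G y n\<close> unfolding G_def by auto
    have "(\<Sum>i\<le>n'. (if i \<le> n then a i else 0) * y ^ i) = (\<Sum>i\<le>n. a i * y ^ i)"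
      using \<open>n \<le> n'\<close> by (intro sum.mono_neutral_cong_right) auto
    then show ?thesis
      unfolding G_def using a J0 by (intro exI[of _ "\<lambda>i. if i \<le> n then a i else 0"]) auto
  qed
  have no0: "\<not> G y 0" for y
  proof
    assume "G y 0"
    then obtain a where "\<And>i. a i \<in> J" "1 = a (0::nat)" unfolding G_def by auto
    with \<open>1 \<notin> J\<close> show False by metis
  qed
  have desc: "G y k" if "G y (Suc k)" "G (inverse y) (Suc k)" "y \<noteq> 0" for y k
  proof -
    obtain a where a: "\<And>i. a i \<in> J" "1 = (\<Sum>i\<le>Suc k. a i * y ^ i)"
      using \<open>G y (Suc k)\<close> unfolding G_def by metis
    obtain b where b: "\<And>i. b i \<in> J" "1 = (\<Sum>i\<le>Suc k. b i * inverse y ^ i)"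
      using \<open>G (inverse y) (Suc k)\<close> unfolding G_def by metis
    show ?thesis
      unfolding G_def by (rule unit_relation_descent[OF J a b \<open>y \<noteq> 0\<close>])
  qed
  have "\<not> (G y n \<and> G (inverse y) m \<and> y \<noteq> 0)" for y n m
  proof (induction "n + m" arbitrary: y n m rule: less_induct)
    case less
    show ?case
    proof
      assume H: "G y n \<and> G (inverse y) m \<and> y \<noteq> 0"
      then obtain n' m' where n: "n = Suc n'" and m: "m = Suc m'"
        using no0 by (metis not0_implies_Suc)
      show False
      proof (cases "m \<le> n")
        case True
        then have "G y n'" using H mono[of "inverse y" m n] desc[of y n'] n by auto
        with less[of n' m y] H n show False by auto
      next
        case False
        then have "G (inverse y) m'"
          using H mono[of y n m] desc[of "inverse y" m'] m by auto
        with less[of n m' y] H m show False by auto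
      qed
    qed
  qed
  then show False
    using a b \<open>y \<noteq> 0\<close> unfolding G_def by blast
qed

text \<open>Multiplying \<open>z = poly p (inverse z)\<close> by a power of \<open>z\<close> gives a
  monic equation, so the last hypothesis says that \<open>z\<close> is not integral over
  \<open>A\<close>. This is the classical fact that the integral closure is an intersection of
  valuation rings.\<close>

theorem valuation_subring_exists:
  fixes z :: "'h::field"
  assumes F: "is_subfield F" and A: "is_subring A" and "A \<subseteq> F" "z \<in> F"
    and z: "z \<notin> adjoin A (inverse z)"
  shows "\<exists>R. is_subring R \<and> A \<subseteq> R \<and> R \<subseteq> F \<and> z \<notin> R \<and> (\<forall>y\<in>F. y \<in> R \<or> inverse y \<in> R)"
proof -
  \<comment> \<open>Having \<open>inverse z\<close> in the ring but not \<open>z\<close> makes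
    \<open>inverse z\<close> a nonunit, so it generates a proper ideal, the \<open>J\<close>
    below.\<close>
  define C where "C = {S. is_subring S \<and> A \<subseteq> S \<and> S \<subseteq> F \<and> inverse z \<in> S \<and> z \<notin> S}"
  have "adjoin A (inverse z) \<in> C"
    unfolding C_def using assms adjoin_subring subset_adjoin[OF A]
      adjoin_subset[OF subfield_subring[OF F] \<open>A \<subseteq> F\<close> subfield_inverse[OF F \<open>z \<in> F\<close>]]
    by simp
  then have "C \<noteq> {}" by auto
  have "\<Union>X \<in> C" if "X \<noteq> {}" "subset.chain C X" for X
  proof -
    have sub: "X \<subseteq> C" and lin: "\<And>S T. S \<in> X \<Longrightarrow> T \<in> X \<Longrightarrow> S \<subseteq> T \<or> T \<subseteq> S"
      using that(2) unfolding subset.chain_def by blast+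
    have "is_subring (\<Union>X)"
      unfolding is_subring_def
    proof (intro conjI ballI)
      obtain S where "S \<in> X" using \<open>X \<noteq> {}\<close> by auto
      then show "1 \<in> \<Union>X" using sub subring_1[of S] unfolding C_def by auto
    next
      fix a b assume "a \<in> \<Union>X" "b \<in> \<Union>X"
      then obtain S where "S \<in> X" "a \<in> S" "b \<in> S"
        using lin by (metis UnionE subsetD)
      moreover from this sub have "is_subring S" unfolding C_def by auto
      ultimately show "a - b \<in> \<Union>X" "a * b \<in> \<Union>X"
        by (auto intro: subring_intros)
    qed
    with \<open>X \<noteq> {}\<close> sub show ?thesis unfolding C_def by blast
  qed
  from subset_Zorn_nonempty[OF \<open>C \<noteq> {}\<close> this]
  obtain R where RC: "R \<in> C" and max: "\<And>S. S \<in> C \<Longrightarrow> R \<subseteq> S \<Longrightarrow> S = R"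
    by blast
  then have R: "is_subring R" "A \<subseteq> R" "R \<subseteq> F" "inverse z \<in> R" "z \<notin> R"
    unfolding C_def by auto
  have "z \<noteq> 0" using R subring_0 by auto
  define J where "J = (\<lambda>s. inverse z * s) ` R"
  have J: "a - b \<in> J" "a * b \<in> J" if "a \<in> J" "b \<in> J" for a b
  proof -
    from that obtain s t where st: "a = inverse z * s" "b = inverse z * t" "s \<in> R" "t \<in> R"
      unfolding J_def by auto
    have "a - b = inverse z * (s - t)" "a * b = inverse z * (inverse z * s * t)"
      by (auto simp: st algebra_simps)
    with st R show "a - b \<in> J" "a * b \<in> J"
      unfolding J_def by (auto simp: subring_intros)
  qed
  have "1 \<notin> J"
  proof
    assume "1 \<in> J"
    then obtain s where "s \<in> R" "1 = inverse z * s"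
      unfolding J_def by auto
    then have "s = z" using \<open>z \<noteq> 0\<close> by (simp add: field_simps)
    with \<open>s \<in> R\<close> \<open>z \<notin> R\<close> show False by simp
  qed
  \<comment> \<open>By maximality, adjoining any new \<open>y\<close> captures \<open>z\<close>.
    Dividing the resulting \<open>z = poly p y\<close> by \<open>z\<close> moves the coefficients
    into \<open>J\<close>.\<close>
  have rel: "\<exists>a n. (\<forall>i. a i \<in> J) \<and> 1 = (\<Sum>i\<le>n. a i * y ^ i)" if "y \<in> F" "y \<notin> R" for y
  proof -
    have "R \<subseteq> adjoin R y" "y \<in> adjoin R y"
      using subset_adjoin[OF R(1)] by auto
    moreover have "adjoin R y \<subseteq> F"
      using adjoin_subset[OF subfield_subring[OF F] \<open>R \<subseteq> F\<close> \<open>y \<in> F\<close>] .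
    ultimately have "z \<in> adjoin R y"
      using max[of "adjoin R y"] adjoin_subring[OF R(1), of y] \<open>y \<notin> R\<close> R unfolding C_def by auto
    then obtain p where p: "z = poly p y" "\<And>i. coeff p i \<in> R"
      unfolding adjoin_def by auto
    have "1 = inverse z * poly p y"
      using p \<open>z \<noteq> 0\<close> by simp
    also have "\<dots> = (\<Sum>i\<le>degree p. inverse z * coeff p i * y ^ i)"
      by (simp add: poly_altdef sum_distrib_left mult.assoc)
    finally show ?thesis
      using p by (intro exI[of _ "\<lambda>i. inverse z * coeff p i"] exI[of _ "degree p"]) (auto simp: J_def)
  qed
  have "y \<in> R \<or> inverse y \<in> R" if "y \<in> F" for y
  proof (rule ccontr)
    assume *: "\<not> (y \<in> R \<or> inverse y \<in> R)"
    then have "y \<noteq> 0" using R subring_0 by auto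
    obtain a n where a: "\<And>i. a i \<in> J" "1 = (\<Sum>i\<le>n. a i * y ^ i)"
      using rel[OF \<open>y \<in> F\<close>] * by auto
    obtain b m where b: "\<And>i. b i \<in> J" "1 = (\<Sum>i\<le>m. b i * inverse y ^ i)"
      using rel[of "inverse y"] * \<open>y \<in> F\<close> F by (auto simp: subfield_intros)
    show False
      by (rule unit_relations_contradiction[OF J \<open>1 \<notin> J\<close> \<open>y \<noteq> 0\<close> a b])
  qed
  with R show ?thesis by blast
qed

section \<open>Counting in finite residue rings\<close>

text \<open>The counting form of rank-nullity: translating a fibre of \<open>h\<close> by one of its
  elements embeds it into \<open>V0\<close>.\<close>

lemma card_le_card_mult_fibre:
  fixes V V0 :: "'a::ab_group_add set"
  assumes "finite X" "h ` V \<subseteq> X" "finite V0"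
    and "\<And>a b. a \<in> V \<Longrightarrow> b \<in> V \<Longrightarrow> h a = h b \<Longrightarrow> a - b \<in> V0"
  shows "finite V" "card V \<le> card X * card V0"
proof -
  have fib: "finite {a \<in> V. h a = x} \<and> card {a \<in> V. h a = x} \<le> card V0" for x
  proof (cases "{a \<in> V. h a = x} = {}")
    case False
    then obtain b where b: "b \<in> V" "h b = x" by auto
    have inj: "inj_on (\<lambda>a. a - b) {a \<in> V. h a = x}"
      by (auto simp: inj_on_def)
    have im: "(\<lambda>a. a - b) ` {a \<in> V. h a = x} \<subseteq> V0"
      using assms(4) b by auto
    show ?thesis
      using inj im \<open>finite V0\<close> by (meson card_inj_on_le finite_imageD finite_subset)
  next
    case True
    then show ?thesis by (metis card.empty finite.emptyI le0)
  qed
  have V: "V = (\<Union>x\<in>X. {a \<in> V. h a = x})"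
    using assms(2) by auto
  show "finite V"
    by (subst V) (use assms(1) fib in auto)
  have "card V \<le> (\<Sum>x\<in>X. card {a \<in> V. h a = x})"
    by (subst V) (rule card_UN_le[OF assms(1)])
  also have "\<dots> \<le> (\<Sum>x\<in>X. card V0)"
    using fib by (intro sum_mono) auto
  finally show "card V \<le> card X * card V0" by simp
qed

text \<open>Lower bounds for the size of the quotient of \<open>R\<close> by the ideal
  \<open>f R\<close> are expressed by such sets, without forming the quotient.\<close>

definition incongruent :: "'h::field set \<Rightarrow> 'h \<Rightarrow> 'h set \<Rightarrow> bool" where
  "incongruent R f Z \<longleftrightarrow> Z \<subseteq> R \<and> (\<forall>z\<in>Z. \<forall>z'\<in>Z. z - z' \<in> (\<lambda>r. f * r) ` R \<longrightarrow> z = z')"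

lemma incongruentD:
  "incongruent R f Z \<Longrightarrow> z \<in> Z \<Longrightarrow> z' \<in> Z \<Longrightarrow> r \<in> R \<Longrightarrow> z - z' = f * r \<Longrightarrow> z = z'"
  unfolding incongruent_def by blast

lemma incongruent_mult:
  assumes "is_subring R" "s \<in> R" "incongruent R t Z"
  shows "incongruent R (t * s) Z"
proof -
  have "(\<lambda>r. t * s * r) ` R \<subseteq> (\<lambda>r. t * r) ` R"
    using subring_mult[OF assms(1,2)] by (auto simp: mult.assoc)
  then show ?thesis using assms(3) unfolding incongruent_def by blast
qed

primrec digit_sums :: "'h::field \<Rightarrow> 'h set \<Rightarrow> nat \<Rightarrow> 'h set" where
  "digit_sums f Z 0 = {0}"
| "digit_sums f Z (Suc N) = (\<lambda>(z, y). z + f * y) ` (Z \<times> digit_sums f Z N)"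

text \<open>The lowest digit is determined modulo \<open>f\<close>; after it is cancelled, one
  factor \<open>f\<close> can be divided out and the induction hypothesis applies to the remaining
  digits.\<close>

lemma digit_sums:
  assumes R: "is_subring R" and f: "f \<in> R" "f \<noteq> 0" and Z: "finite Z" "incongruent R f Z"
  shows "finite (digit_sums f Z N) \<and> incongruent R (f ^ N) (digit_sums f Z N)
    \<and> card (digit_sums f Z N) = card Z ^ N"
proof (induction N)
  case 0
  then show ?case using R by (auto simp: incongruent_def subring_0)
next
  case (Suc N)
  let ?D = "digit_sums f Z N"
  have ZR: "Z \<subseteq> R" and DR: "?D \<subseteq> R" using Z Suc by (auto simp: incongruent_def)
  have key: "z = z' \<and> y = y'"
    if "z \<in> Z" "z' \<in> Z" "y \<in> ?D" "y' \<in> ?D" "r \<in> R" "(z + f * y) - (z' + f * y') = f ^ Suc N * r"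
    for z z' y y' r
  proof -
    have "z - z' = f * (f ^ N * r - (y - y'))"
      using that by (simp add: algebra_simps)
    moreover have "f ^ N * r - (y - y') \<in> R"
      using that DR R f by (auto intro!: subring_intros)
    ultimately have "z = z'"
      using that incongruentD[OF Z(2)] by blast
    then have "f * (y - y') = f * (f ^ N * r)"
      using that(6) by (simp add: algebra_simps)
    then have "y - y' = f ^ N * r"
      using f by simp
    then have "y = y'"
      using that incongruentD[of R "f ^ N" ?D] Suc by blast
    with \<open>z = z'\<close> show ?thesis by simp
  qed
  have "inj_on (\<lambda>(z, y). z + f * y) (Z \<times> ?D)"
  proof (rule inj_onI, clarify)
    fix z y z' y' assume "z \<in> Z" "y \<in> ?D" "z' \<in> Z" "y' \<in> ?D" "z + f * y = z' + f * y'"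
    then show "z = z' \<and> y = y'"
      using key[of z z' y y' 0] R by (simp add: subring_0)
  qed
  then have "card (digit_sums f Z (Suc N)) = card Z ^ Suc N"
    using Suc by (simp add: card_image card_cartesian_product)
  moreover have "incongruent R (f ^ Suc N) (digit_sums f Z (Suc N))"
    unfolding incongruent_def
  proof (intro conjI ballI impI)
    show "digit_sums f Z (Suc N) \<subseteq> R"
      using ZR DR R f by (auto intro!: subring_intros)
  next
    fix a b assume ab: "a \<in> digit_sums f Z (Suc N)" "b \<in> digit_sums f Z (Suc N)"
      and "a - b \<in> (\<lambda>r. f ^ Suc N * r) ` R"
    then obtain r where r: "r \<in> R" "a - b = f ^ Suc N * r" by auto
    from ab obtain z y z' y' where *: "z \<in> Z" "y \<in> ?D" "z' \<in> Z" "y' \<in> ?D"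
      and ab': "a = z + f * y" "b = z' + f * y'" by auto
    have "z = z' \<and> y = y'" by (rule key[of z z' y y' r]) (use * r ab' in auto)
    then show "a = b" by (simp add: ab')
  qed
  ultimately show ?case
    using Suc Z by auto
qed

lemma power_le_const_mult_power:
  fixes a b c :: nat
  assumes "\<And>n. a ^ n \<le> c * b ^ n" "b > 0"
  shows "a \<le> b"
proof (rule ccontr)
  assume "\<not> a \<le> b"
  define x where "x = real a / real b"
  have "x > 1" using \<open>\<not> a \<le> b\<close> \<open>b > 0\<close> by (simp add: x_def)
  then obtain n where "real c < x ^ n"
    using real_arch_pow by blast
  moreover have "x ^ n \<le> real c"
  proof -
    have "real a ^ n \<le> real c * real b ^ n"
      using assms(1)[of n] by (metis of_nat_le_iff of_nat_mult of_nat_power)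
    then show ?thesis
      using \<open>b > 0\<close> by (simp add: x_def power_divide divide_simps)
  qed
  ultimately show False by simp
qed

text \<open>A set of largest size represents every class, since an element of a missing class could
  be added to it.\<close>

lemma maximal_incongruent_set:
  assumes R: "is_subring R" and bound: "\<And>Z. finite Z \<Longrightarrow> incongruent R f Z \<Longrightarrow> card Z \<le> M"
  shows "\<exists>Z. finite Z \<and> incongruent R f Z \<and> (\<forall>r\<in>R. \<exists>z\<in>Z. r - z \<in> (\<lambda>r. f * r) ` R)"
proof -
  define Q where "Q n \<longleftrightarrow> (\<exists>Z. finite Z \<and> incongruent R f Z \<and> card Z = n)" for n
  have "Q 0" unfolding Q_def incongruent_def by (rule exI[of _ "{}"]) auto
  moreover have "n \<le> M" if "Q n" for n using that bound unfolding Q_def by blast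
  ultimately obtain n where "Q n" and nmax: "\<And>k. Q k \<Longrightarrow> k \<le> n"
    using Nat.ex_has_greatest_nat[of Q 0 M] by blast
  then obtain Z where Z: "finite Z" "incongruent R f Z" "card Z = n" unfolding Q_def by auto
  have "\<exists>z\<in>Z. r - z \<in> (\<lambda>r. f * r) ` R" if "r \<in> R" for r
  proof (rule ccontr)
    assume *: "\<not> (\<exists>z\<in>Z. r - z \<in> (\<lambda>r. f * r) ` R)"
    have "0 \<in> (\<lambda>r. f * r) ` R" using R subring_0 by force
    then have "r \<notin> Z" using * by (metis diff_self)
    have sym: "z - r \<notin> (\<lambda>r. f * r) ` R" if "z \<in> Z" for z
    proof
      assume "z - r \<in> (\<lambda>r. f * r) ` R"
      then obtain s where "s \<in> R" "z - r = f * s" by auto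
      then have "r - z = f * (- s)" "- s \<in> R"
        using R by (auto simp: subring_intros algebra_simps)
      with * that show False by blast
    qed
    have "incongruent R f (insert r Z)"
      using Z(2) * sym \<open>r \<in> R\<close> unfolding incongruent_def by blast
    then have "Q (Suc n)"
      unfolding Q_def using Z \<open>r \<notin> Z\<close> by (intro exI[of _ "insert r Z"]) auto
    with nmax[of "Suc n"] show False by simp
  qed
  with Z show ?thesis by blast
qed

section \<open>Dimensions and residue degrees as cardinalities\<close>

definition lin_comb :: "('k::field \<Rightarrow> 'h::field) \<Rightarrow> 'h set \<Rightarrow> ('h \<Rightarrow> 'k) \<Rightarrow> 'h" where
  "lin_comb \<iota> B a = (\<Sum>b\<in>B. \<iota> (a b) * b)"

lemma lin_comb_diff:
  "const_embedding \<iota> \<Longrightarrow> lin_comb \<iota> B a - lin_comb \<iota> B c = lin_comb \<iota> B (\<lambda>b. a b - c b)"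
  unfolding lin_comb_def sum_subtractf[symmetric]
  by (simp add: const_embedding_simps algebra_simps)

lemma lin_comb_cong: "(\<And>b. b \<in> B \<Longrightarrow> a b = c b) \<Longrightarrow> lin_comb \<iota> B a = lin_comb \<iota> B c"
  unfolding lin_comb_def by (auto intro!: sum.cong)

lemma card_lin_comb:
  fixes \<iota> :: "'k::{field,finite} \<Rightarrow> 'h::field"
  assumes "finite B" "const_embedding \<iota>"
    and inj: "\<And>a. lin_comb \<iota> B a \<in> P \<Longrightarrow> \<forall>b\<in>B. a b = 0" and "0 \<in> P"
  shows "card (range (lin_comb \<iota> B)) = CARD('k) ^ card B" "finite (range (lin_comb \<iota> B))"
proof -
  have eq: "range (lin_comb \<iota> B) = lin_comb \<iota> B ` (B \<rightarrow>\<^sub>E UNIV)"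
  proof -
    have "lin_comb \<iota> B a = lin_comb \<iota> B (restrict a B)" for a
      by (rule lin_comb_cong) auto
    then show ?thesis by fastforce
  qed
  have inj': "inj_on (lin_comb \<iota> B) (B \<rightarrow>\<^sub>E UNIV)"
  proof (rule inj_onI)
    fix a c assume *: "a \<in> B \<rightarrow>\<^sub>E UNIV" "c \<in> B \<rightarrow>\<^sub>E UNIV" "lin_comb \<iota> B a = lin_comb \<iota> B c"
    then have "\<forall>b\<in>B. a b - c b = 0"
      using inj[of "\<lambda>b. a b - c b"] \<open>0 \<in> P\<close> lin_comb_diff[OF assms(2), of B a c] by simp
    with * show "a = c" by (intro PiE_ext) auto
  qed
  show "card (range (lin_comb \<iota> B)) = CARD('k) ^ card B"
    unfolding eq using card_image[OF inj'] \<open>finite B\<close> by (simp add: card_PiE)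
  show "finite (range (lin_comb \<iota> B))"
    unfolding eq using \<open>finite B\<close> by (intro finite_imageI finite_PiE) auto
qed

text \<open>The bridge between \<open>vector_space.dim\<close>, in which \<open>ell\<close> is
  defined, and the counting arguments.\<close>

lemma card_eq_power_dim:
  fixes \<iota> :: "'k::{field,finite} \<Rightarrow> 'h::field"
  assumes \<iota>: "const_embedding \<iota>" and "finite L" "0 \<in> L"
    and "\<And>a b. a \<in> L \<Longrightarrow> b \<in> L \<Longrightarrow> a + b \<in> L" "\<And>c a. a \<in> L \<Longrightarrow> \<iota> c * a \<in> L"
  shows "card L = CARD('k) ^ vector_space.dim (\<lambda>a z. \<iota> a * z) L"
proof -
  interpret vector_space "\<lambda>a z. \<iota> a * z"
    using \<iota> by (rule vector_space_const_embedding)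
  have sub: "subspace L"
    using assms unfolding subspace_def by auto
  obtain B where B: "B \<subseteq> L" "independent B" "L \<subseteq> span B" "card B = dim L"
    using basis_exists[of L] by metis
  have fB: "finite B" using B \<open>finite L\<close> finite_subset by blast
  have "L = span B" using B sub by (metis span_minimal subset_antisym)
  also have "span B = range (lin_comb \<iota> B)"
    unfolding span_finite[OF fB] lin_comb_def ..
  finally have "L = range (lin_comb \<iota> B)" .
  moreover have "card (range (lin_comb \<iota> B)) = CARD('k) ^ card B"
  proof (rule card_lin_comb(1)[OF fB \<iota>, of "{0}"])
    fix a assume "lin_comb \<iota> B a \<in> {0}"
    then show "\<forall>b\<in>B. a b = 0"
      using B(2) fB unfolding lin_comb_def dependent_finite[OF fB] by blast
  qed simp
  ultimately show ?thesis using B by simp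
qed

definition residue_system :: "'h::field set \<Rightarrow> 'h set \<Rightarrow> 'h set \<Rightarrow> bool" where
  "residue_system R P T \<longleftrightarrow> finite T \<and> T \<subseteq> R \<and> (\<forall>z\<in>R. \<exists>t\<in>T. z - t \<in> P) \<and>
     (\<forall>s\<in>T. \<forall>t\<in>T. s - t \<in> P \<longrightarrow> s = t)"

lemma residue_system_card_unique:
  assumes "residue_system R P T" "residue_system R P T'"
    and P: "\<And>a b. a \<in> P \<Longrightarrow> b \<in> P \<Longrightarrow> a - b \<in> P"
  shows "card T = card T'"
proof -
  have le: "card T \<le> card T'" if T: "residue_system R P T" "residue_system R P T'" for T T'
  proof -
    have "\<forall>t\<in>T. \<exists>s\<in>T'. t - s \<in> P"
      using T unfolding residue_system_def by blast
    then obtain h where h: "\<And>t. t \<in> T \<Longrightarrow> h t \<in> T' \<and> t - h t \<in> P" by metis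
    have "inj_on h T"
    proof (rule inj_onI)
      fix s t assume *: "s \<in> T" "t \<in> T" "h s = h t"
      then have "(s - h s) - (t - h t) \<in> P" using h P by blast
      then have "s - t \<in> P" using * by simp
      with * T show "s = t" unfolding residue_system_def by blast
    qed
    then show ?thesis
      using h T unfolding residue_system_def by (meson card_inj_on_le image_subsetI)
  qed
  show ?thesis using le[OF assms(1,2)] le[OF assms(2,1)] by simp
qed

text \<open>Turns a residue degree into the size of a system of representatives. Since two such
  systems are equinumerous, \<open>place_degree\<close> is well defined.\<close>

lemma residue_basis_imp_system:
  fixes \<iota> :: "'k::{field,finite} \<Rightarrow> 'h::field"
  assumes \<iota>: "const_embedding \<iota>" and B: "residue_basis \<iota> F P B"
    and R: "is_subring (val_ring F P)" "range \<iota> \<subseteq> val_ring F P" and "0 \<in> P"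
  shows "residue_system (val_ring F P) P (range (lin_comb \<iota> B))"
    "card (range (lin_comb \<iota> B)) = CARD('k) ^ card B"
proof -
  have fB: "finite B" and BR: "B \<subseteq> val_ring F P"
    and span: "\<And>z. z \<in> val_ring F P \<Longrightarrow> \<exists>a. z - lin_comb \<iota> B a \<in> P"
    and ind: "\<And>a. lin_comb \<iota> B a \<in> P \<Longrightarrow> \<forall>b\<in>B. a b = 0"
    using B unfolding residue_basis_def lin_comb_def by auto
  show "card (range (lin_comb \<iota> B)) = CARD('k) ^ card B"
    by (rule card_lin_comb(1)[OF fB \<iota> ind \<open>0 \<in> P\<close>])
  have "lin_comb \<iota> B a \<in> val_ring F P" for a
    unfolding lin_comb_def using R BR by (auto intro!: subring_intros)
  moreover have "s = t" if "s \<in> range (lin_comb \<iota> B)" "t \<in> range (lin_comb \<iota> B)" "s - t \<in> P" for s t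
  proof -
    from that obtain a c where ac: "s = lin_comb \<iota> B a" "t = lin_comb \<iota> B c" by auto
    then have "lin_comb \<iota> B (\<lambda>b. a b - c b) \<in> P"
      using that lin_comb_diff[OF \<iota>, of B a c] by simp
    then have "\<forall>b\<in>B. a b - c b = 0"
      by (rule ind)
    then show ?thesis unfolding ac by (intro lin_comb_cong) auto
  qed
  ultimately show "residue_system (val_ring F P) P (range (lin_comb \<iota> B))"
    unfolding residue_system_def
    using span card_lin_comb(2)[OF fB \<iota> ind \<open>0 \<in> P\<close>] by blast
qed

text \<open>A generating set of least size is a basis: a nontrivial relation modulo \<open>P\<close>
  would allow one generator to be dropped. Generators exist because \<open>X\<close> meets every
  residue class.\<close>

lemma residue_basis_exists:
  fixes \<iota> :: "'k::{field,finite} \<Rightarrow> 'h::field"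
  assumes \<iota>: "const_embedding \<iota>"
    and R: "is_subring (val_ring F P)" "range \<iota> \<subseteq> val_ring F P"
    and P: "\<And>a b. a \<in> P \<Longrightarrow> b \<in> P \<Longrightarrow> a - b \<in> P" "\<And>a r. a \<in> P \<Longrightarrow> r \<in> val_ring F P \<Longrightarrow> r * a \<in> P"
    and X: "finite X" "X \<subseteq> val_ring F P" "\<And>z. z \<in> val_ring F P \<Longrightarrow> \<exists>x\<in>X. z - x \<in> P"
  shows "\<exists>B. residue_basis \<iota> F P B"
proof -
  define Q where "Q B \<longleftrightarrow> finite B \<and> B \<subseteq> val_ring F P \<and>
    (\<forall>z\<in>val_ring F P. \<exists>a. z - lin_comb \<iota> B a \<in> P)" for B
  have "Q X"
    unfolding Q_def
  proof (intro conjI ballI)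
    fix z assume "z \<in> val_ring F P"
    then obtain x where x: "x \<in> X" "z - x \<in> P" using X by blast
    have "lin_comb \<iota> X (\<lambda>b. if b = x then 1 else 0) = (\<Sum>b\<in>X. if b = x then b else 0)"
      unfolding lin_comb_def by (rule sum.cong) (auto simp: const_embedding_simps[OF \<iota>])
    also have "\<dots> = x" using X x by simp
    finally show "\<exists>a. z - lin_comb \<iota> X a \<in> P" using x by metis
  qed (use X in auto)
  then obtain B where B: "Q B" and min: "\<And>B'. Q B' \<Longrightarrow> card B \<le> card B'"
    using ex_has_least_nat[of Q X card] by blast
  then have fB: "finite B" and BR: "B \<subseteq> val_ring F P"
    and span: "\<And>z. z \<in> val_ring F P \<Longrightarrow> \<exists>a. z - lin_comb \<iota> B a \<in> P"
    unfolding Q_def by auto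
  have ind: "\<forall>b\<in>B. a b = 0" if a: "lin_comb \<iota> B a \<in> P" for a
  proof (rule ccontr)
    assume "\<not> (\<forall>b\<in>B. a b = 0)"
    then obtain b0 where b0: "b0 \<in> B" "a b0 \<noteq> 0" by auto
    have "Q (B - {b0})"
      unfolding Q_def
    proof (intro conjI ballI)
      fix z assume "z \<in> val_ring F P"
      then obtain c where c: "z - lin_comb \<iota> B c \<in> P" using span by blast
      \<comment> \<open>Chosen so that adding \<open>\<iota> e\<close> times the relation kills the
        coefficient of \<open>b0\<close>.\<close>
      define e where "e = - (c b0 / a b0)"
      have "z - lin_comb \<iota> B c - \<iota> e * lin_comb \<iota> B a \<in> P"
        using P c a R by blast
      moreover have "lin_comb \<iota> B c + \<iota> e * lin_comb \<iota> B a = lin_comb \<iota> (B - {b0}) (\<lambda>b. c b + e * a b)"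
      proof -
        have "lin_comb \<iota> B c + \<iota> e * lin_comb \<iota> B a = (\<Sum>b\<in>B. \<iota> (c b + e * a b) * b)"
          unfolding lin_comb_def sum_distrib_left sum.distrib[symmetric]
          by (intro sum.cong) (auto simp: const_embedding_simps[OF \<iota>] algebra_simps)
        also have "\<dots> = \<iota> (c b0 + e * a b0) * b0 + (\<Sum>b\<in>B - {b0}. \<iota> (c b + e * a b) * b)"
          by (rule sum.remove[OF fB b0(1)])
        also have "c b0 + e * a b0 = 0" using b0 by (simp add: e_def)
        finally show ?thesis by (simp add: lin_comb_def const_embedding_simps[OF \<iota>])
      qed
      ultimately show "\<exists>a. z - lin_comb \<iota> (B - {b0}) a \<in> P"
        by (metis diff_diff_eq)
    qed (use fB BR in auto)
    from min[OF this] show False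
      using b0 fB by (metis card_Diff1_less linorder_not_less)
  qed
  show ?thesis
    using fB BR span ind unfolding residue_basis_def lin_comb_def by blast
qed

section \<open>Discrete places and weak approximation\<close>

definition level :: "'h::field set \<Rightarrow> ('h \<Rightarrow> int) \<Rightarrow> int \<Rightarrow> 'h set" where
  "level F v k = {z \<in> F. z = 0 \<or> v z \<ge> k}"

locale discrete_place =
  fixes F P :: "'h::field set" and v :: "'h \<Rightarrow> int"
  assumes F: "is_subfield F"
    and v_mult: "\<And>a b. a \<in> F \<Longrightarrow> a \<noteq> 0 \<Longrightarrow> b \<in> F \<Longrightarrow> b \<noteq> 0 \<Longrightarrow> v (a * b) = v a + v b"
    and uniformizer: "\<exists>t\<in>F. t \<noteq> 0 \<and> v t = 1"
    and val_ring_eq: "val_ring F P = level F v 0"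
    and place_eq: "P = level F v 1"
    and val_ring_subring: "is_subring (val_ring F P)"
begin

lemma mem_val_ring: "z \<in> val_ring F P \<longleftrightarrow> z \<in> F \<and> (z = 0 \<or> v z \<ge> 0)"
  unfolding val_ring_eq level_def by simp

lemma mem_place: "z \<in> P \<longleftrightarrow> z \<in> F \<and> (z = 0 \<or> v z \<ge> 1)"
  by (subst place_eq) (simp add: level_def)

lemma v_1: "v 1 = 0"
  using v_mult[of 1 1] F by (simp add: subfield_intros)

lemma v_inverse: "a \<in> F \<Longrightarrow> a \<noteq> 0 \<Longrightarrow> v (inverse a) = - v a"
  using v_mult[of a "inverse a"] F v_1 by (simp add: subfield_intros)

lemma v_divide: "a \<in> F \<Longrightarrow> a \<noteq> 0 \<Longrightarrow> b \<in> F \<Longrightarrow> b \<noteq> 0 \<Longrightarrow> v (a / b) = v a - v b"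
  using v_mult[of a "inverse b"] F v_inverse by (simp add: subfield_intros divide_inverse)

lemma v_power: "a \<in> F \<Longrightarrow> a \<noteq> 0 \<Longrightarrow> v (a ^ n) = int n * v a"
  by (induction n) (auto simp: v_1 v_mult subfield_intros[OF F] algebra_simps)

lemma v_powi: "a \<in> F \<Longrightarrow> a \<noteq> 0 \<Longrightarrow> v (a powi n) = n * v a"
  by (auto simp: power_int_def v_power v_inverse subfield_intros[OF F])

lemma level_0: "0 \<in> level F v k"
  using F by (auto simp: level_def subfield_intros)

lemma level_mono: "a \<in> level F v k \<Longrightarrow> l \<le> k \<Longrightarrow> a \<in> level F v l"
  by (auto simp: level_def)

lemma level_mult: "a \<in> level F v k \<Longrightarrow> b \<in> level F v l \<Longrightarrow> a * b \<in> level F v (k + l)"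
  using F by (cases "a = 0 \<or> b = 0") (auto simp: level_def subfield_intros v_mult)

text \<open>The ultrametric inequality is a consequence of the locale assumptions: scaling by a
  power of a uniformizer reduces it to the valuation ring, which is closed under
  subtraction.\<close>

lemma level_diff:
  assumes "a \<in> level F v k" "b \<in> level F v k"
  shows "a - b \<in> level F v k"
proof -
  obtain t where t: "t \<in> F" "t \<noteq> 0" "v t = 1" using uniformizer by auto
  have u: "t powi n \<in> level F v n" for n
    using t F by (auto simp: level_def v_powi subfield_intros)
  have "t powi (-k) * a \<in> level F v 0" "t powi (-k) * b \<in> level F v 0"
    using level_mult[OF u[of "-k"] assms(1)] level_mult[OF u[of "-k"] assms(2)] by auto
  then have "t powi (-k) * a - t powi (-k) * b \<in> level F v 0"
    using val_ring_subring unfolding val_ring_eq by (rule subring_diff[rotated])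
  from level_mult[OF u[of k] this]
  have "t powi k * (t powi (-k) * (a - b)) \<in> level F v k" by (simp add: algebra_simps)
  then show ?thesis
    using t by (simp add: power_int_minus flip: mult.assoc)
qed

lemma level_uminus: "a \<in> level F v k \<Longrightarrow> - a \<in> level F v k"
  using level_diff[OF level_0, of a k] by simp

lemma level_add: "a \<in> level F v k \<Longrightarrow> b \<in> level F v k \<Longrightarrow> a + b \<in> level F v k"
  using level_diff[OF _ level_uminus, of a k b] by simp

lemma level_sum: "(\<And>i. i \<in> I \<Longrightarrow> f i \<in> level F v k) \<Longrightarrow> sum f I \<in> level F v k"
  by (induction I rule: infinite_finite_induct) (auto intro: level_0 level_add)

lemma level_divide:
  assumes "a \<in> level F v k" "f \<in> F" "f \<noteq> 0"
  shows "a / f \<in> level F v (k - v f)"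
proof -
  have "inverse f \<in> level F v (- v f)"
    using assms F by (auto simp: level_def v_inverse subfield_intros)
  from level_mult[OF assms(1) this] show ?thesis by (simp add: divide_inverse)
qed

lemma v_add_eq:
  assumes a: "a \<in> F" "a \<noteq> 0" and b: "b \<in> level F v (v a + 1)"
  shows "a + b \<noteq> 0" "v (a + b) = v a"
proof -
  have F': "a + b \<in> F" using a b F by (auto simp: level_def subfield_intros)
  have *: "a + b \<notin> level F v (v a + 1)"
    using level_diff[OF _ b, of "a + b"] a by (auto simp: level_def)
  then show nz: "a + b \<noteq> 0" using level_0 by metis
  have "a + b \<in> level F v (v a)"
    using level_mono[OF b, of "v a"] a level_add by (auto simp: level_def)
  with * F' nz show "v (a + b) = v a" by (auto simp: level_def)
qed

lemma level_factor:
  assumes "a \<in> level F v (int n)" "t \<in> F" "t \<noteq> 0" "v t = 1"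
  shows "\<exists>r\<in>val_ring F P. a = t ^ n * r"
proof (rule bexI)
  show "a = t ^ n * (a / t ^ n)" using assms by simp
  show "a / t ^ n \<in> val_ring F P"
    using assms unfolding mem_val_ring level_def
    by (cases "a = 0") (auto simp: subfield_intros[OF F] v_divide v_power)
qed

lemma prime_element_iff: "prime_element F P t \<longleftrightarrow> t \<in> F \<and> t \<noteq> 0 \<and> v t = 1"
proof
  assume t: "t \<in> F \<and> t \<noteq> 0 \<and> v t = 1"
  show "prime_element F P t"
    unfolding prime_element_def
  proof (intro equalityI subsetI)
    fix z assume "z \<in> P"
    then show "z \<in> (\<lambda>u. t * u) ` val_ring F P"
      using level_factor[of z 1 t] t by (auto simp: mem_place level_def)
  next
    fix z assume "z \<in> (\<lambda>u. t * u) ` val_ring F P"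
    moreover have "t \<in> level F v 1" using t by (auto simp: level_def)
    ultimately have "z \<in> level F v 1"
      using level_mult[of t 1 _ 0] unfolding val_ring_eq by auto
    then show "z \<in> P" using place_eq by simp
  qed
next
  assume "prime_element F P t"
  then have P: "P = (\<lambda>u. t * u) ` val_ring F P" by (simp add: prime_element_def)
  have "t * 1 \<in> P" by (subst P) (use subring_1[OF val_ring_subring] in blast)
  then have t: "t \<in> F" "t = 0 \<or> v t \<ge> 1" by (auto simp: mem_place)
  obtain t1 where t1: "t1 \<in> F" "t1 \<noteq> 0" "v t1 = 1" using uniformizer by auto
  then have "t1 \<in> P" by (auto simp: mem_place)
  then obtain u where u: "u \<in> val_ring F P" "t1 = t * u" using P by auto
  with t1 have "t \<noteq> 0" "u \<noteq> 0" by auto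
  moreover from this u t t1 have "v t + v u = 1" "v u \<ge> 0"
    unfolding mem_val_ring using v_mult[of t u] by auto
  ultimately show "t \<in> F \<and> t \<noteq> 0 \<and> v t = 1" using t by auto
qed

lemma unit_iff: "u \<in> val_ring F P - P \<longleftrightarrow> u \<in> F \<and> u \<noteq> 0 \<and> v u = 0"
  using F by (auto simp: mem_val_ring mem_place)

text \<open>Identifies any normalised \<open>v\<close> with the canonical valuation, so that an
  explicit formula such as \<open>v_inf\<close> may be used to compute the latter.\<close>

lemma valuation_eq:
  assumes z: "z \<in> F" "z \<noteq> 0"
  shows "valuation F P z = v z"
  unfolding valuation_def
proof (rule the_equality)
  obtain t where t: "t \<in> F" "t \<noteq> 0" "v t = 1" using uniformizer by auto
  have "z / t powi v z \<in> val_ring F P - P"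
    unfolding unit_iff using z t by (auto simp: v_divide v_powi subfield_intros[OF F])
  moreover have "z = t powi v z * (z / t powi v z)" using t by simp
  ultimately show "\<exists>t u. prime_element F P t \<and> u \<in> val_ring F P - P \<and> z = t powi v z * u"
    using t prime_element_iff by blast
next
  fix n assume "\<exists>t u. prime_element F P t \<and> u \<in> val_ring F P - P \<and> z = t powi n * u"
  then obtain t u where "prime_element F P t" "u \<in> val_ring F P - P" "z = t powi n * u" by blast
  then show "n = v z"
    unfolding prime_element_iff unit_iff
    by (auto simp: v_mult v_powi subfield_intros[OF F])
qed

lemma valuation_discrete: "discrete_place F P (valuation F P)"
proof -
  have lev: "level F (valuation F P) k = level F v k" for k
    unfolding level_def by (intro Collect_cong) (metis valuation_eq)
  show ?thesis
  proof
    show "\<exists>t\<in>F. t \<noteq> 0 \<and> valuation F P t = 1"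
      using uniformizer valuation_eq by auto
    show "val_ring F P = level F (valuation F P) 0" "P = level F (valuation F P) 1"
      unfolding lev using val_ring_eq place_eq by auto
  qed (use F v_mult valuation_eq val_ring_subring in \<open>auto simp: subfield_intros\<close>)
qed

end

section \<open>Places as maximal ideals, and a criterion for discreteness\<close>

lemma place_valuation_ring:
  assumes "P \<in> places \<iota> F"
  shows "val_ring F P \<in> valuation_rings \<iota> F" "P = nonunits (val_ring F P)"
proof -
  from assms obtain R where R: "R \<in> valuation_rings \<iota> F" "P = nonunits R"
    unfolding places_def by auto
  then have "val_ring F P = R" using val_ring_nonunits by blast
  with R show "val_ring F P \<in> valuation_rings \<iota> F" "P = nonunits (val_ring F P)" by simp_all
qed

lemma place_subring: "P \<in> places \<iota> F \<Longrightarrow> is_subring (val_ring F P)"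
  and place_const: "P \<in> places \<iota> F \<Longrightarrow> range \<iota> \<subseteq> val_ring F P"
  and place_val_ring_sub: "P \<in> places \<iota> F \<Longrightarrow> val_ring F P \<subseteq> F"
  and place_proper: "P \<in> places \<iota> F \<Longrightarrow> val_ring F P \<noteq> F"
  and place_total: "P \<in> places \<iota> F \<Longrightarrow> z \<in> F \<Longrightarrow> z \<in> val_ring F P \<or> inverse z \<in> val_ring F P"
  using place_valuation_ring(1)[of P \<iota> F] unfolding valuation_rings_def by auto

lemma place_unit_iff:
  assumes "P \<in> places \<iota> F"
  shows "u \<in> val_ring F P - P \<longleftrightarrow> u \<in> val_ring F P \<and> u \<noteq> 0 \<and> inverse u \<in> val_ring F P"
  by (subst (2) place_valuation_ring(2)[OF assms]) (auto simp: nonunits_def)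

lemma place_mult:
  assumes P: "P \<in> places \<iota> F" and "a \<in> P" "r \<in> val_ring F P"
  shows "a * r \<in> P"
proof -
  note sub = place_subring[OF P]
  have a: "a \<in> val_ring F P"
    using \<open>a \<in> P\<close> place_valuation_ring(2)[OF P] unfolding nonunits_def by blast
  have ar: "a * r \<in> val_ring F P" using subring_mult[OF sub a \<open>r \<in> val_ring F P\<close>] .
  show ?thesis
  proof (rule ccontr)
    assume "a * r \<notin> P"
    with ar have "a * r \<noteq> 0" "inverse (a * r) \<in> val_ring F P"
      using place_unit_iff[OF P, of "a * r"] by auto
    then have "r * inverse (a * r) \<in> val_ring F P"
      using subring_mult[OF sub \<open>r \<in> val_ring F P\<close>] by blast
    moreover have "r * inverse (a * r) = inverse a"
      using \<open>a * r \<noteq> 0\<close> by (simp add: field_simps)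
    ultimately have "inverse a \<in> val_ring F P" by metis
    then have "a \<notin> P" using place_unit_iff[OF P, of a] a \<open>a * r \<noteq> 0\<close> by auto
    with \<open>a \<in> P\<close> show False by simp
  qed
qed

lemma place_subset: "P \<in> places \<iota> F \<Longrightarrow> P \<subseteq> val_ring F P"
  using place_valuation_ring(2)[of P \<iota> F] unfolding nonunits_def by blast

lemma place_0: "P \<in> places \<iota> F \<Longrightarrow> 0 \<in> P"
  using place_valuation_ring(2)[of P \<iota> F] subring_0[OF place_subring, of P \<iota> F]
  unfolding nonunits_def by blast

lemma place_1: "P \<in> places \<iota> F \<Longrightarrow> 1 \<notin> P"
  using place_unit_iff[of P \<iota> F 1] subring_1[OF place_subring, of P \<iota> F] by auto

text \<open>Of two nonzero elements one divides the other in the valuation ring, and the difference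
  is a multiple of the divisor.\<close>

lemma place_diff:
  assumes P: "P \<in> places \<iota> F" and F: "is_subfield F" and ab: "a \<in> P" "b \<in> P"
  shows "a - b \<in> P"
proof -
  note sub = place_subring[OF P] and PF = place_val_ring_sub[OF P] and tot = place_total[OF P]
  have aux: "a - b \<in> P" if "a \<in> P" "b \<in> P" "b \<noteq> 0" "a / b \<in> val_ring F P" for a b
  proof -
    have "a / b - 1 \<in> val_ring F P" using sub that by (simp add: subring_intros)
    from place_mult[OF P \<open>b \<in> P\<close> this] show ?thesis using that by (simp add: algebra_simps)
  qed
  have neg: "- a \<in> P" if "a \<in> P" for a
  proof -
    have "- 1 \<in> val_ring F P" using sub by (simp add: subring_intros)
    from place_mult[OF P that this] show ?thesis by simp
  qed
  consider "a = 0" | "b = 0" | "a \<noteq> 0" "b \<noteq> 0" by blast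
  then show ?thesis
  proof cases
    case 3
    have "a / b \<in> F" using ab place_subset[OF P] PF F by (auto intro!: subfield_divide)
    then have "a / b \<in> val_ring F P \<or> b / a \<in> val_ring F P" using tot by fastforce
    then show ?thesis
      using aux[of a b] aux[of b a] neg[of "b - a"] 3 ab by auto
  qed (use ab neg in auto)
qed

text \<open>The exponent in \<open>t powi n * u\<close> is unique, because a positive power of
  \<open>t\<close> times a ring element lies in \<open>P\<close> and therefore is no unit. This
  exponent is the valuation.\<close>

lemma discrete_placeI:
  assumes P: "P \<in> places \<iota> F" and F: "is_subfield F"
    and t: "t \<noteq> 0" "P = (\<lambda>r. t * r) ` val_ring F P"
    and fact: "\<And>z. z \<in> F \<Longrightarrow> z \<noteq> 0 \<Longrightarrow> \<exists>n. \<exists>u\<in>val_ring F P - P. z = t powi n * u"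
  shows "discrete_place F P (valuation F P)"
proof -
  let ?R = "val_ring F P"
  note sub = place_subring[OF P] and PF = place_val_ring_sub[OF P]
  note unit = place_unit_iff[OF P]
  have "t * 1 \<in> P" by (subst t) (use subring_1[OF sub] in blast)
  then have tP: "t \<in> P" by simp
  have tR: "t \<in> ?R" using tP place_subset[OF P] by auto
  have tF: "t \<in> F" using tR PF by auto
  have pos: "t powi n * r \<in> P" if "n > 0" "r \<in> ?R" for n r
  proof -
    have "t powi n * r = t * (t ^ (nat n - 1) * r)"
      using that by (cases "nat n") (auto simp: power_int_def)
    moreover have "t ^ (nat n - 1) * r \<in> ?R" using sub tR that by (auto intro!: subring_intros)
    ultimately show ?thesis using place_mult[OF P tP] by metis
  qed
  have uniq_le: "\<not> n < n'" if "u \<in> ?R - P" "u' \<in> ?R - P" "t powi n * u = t powi n' * u'" for n n' u u'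
  proof
    assume "n < n'"
    then have "t powi (n' - n) * u' \<in> P" using pos[of "n' - n" u'] that by auto
    moreover have "t powi (n' - n) * u' = u"
      using that t by (simp add: power_int_diff field_simps)
    ultimately show False using that by auto
  qed
  define v where "v z = (THE n. \<exists>u\<in>?R - P. z = t powi n * u)" for z
  have v_eq: "v (t powi n * u) = n" if "u \<in> ?R - P" for n u
    unfolding v_def using that uniq_le by (intro the_equality) (blast, metis linorder_neqE)
  have uF: "u \<in> F" "u \<noteq> 0" if "u \<in> ?R - P" for u
    using that PF unit by auto
  have nonneg: "n \<ge> 0 \<longleftrightarrow> t powi n * u \<in> ?R" if u: "u \<in> ?R - P" for n u
  proof
    assume "n \<ge> 0"
    then show "t powi n * u \<in> ?R" using sub tR u by (auto simp: power_int_def intro!: subring_intros)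
  next
    assume *: "t powi n * u \<in> ?R"
    show "n \<ge> 0"
    proof (rule ccontr)
      assume "\<not> n \<ge> 0"
      then have "t powi (-n) * (t powi n * u) \<in> P" using pos[OF _ *, of "-n"] by auto
      moreover have "t powi (-n) * (t powi n * u) = u" using t by (simp add: power_int_minus)
      ultimately show False using u by auto
    qed
  qed
  have pos_iff: "n \<ge> 1 \<longleftrightarrow> t powi n * u \<in> P" if u: "u \<in> ?R - P" for n u
  proof
    assume "t powi n * u \<in> P"
    then obtain r where r: "r \<in> ?R" "t powi n * u = t * r" using t by auto
    then have "r = t powi (n - 1) * u" using t by (simp add: power_int_diff field_simps)
    then show "n \<ge> 1" using nonneg[OF u, of "n - 1"] r by auto
  qed (use pos u in auto)
  interpret discrete_place F P v
  proof
    fix a b assume "a \<in> F" "a \<noteq> 0" "b \<in> F" "b \<noteq> 0"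
    then obtain n u m w where *: "u \<in> ?R - P" "a = t powi n * u" "w \<in> ?R - P" "b = t powi m * w"
      using fact by meson
    then have "u * w \<in> ?R - P"
      unfolding unit using sub by (auto simp: subring_intros)
    moreover have "a * b = t powi (n + m) * (u * w)" using * t by (simp add: power_int_add)
    ultimately show "v (a * b) = v a + v b" using v_eq * by metis
  next
    have "1 \<in> ?R - P" unfolding unit using sub by (simp add: subring_1)
    from v_eq[OF this, of 1] show "\<exists>t\<in>F. t \<noteq> 0 \<and> v t = 1" using tF t by auto
  next
    have *: "z \<in> ?R \<longleftrightarrow> v z \<ge> 0" "z \<in> P \<longleftrightarrow> v z \<ge> 1" if "z \<in> F" "z \<noteq> 0" for z
      using fact[OF that] v_eq nonneg pos_iff by metis+
    show "?R = level F v 0"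
      unfolding level_def using * PF subring_0[OF sub] subring_0[OF subfield_subring[OF F]] by blast
    show "P = level F v 1"
      unfolding level_def using * PF place_subset[OF P] place_0[OF P] by blast
  qed (use F sub in auto)
  show ?thesis by (rule valuation_discrete)
qed

section \<open>Separating finitely many places, and weak approximation\<close>

lemma place_not_dominated:
  assumes P: "discrete_place F P v" and P': "discrete_place F P' v'" and "P \<noteq> P'"
  shows "\<exists>z\<in>F. z \<noteq> 0 \<and> v z \<ge> 0 \<and> v' z < 0"
proof (rule ccontr)
  assume "\<not> ?thesis"
  then have sub: "v' z \<ge> 0" if "z \<in> F" "z \<noteq> 0" "v z \<ge> 0" for z using that by force
  interpret P: discrete_place F P v by fact
  interpret P': discrete_place F P' v' by fact
  \<comment> \<open>A discrete valuation ring is maximal among proper subrings. If \<open>y\<close>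
    has a pole at \<open>P\<close> only, then for large \<open>n\<close> the element
    \<open>inverse t / y ^ n\<close> is integral at \<open>P\<close> but has a pole at
    \<open>P'\<close>, against \<open>sub\<close>.\<close>
  have sup: "v y \<ge> 0" if y: "y \<in> F" "y \<noteq> 0" "v' y \<ge> 0" for y
  proof (rule ccontr)
    assume neg: "\<not> v y \<ge> 0"
    obtain t where t: "t \<in> F" "t \<noteq> 0" "v' t = 1" using P'.uniformizer by auto
    define n where "n = nat \<bar>v t\<bar>"
    have "int n * v y \<le> int n * (-1)" using neg by (intro mult_left_mono) auto
    then have "v (inverse t / y ^ n) \<ge> 0"
      using t y P.F by (simp add: P.v_divide P.v_inverse P.v_power subfield_intros n_def)
    then have "v' (inverse t / y ^ n) \<ge> 0"
      using t y P.F by (intro sub) (auto simp: subfield_intros)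
    then have "int n * v' y \<le> -1"
      using t y P.F by (simp add: P'.v_divide P'.v_inverse P'.v_power subfield_intros)
    moreover have "int n * v' y \<ge> 0" using y by simp
    ultimately show False by simp
  qed
  have "v z \<ge> 1 \<longleftrightarrow> v' z \<ge> 1" if "z \<in> F" "z \<noteq> 0" for z
    using sub[of "inverse z"] sup[of "inverse z"] that P.F
    by (force simp: P.v_inverse P'.v_inverse subfield_intros)
  then have "P = P'"
    unfolding P.place_eq P'.place_eq level_def by auto
  with \<open>P \<noteq> P'\<close> show False by simp
qed

lemma separate_two_places:
  assumes P: "discrete_place F P v" and P': "discrete_place F P' v'" and "P \<noteq> P'"
  shows "\<exists>z\<in>F. z \<noteq> 0 \<and> v z > 0 \<and> v' z < 0"
proof -
  interpret P: discrete_place F P v by fact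
  interpret P': discrete_place F P' v' by fact
  obtain a where a: "a \<in> F" "a \<noteq> 0" "v a \<ge> 0" "v' a < 0"
    using place_not_dominated[OF P P' \<open>P \<noteq> P'\<close>] by auto
  obtain b where b: "b \<in> F" "b \<noteq> 0" "v' b \<ge> 0" "v b < 0"
    using place_not_dominated[OF P' P] \<open>P \<noteq> P'\<close> by auto
  show ?thesis
    using a b P.F by (intro bexI[of _ "a / b"]) (auto simp: P.v_divide P'.v_divide subfield_intros)
qed

lemma separate_places:
  assumes P: "discrete_place F P (V P)" and "finite W"
    and W: "\<And>P'. P' \<in> W \<Longrightarrow> discrete_place F P' (V P')" "P \<notin> W"
  shows "\<exists>u\<in>F. u \<noteq> 0 \<and> V P u > 0 \<and> (\<forall>P'\<in>W. V P' u < 0)"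
  using \<open>finite W\<close> W
proof (induction W rule: finite_induct)
  case empty
  interpret P: discrete_place F P "V P" by fact
  show ?case using P.uniformizer by force
next
  case (insert P1 W)
  then obtain u where u: "u \<in> F" "u \<noteq> 0" "V P u > 0" "\<And>P'. P' \<in> W \<Longrightarrow> V P' u < 0" by auto
  interpret P: discrete_place F P "V P" by fact
  interpret P1: discrete_place F P1 "V P1" using insert by auto
  show ?case
  proof (cases "V P1 u < 0")
    case False
    obtain z where z: "z \<in> F" "z \<noteq> 0" "V P z > 0" "V P1 z < 0"
      using separate_two_places[of F P "V P" P1 "V P1"] P P1.discrete_place_axioms insert by auto
    have "finite ((\<lambda>P'. nat \<bar>V P' u\<bar>) ` W)" using insert by simp
    then obtain k0 where k0: "\<forall>n\<in>(\<lambda>P'. nat \<bar>V P' u\<bar>) ` W. n \<le> k0"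
      using finite_nat_set_iff_bounded_le by blast
    \<comment> \<open>As \<open>k\<close> exceeds every \<open>\<bar>V P' u\<bar>\<close>, the
      values of \<open>z ^ k\<close> and \<open>u\<close> differ at each \<open>P'\<close> in
      \<open>W\<close>: if \<open>z\<close> has a pole there, \<open>z ^ k\<close> dominates the
      sum, otherwise \<open>u\<close> does.\<close>
    define k where "k = Suc k0"
    have k: "\<bar>V P' u\<bar> < int k" if "P' \<in> W" for P' using k0 that unfolding k_def by force
    have kpos: "int k > 0" by (simp add: k_def)
    have zk: "z ^ k \<in> F" "z ^ k \<noteq> 0" using z P.F by (auto simp: subfield_intros)
    have neg1: "V P1 (z ^ k) < 0"
      using z mult_pos_neg[of "int k" "V P1 z"] kpos by (simp add: P1.v_power)
    have P1': "z ^ k + u \<noteq> 0" "V P1 (z ^ k + u) = V P1 (z ^ k)"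
      using P1.v_add_eq[OF zk, of u] u False neg1 by (auto simp: level_def)
    have "1 \<le> int k * V P z" using mult_mono[of 1 "int k" 1 "V P z"] kpos z by simp
    then have "u \<in> level F (V P) 1" "z ^ k \<in> level F (V P) 1"
      using u z zk by (auto simp: level_def P.v_power)
    then have "z ^ k + u \<in> level F (V P) 1" by (intro P.level_add)
    then have "V P (z ^ k + u) > 0" using P1' by (auto simp: level_def)
    moreover have "V P' (z ^ k + u) < 0" if "P' \<in> W" for P'
    proof -
      interpret P': discrete_place F P' "V P'" using insert that by auto
      show ?thesis
      proof (cases "V P' z \<ge> 0")
        case True
        then have "V P' (z ^ k) \<ge> 0" using z by (simp add: P'.v_power)
        then have "V P' (u + z ^ k) = V P' u"
          using u(4)[OF that] zk by (intro P'.v_add_eq u) (auto simp: level_def)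
        with u(4)[OF that] show ?thesis by (simp add: add.commute)
      next
        case neg: False
        have "int k * V P' z \<le> int k * (-1)" using neg by (intro mult_left_mono) auto
        then have "V P' (z ^ k) \<le> - int k" using z by (simp add: P'.v_power)
        then have "V P' (z ^ k + u) = V P' (z ^ k)"
          using k[OF that] u by (intro P'.v_add_eq zk) (auto simp: level_def)
        with \<open>V P' (z ^ k) \<le> - int k\<close> show ?thesis by (simp add: k_def)
      qed
    qed
    moreover have "z ^ k + u \<in> F" using zk u P.F by (auto simp: subfield_intros)
    ultimately show ?thesis using P1' neg1 by (intro bexI[of _ "z ^ k + u"]) auto
  qed (use u in blast)
qed

text \<open>For \<open>u\<close> with a zero at \<open>P\<close> and poles at the other places,
  \<open>1 / (1 + u ^ M)\<close> is close to 1 at \<open>P\<close> and close to 0 elsewhere.\<close>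

lemma approximate_idempotent:
  assumes "finite W" and W: "\<And>P'. P' \<in> W \<Longrightarrow> discrete_place F P' (V P')" and "P \<in> W"
  shows "\<exists>w\<in>F. w - 1 \<in> level F (V P) (int N) \<and> (\<forall>P'\<in>W - {P}. w \<in> level F (V P') (int N))"
proof -
  \<comment> \<open>The successor keeps the exponent positive for \<open>N = 0\<close>, so that
    \<open>u ^ M\<close> still vanishes at \<open>P\<close> and has poles elsewhere.\<close>
  define M where "M = Suc N"
  interpret P: discrete_place F P "V P" using assms by auto
  obtain u where u: "u \<in> F" "u \<noteq> 0" "V P u > 0" "\<And>P'. P' \<in> W - {P} \<Longrightarrow> V P' u < 0"
    using separate_places[of F P V "W - {P}"] assms by auto
  have uM: "u ^ M \<in> F" "u ^ M \<noteq> 0" using u P.F by (auto simp: subfield_intros)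
  have big: "int M \<le> int M * k" if "k > 0" for k using that by (simp add: M_def)
  have vM: "V P (u ^ M) \<ge> int M" using u big by (simp add: P.v_power)
  have one: "1 + u ^ M \<noteq> 0" "V P (1 + u ^ M) = 0"
    using P.v_add_eq[of 1 "u ^ M"] uM vM P.F by (auto simp: P.v_1 level_def subfield_intros M_def)
  have oF: "1 + u ^ M \<in> F" using uM P.F by (auto simp: subfield_intros)
  define w where "w = 1 / (1 + u ^ M)"
  have wF: "w \<in> F" "w \<noteq> 0" unfolding w_def using oF one P.F by (auto simp: subfield_intros)
  have "w - 1 = - (u ^ M / (1 + u ^ M))" unfolding w_def using one by (simp add: field_simps)
  moreover have "u ^ M / (1 + u ^ M) \<in> level F (V P) (int N)"
    unfolding level_def using uM one vM oF P.F by (auto simp: P.v_divide subfield_intros M_def)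
  ultimately have "w - 1 \<in> level F (V P) (int N)" using P.level_uminus by simp
  moreover have "w \<in> level F (V P') (int N)" if "P' \<in> W - {P}" for P'
  proof -
    interpret P': discrete_place F P' "V P'" using assms that by auto
    have "int M \<le> int M * (- V P' u)" using u(4)[OF that] by (intro big) auto
    then have "V P' (u ^ M) \<le> - int M" using u by (simp add: P'.v_power)
    moreover from this have "V P' (u ^ M + 1) = V P' (u ^ M)"
      using P'.v_1 P'.F by (intro P'.v_add_eq uM) (auto simp: level_def subfield_intros M_def)
    ultimately have "V P' (1 + u ^ M) \<le> - int M" by (simp add: add.commute)
    then show ?thesis
      unfolding w_def level_def using one oF P'.F
      by (auto simp: P'.v_divide P'.v_1 subfield_intros M_def)
  qed
  ultimately show ?thesis using wF by blast
qed

lemma weak_approximation: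
  fixes z :: "'h::field set \<Rightarrow> 'h"
  assumes "finite W" and W: "\<And>P. P \<in> W \<Longrightarrow> discrete_place F P (V P)" and F: "is_subfield F"
    and z: "\<And>P. P \<in> W \<Longrightarrow> z P \<in> F"
  shows "\<exists>y\<in>F. \<forall>P\<in>W. y - z P \<in> level F (V P) n"
proof -
  \<comment> \<open>The precision \<open>N\<close> of the approximate idempotents must also absorb
    the poles of each target \<open>z P'\<close> at each place \<open>P\<close>.\<close>
  have "finite ((\<lambda>(P, P'). nat (n - V P (z P'))) ` (W \<times> W))" using assms by simp
  then obtain N where N: "\<forall>k\<in>(\<lambda>(P, P'). nat (n - V P (z P'))) ` (W \<times> W). k \<le> N"
    using finite_nat_set_iff_bounded_le by blast
  then have N: "n \<le> int N + V P (z P')" if "P \<in> W" "P' \<in> W" for P P'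
    using that by force
  have "\<forall>P\<in>W. \<exists>w\<in>F. w - 1 \<in> level F (V P) (int N) \<and> (\<forall>P'\<in>W - {P}. w \<in> level F (V P') (int N))"
    using approximate_idempotent[OF \<open>finite W\<close>, of F V] W by blast
  then obtain w where w: "\<And>P. P \<in> W \<Longrightarrow> w P \<in> F" "\<And>P. P \<in> W \<Longrightarrow> w P - 1 \<in> level F (V P) (int N)"
    "\<And>P P'. P \<in> W \<Longrightarrow> P' \<in> W \<Longrightarrow> P \<noteq> P' \<Longrightarrow> w P \<in> level F (V P') (int N)"
    by (metis DiffI singletonD)
  define y where "y = (\<Sum>P\<in>W. w P * z P)"
  have "y \<in> F" unfolding y_def using w z F by (auto intro!: subfield_intros)
  moreover have "y - z P \<in> level F (V P) n" if P: "P \<in> W" for P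
  proof -
    interpret P: discrete_place F P "V P" using W P by auto
    have zl: "z P' \<in> level F (V P) (V P (z P'))" if "P' \<in> W" for P'
      using z that by (auto simp: level_def)
    have "y - z P = (w P - 1) * z P + (\<Sum>P'\<in>W - {P}. w P' * z P')"
      unfolding y_def using sum.remove[OF \<open>finite W\<close> P] by (simp add: algebra_simps)
    also have "\<dots> \<in> level F (V P) n"
    proof (intro P.level_add P.level_sum)
      show "(w P - 1) * z P \<in> level F (V P) n"
        using P.level_mult[OF w(2)[OF P] zl[OF P]] N[OF P P] by (rule P.level_mono)
      fix P' assume P': "P' \<in> W - {P}"
      then have "w P' \<in> level F (V P) (int N)" "P' \<in> W" using w(3)[of P' P] P by auto
      then show "w P' * z P' \<in> level F (V P) n"
        using P.level_mult[OF _ zl] N[OF P] P.level_mono by blast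
    qed
    finally show ?thesis .
  qed
  ultimately show ?thesis by blast
qed

section \<open>Rings with a degree function\<close>

text \<open>Here \<^term>\<open>A\<close> is the ring of functions with poles at a single rational place only, and
  \<^term>\<open>d\<close> is the pole order at this place.\<close>

locale degree_ring =
  fixes \<iota> :: "'k::{field,finite} \<Rightarrow> 'h::field" and F A :: "'h set" and d :: "'h \<Rightarrow> nat"
  assumes \<iota>: "const_embedding \<iota>" and F: "is_subfield F" and A: "is_subring A"
    and A_sub: "A \<subseteq> F" and const_sub: "range \<iota> \<subseteq> A"
    and frac: "\<And>z. z \<in> F \<Longrightarrow> \<exists>a\<in>A. \<exists>b\<in>A. b \<noteq> 0 \<and> z = a / b"
    and d_mult: "\<And>a b. a \<in> A \<Longrightarrow> a \<noteq> 0 \<Longrightarrow> b \<in> A \<Longrightarrow> b \<noteq> 0 \<Longrightarrow> d (a * b) = d a + d b"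
    and d_diff: "\<And>a b. a \<in> A \<Longrightarrow> b \<in> A \<Longrightarrow> d (a - b) \<le> max (d a) (d b)"
    and d_0: "d 0 = 0"
    and d_lead: "\<And>a b. a \<in> A \<Longrightarrow> a \<noteq> 0 \<Longrightarrow> b \<in> A \<Longrightarrow> b \<noteq> 0 \<Longrightarrow> d a = d b \<Longrightarrow>
      \<exists>c. a - \<iota> c * b = 0 \<or> d (a - \<iota> c * b) < d a"
    and finite_gaps: "finite {n. \<forall>a\<in>A - {0}. d a \<noteq> n}"
begin

section \<open>The degree filtration and the gaps\<close>

lemma const_mem: "\<iota> c \<in> A" using const_sub by auto

lemmas A_intros = subring_intros[OF A] const_mem
lemmas \<iota>_simps = const_embedding_simps[OF \<iota>]

lemma A_F: "a \<in> A \<Longrightarrow> a \<in> F" using A_sub by auto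

lemma d_1: "d 1 = 0"
  using d_mult[of 1 1] A by (simp add: subring_1)

lemma d_const: "d (\<iota> c) = 0"
proof (cases "c = 0")
  case False
  have "d (\<iota> c * \<iota> (inverse c)) = d (\<iota> c) + d (\<iota> (inverse c))"
    using False by (intro d_mult const_mem) (auto simp: \<iota>_simps)
  with False d_1 show ?thesis by (simp add: \<iota>_simps)
qed (simp add: d_0 \<iota>_simps)

lemma d_0_imp_const: "a \<in> A \<Longrightarrow> d a = 0 \<Longrightarrow> a \<in> range \<iota>"
  using d_lead[of a 1] A const_embedding_0[OF \<iota>] by (cases "a = 0") (auto simp: d_1 subring_1)

lemma d_power: "a \<in> A \<Longrightarrow> a \<noteq> 0 \<Longrightarrow> d (a ^ n) = n * d a"
  by (induction n) (auto simp: d_1 d_mult A_intros)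

text \<open>The strict bound makes \<open>filt 0\<close> trivial and lets the step to
  \<open>filt (Suc n)\<close> add exactly the degree \<open>n\<close>. Zero is listed separately
  because \<open>d 0 = 0\<close>.\<close>

definition filt :: "nat \<Rightarrow> 'h set" where
  "filt n = {a \<in> A. a = 0 \<or> d a < n}"

lemma filt_0: "0 \<in> filt n" using A by (auto simp: filt_def subring_0)

lemma filt_A: "a \<in> filt n \<Longrightarrow> a \<in> A" by (simp add: filt_def)

lemma filt_mono: "a \<in> filt m \<Longrightarrow> m \<le> n \<Longrightarrow> a \<in> filt n" by (auto simp: filt_def)

lemma mem_filt_Suc_d: "a \<in> A \<Longrightarrow> a \<in> filt (Suc (d a))" by (simp add: filt_def)

lemma filt_diff: "a \<in> filt n \<Longrightarrow> b \<in> filt n \<Longrightarrow> a - b \<in> filt n"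
proof -
  assume ab: "a \<in> filt n" "b \<in> filt n"
  then have "d (a - b) \<le> max (d a) (d b)" by (intro d_diff) (auto simp: filt_def)
  then show "a - b \<in> filt n"
    using ab A d_diff[of 0 b] by (cases "n = 0") (auto simp: filt_def subring_intros d_0)
qed

lemma filt_uminus: "a \<in> filt n \<Longrightarrow> - a \<in> filt n"
  using filt_diff[OF filt_0, of a n] by simp

lemma filt_add: "a \<in> filt n \<Longrightarrow> b \<in> filt n \<Longrightarrow> a + b \<in> filt n"
  using filt_diff[OF _ filt_uminus, of a n b] by simp

lemma filt_mult: "a \<in> filt (Suc m) \<Longrightarrow> b \<in> filt n \<Longrightarrow> a * b \<in> filt (m + n)"
  using A by (cases "a = 0 \<or> b = 0") (auto simp: filt_def subring_intros d_mult)

lemma filt_const_mult: "a \<in> filt n \<Longrightarrow> \<iota> c * a \<in> filt n"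
  using filt_mult[of "\<iota> c" 0 a n] const_mem[of c] by (simp add: filt_def d_const)

definition degrees :: "nat set" where
  "degrees = {n. \<exists>a\<in>A. a \<noteq> 0 \<and> d a = n}"

definition gaps :: nat where
  "gaps = card (- degrees)"

lemma finite_gaps': "finite (- degrees)"
proof -
  have "- degrees = {n. \<forall>a\<in>A - {0}. d a \<noteq> n}" unfolding degrees_def by auto
  then show ?thesis using finite_gaps by simp
qed

lemma degreesE: "n \<in> degrees \<Longrightarrow> (\<And>a. a \<in> A \<Longrightarrow> a \<noteq> 0 \<Longrightarrow> d a = n \<Longrightarrow> thesis) \<Longrightarrow> thesis"
  unfolding degrees_def by auto

text \<open>By \<open>d_lead\<close>, leading coefficients are constants, so each degree that occurs
  adds one dimension.\<close>

lemma filt_Suc_new: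
  assumes e: "e \<in> A" "e \<noteq> 0" "d e = n"
  shows "bij_betw (\<lambda>(a, c). a + \<iota> c * e) (filt n \<times> UNIV) (filt (Suc n))"
proof (rule bij_betwI')
  fix x y :: "'h \<times> 'k" assume "x \<in> filt n \<times> UNIV" "y \<in> filt n \<times> UNIV"
  then obtain a c a' c' where xy: "x = (a, c)" "y = (a', c')" "a \<in> filt n" "a' \<in> filt n"
    by auto
  have "a = a' \<and> c = c'" if eq: "a + \<iota> c * e = a' + \<iota> c' * e"
  proof -
    have *: "a - a' = \<iota> (c' - c) * e" using eq by (simp add: \<iota>_simps algebra_simps)
    have "c' - c = 0"
    proof (rule ccontr)
      assume nz: "c' - c \<noteq> 0"
      then have "d (\<iota> (c' - c) * e) = n" "\<iota> (c' - c) * e \<noteq> 0"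
        using e d_mult[OF const_mem, of "c' - c" e] const_embedding_eq_0[OF \<iota>, of "c' - c"] d_const
        by auto
      moreover have "\<iota> (c' - c) * e \<in> filt n"
        using filt_diff[OF xy(3,4)] * by simp
      ultimately show False by (simp add: filt_def)
    qed
    with * show ?thesis by (simp add: \<iota>_simps)
  qed
  then show "((case x of (a, c) \<Rightarrow> a + \<iota> c * e) = (case y of (a, c) \<Rightarrow> a + \<iota> c * e)) = (x = y)"
    using xy by auto
next
  fix x :: "'h \<times> 'k" assume "x \<in> filt n \<times> UNIV"
  moreover have "e \<in> filt (Suc n)" using e by (simp add: filt_def)
  ultimately show "(case x of (a, c) \<Rightarrow> a + \<iota> c * e) \<in> filt (Suc n)"
    by (auto intro!: filt_add filt_const_mult intro: filt_mono)
next
  fix b assume b: "b \<in> filt (Suc n)"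
  show "\<exists>x\<in>filt n \<times> UNIV. b = (case x of (a, c) \<Rightarrow> a + \<iota> c * e)"
  proof (cases "b \<in> filt n")
    case True
    then show ?thesis by (intro bexI[of _ "(b, 0)"]) (auto simp: \<iota>_simps)
  next
    case False
    with b have "b \<in> A" "b \<noteq> 0" "d b = d e" using e by (auto simp: filt_def)
    with d_lead[of b e] e obtain c where "b - \<iota> c * e = 0 \<or> d (b - \<iota> c * e) < n" by auto
    then have "b - \<iota> c * e \<in> filt n" using \<open>b \<in> A\<close> e by (auto simp: filt_def A_intros)
    then show ?thesis by (intro bexI[of _ "(b - \<iota> c * e, c)"]) auto
  qed
qed

lemma card_filt: "finite (filt n) \<and> card (filt n) = CARD('k) ^ card (degrees \<inter> {..<n})"
proof (induction n)
  case 0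
  have "filt 0 = {0}" using filt_0 by (auto simp: filt_def)
  then show ?case by simp
next
  case (Suc n)
  show ?case
  proof (cases "n \<in> degrees")
    case True
    then obtain e where "e \<in> A" "e \<noteq> 0" "d e = n" by (rule degreesE)
    note bij = filt_Suc_new[OF this]
    have "card (filt (Suc n)) = card (filt n) * CARD('k)"
      using bij_betw_same_card[OF bij] by (simp add: card_cartesian_product)
    moreover have "finite (filt (Suc n))"
      using bij_betw_finite[OF bij] Suc by simp
    moreover have "degrees \<inter> {..<Suc n} = insert n (degrees \<inter> {..<n})"
      using True by (auto simp: less_Suc_eq)
    ultimately show ?thesis using Suc by simp
  next
    case False
    then have "filt (Suc n) = filt n"
      by (auto simp: filt_def less_Suc_eq degrees_def)
    moreover have "degrees \<inter> {..<Suc n} = degrees \<inter> {..<n}"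
      using False by (auto simp: less_Suc_eq)
    ultimately show ?thesis using Suc by simp
  qed
qed

lemma finite_filt: "finite (filt n)" using card_filt by blast

lemma card_ge_2: "CARD('k) \<ge> 2"
proof -
  have "card {0::'k, 1} \<le> CARD('k)" by (rule card_mono) auto
  then show ?thesis by simp
qed

lemma card_filt_le: "card (filt n) \<le> CARD('k) ^ n"
proof -
  have "card (degrees \<inter> {..<n}) \<le> card {..<n}" by (intro card_mono) auto
  then show ?thesis using card_filt card_ge_2 by (auto intro!: power_increasing)
qed

text \<open>Riemann's inequality for multiples of infinity; beyond the conductor it becomes the
  equality \<open>card_degrees_eq\<close>.\<close>

lemma card_degrees_ge: "n \<le> card (degrees \<inter> {..<n}) + gaps"
proof -
  have "card {..<n} \<le> card ((degrees \<inter> {..<n}) \<union> - degrees)"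
    using finite_gaps' by (intro card_mono) auto
  also have "\<dots> \<le> card (degrees \<inter> {..<n}) + card (- degrees)" by (rule card_Un_le)
  finally show ?thesis unfolding gaps_def by simp
qed

lemma conductor: "\<exists>c. \<forall>n\<ge>c. n \<in> degrees"
proof -
  obtain c where c: "\<forall>n\<in>- degrees. n \<le> c" using finite_gaps' finite_nat_set_iff_bounded_le by blast
  have "n \<in> degrees" if "n \<ge> Suc c" for n
  proof (rule ccontr)
    assume "n \<notin> degrees"
    then have "n \<le> c" using c by auto
    with that show False by simp
  qed
  then show ?thesis by blast
qed

lemma card_degrees_eq:
  assumes "\<And>n. n \<ge> c \<Longrightarrow> n \<in> degrees"
  shows "n \<ge> c \<Longrightarrow> n = card (degrees \<inter> {..<n}) + gaps"
proof -
  assume "n \<ge> c"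
  have "{..<n} = (degrees \<inter> {..<n}) \<union> - degrees"
    using assms \<open>n \<ge> c\<close> by (fastforce simp: not_le[symmetric])
  moreover have "card ((degrees \<inter> {..<n}) \<union> - degrees) = card (degrees \<inter> {..<n}) + card (- degrees)"
    using finite_gaps' by (intro card_Un_disjoint) auto
  ultimately show ?thesis unfolding gaps_def by (metis card_lessThan)
qed

lemma nonconstant: obtains a where "a \<in> A" "a \<noteq> 0" "d a > 0" "a \<notin> range \<iota>"
proof -
  obtain c where c: "\<And>n. n \<ge> c \<Longrightarrow> n \<in> degrees" using conductor by blast
  from c[of "Suc c"] obtain a where "a \<in> A" "a \<noteq> 0" "d a = Suc c"
    by (auto elim!: degreesE)
  then show thesis using that d_const by fastforce
qed

subsection \<open>The place at infinity\<close>

definition O_inf :: "'h set" where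
  "O_inf = {z. \<exists>a\<in>A. \<exists>b\<in>A. b \<noteq> 0 \<and> z = a / b \<and> d a \<le> d b}"

definition P_inf :: "'h set" where
  "P_inf = {z. \<exists>a\<in>A. \<exists>b\<in>A. b \<noteq> 0 \<and> z = a / b \<and> (a = 0 \<or> d a < d b)}"

lemma O_infI: "a \<in> A \<Longrightarrow> b \<in> A \<Longrightarrow> b \<noteq> 0 \<Longrightarrow> d a \<le> d b \<Longrightarrow> a / b \<in> O_inf"
  unfolding O_inf_def by blast

lemma P_infI: "a \<in> A \<Longrightarrow> b \<in> A \<Longrightarrow> b \<noteq> 0 \<Longrightarrow> a = 0 \<or> d a < d b \<Longrightarrow> a / b \<in> P_inf"
  unfolding P_inf_def by blast

lemma frac_degrees:
  assumes "a \<in> A" "b \<in> A" "b \<noteq> 0" "a' \<in> A" "b' \<in> A" "b' \<noteq> 0" "a / b = a' / b'" "a \<noteq> 0"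
  shows "d a + d b' = d a' + d b"
proof -
  have "a * b' = a' * b" using assms by (simp add: field_simps)
  moreover have "a' \<noteq> 0" using assms by auto
  ultimately show ?thesis using assms d_mult by metis
qed

lemma O_inf_iff:
  assumes "a \<in> A" "b \<in> A" "b \<noteq> 0"
  shows "a / b \<in> O_inf \<longleftrightarrow> d a \<le> d b"
proof
  assume "a / b \<in> O_inf"
  then obtain a' b' where *: "a' \<in> A" "b' \<in> A" "b' \<noteq> 0" "a / b = a' / b'" "d a' \<le> d b'"
    unfolding O_inf_def by auto
  then show "d a \<le> d b"
    using frac_degrees[of a b a' b'] assms d_0 by (cases "a = 0") auto
qed (use assms O_infI in auto)

lemma P_inf_iff:
  assumes "a \<in> A" "b \<in> A" "b \<noteq> 0"
  shows "a / b \<in> P_inf \<longleftrightarrow> a = 0 \<or> d a < d b"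
proof
  assume "a / b \<in> P_inf"
  then obtain a' b' where *: "a' \<in> A" "b' \<in> A" "b' \<noteq> 0" "a / b = a' / b'" "a' = 0 \<or> d a' < d b'"
    unfolding P_inf_def by auto
  then show "a = 0 \<or> d a < d b"
    using frac_degrees[of a b a' b'] assms by (cases "a = 0") auto
qed (use assms P_infI in auto)

lemma O_inf_sub: "O_inf \<subseteq> F"
  unfolding O_inf_def using A_F F by (auto intro!: subfield_divide)

lemma O_inf_subring: "is_subring O_inf"
  unfolding is_subring_def
proof (intro conjI ballI)
  show "1 \<in> O_inf" using O_infI[of 1 1] A by (simp add: subring_1)
next
  fix x y assume "x \<in> O_inf" "y \<in> O_inf"
  then obtain a b a' b' where *: "a \<in> A" "b \<in> A" "b \<noteq> 0" "d a \<le> d b"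
    "a' \<in> A" "b' \<in> A" "b' \<noteq> 0" "d a' \<le> d b'" and xy: "x = a / b" "y = a' / b'"
    unfolding O_inf_def by auto
  have dm: "d (s * t) \<le> d s + d t" if "s \<in> A" "t \<in> A" for s t
    using d_mult that d_0 by (cases "s = 0 \<or> t = 0") auto
  have "d (a * b' - a' * b) \<le> max (d (a * b')) (d (a' * b))"
    using * by (intro d_diff A_intros)
  also have "\<dots> \<le> d (b * b')"
    using * dm[of a b'] dm[of a' b] by (simp add: d_mult)
  finally have "(a * b' - a' * b) / (b * b') \<in> O_inf"
    using * by (intro O_infI A_intros) auto
  moreover have "x - y = (a * b' - a' * b) / (b * b')"
    using * xy by (simp add: diff_frac_eq)
  ultimately show "x - y \<in> O_inf" by simp
  have "a * a' / (b * b') \<in> O_inf"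
    using * dm[of a a'] by (intro O_infI A_intros) (auto simp: d_mult)
  then show "x * y \<in> O_inf" using xy by simp
qed

lemma O_inf_total: "z \<in> F \<Longrightarrow> z \<in> O_inf \<or> inverse z \<in> O_inf"
proof -
  assume "z \<in> F"
  then obtain a b where *: "a \<in> A" "b \<in> A" "b \<noteq> 0" "z = a / b" using frac by blast
  show ?thesis
  proof (cases "d a \<le> d b")
    case False
    then have "a \<noteq> 0" using d_0 by auto
    then show ?thesis using * False O_infI[of b a] by simp
  qed (use * O_infI in auto)
qed

lemma O_inf_valuation_ring: "O_inf \<in> valuation_rings \<iota> F"
proof -
  obtain a where a: "a \<in> A" "a \<noteq> 0" "d a > 0" "a \<notin> range \<iota>" by (rule nonconstant)
  have "\<iota> c \<in> O_inf" for c
    using O_infI[of "\<iota> c" 1] A by (simp add: const_mem subring_1 d_const)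
  moreover have "inverse a \<in> O_inf"
    using O_infI[of 1 a] a A by (simp add: subring_1 d_1 divide_inverse)
  moreover have "inverse a \<notin> range \<iota>"
  proof
    assume "inverse a \<in> range \<iota>"
    then obtain c where "inverse a = \<iota> c" by auto
    then have "inverse (inverse a) = \<iota> (inverse c)" by (simp only: const_embedding_inverse[OF \<iota>])
    with a show False by auto
  qed
  moreover have "a \<notin> O_inf"
    using O_inf_iff[of a 1] a A by (simp add: subring_1 d_1)
  ultimately show ?thesis
    unfolding valuation_rings_def
    using O_inf_subring O_inf_sub O_inf_total a A_F by blast
qed

lemma P_inf_eq: "nonunits O_inf = P_inf"
proof (intro equalityI subsetI)
  fix z assume "z \<in> nonunits O_inf"
  then have z: "z \<in> O_inf" "z = 0 \<or> inverse z \<notin> O_inf" unfolding nonunits_def by auto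
  then obtain a b where *: "a \<in> A" "b \<in> A" "b \<noteq> 0" "z = a / b" unfolding O_inf_def by auto
  show "z \<in> P_inf"
    using z * O_inf_iff[of b a] P_infI[of a b] by (cases "a = 0") auto
next
  fix z assume "z \<in> P_inf"
  then obtain a b where *: "a \<in> A" "b \<in> A" "b \<noteq> 0" "z = a / b" "a = 0 \<or> d a < d b"
    unfolding P_inf_def by auto
  then show "z \<in> nonunits O_inf"
    using O_inf_iff[of b a] O_infI[of a b] d_0 unfolding nonunits_def by (cases "a = 0") auto
qed

lemma P_inf_place: "P_inf \<in> places \<iota> F" and val_ring_P_inf: "val_ring F P_inf = O_inf"
  using O_inf_valuation_ring P_inf_eq val_ring_nonunits[OF O_inf_valuation_ring]
  unfolding places_def by auto

definition v_inf :: "'h \<Rightarrow> int" where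
  "v_inf z = (THE n. \<exists>a\<in>A. \<exists>b\<in>A. a \<noteq> 0 \<and> b \<noteq> 0 \<and> z = a / b \<and> n = int (d b) - int (d a))"

lemma v_inf_divide:
  assumes "a \<in> A" "b \<in> A" "a \<noteq> 0" "b \<noteq> 0"
  shows "v_inf (a / b) = int (d b) - int (d a)"
  unfolding v_inf_def
proof (rule the_equality)
  fix n assume "\<exists>a'\<in>A. \<exists>b'\<in>A. a' \<noteq> 0 \<and> b' \<noteq> 0 \<and> a / b = a' / b' \<and> n = int (d b') - int (d a')"
  then obtain a' b' where *: "a' \<in> A" "b' \<in> A" "a' \<noteq> 0" "b' \<noteq> 0" "a / b = a' / b'"
    "n = int (d b') - int (d a')" by blast
  then show "n = int (d b) - int (d a)"
    using frac_degrees[of a b a' b'] assms by simp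
qed (use assms in blast)

lemma P_inf_discrete': "discrete_place F P_inf v_inf"
proof
  fix x y assume "x \<in> F" "x \<noteq> 0" "y \<in> F" "y \<noteq> 0"
  then obtain a b a' b' where *: "a \<in> A" "b \<in> A" "b \<noteq> 0" "x = a / b" "a \<noteq> 0"
    "a' \<in> A" "b' \<in> A" "b' \<noteq> 0" "y = a' / b'" "a' \<noteq> 0"
    using frac by (metis div_0)
  then have "v_inf ((a * a') / (b * b')) = int (d (b * b')) - int (d (a * a'))"
    by (intro v_inf_divide A_intros) auto
  with * show "v_inf (x * y) = v_inf x + v_inf y" by (simp add: v_inf_divide d_mult)
next
  obtain c where c: "\<And>n. n \<ge> c \<Longrightarrow> n \<in> degrees" using conductor by blast
  from c[of c] c[of "Suc c"] obtain a b where "a \<in> A" "a \<noteq> 0" "d a = c" "b \<in> A" "b \<noteq> 0" "d b = Suc c"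
    by (auto elim!: degreesE)
  then show "\<exists>t\<in>F. t \<noteq> 0 \<and> v_inf t = 1"
    using A_F F by (intro bexI[of _ "a / b"]) (auto simp: v_inf_divide intro!: subfield_divide)
next
  have *: "z \<in> O_inf \<longleftrightarrow> v_inf z \<ge> 0" "z \<in> P_inf \<longleftrightarrow> v_inf z \<ge> 1" if z: "z \<in> F" "z \<noteq> 0" for z
  proof -
    obtain a b where *: "a \<in> A" "b \<in> A" "b \<noteq> 0" "z = a / b" "a \<noteq> 0"
      using frac[OF z(1)] z(2) by auto
    then show "z \<in> O_inf \<longleftrightarrow> v_inf z \<ge> 0" "z \<in> P_inf \<longleftrightarrow> v_inf z \<ge> 1"
      by (auto simp: v_inf_divide O_inf_iff P_inf_iff)
  qed
  have zero: "0 \<in> F" "0 \<in> O_inf" "0 \<in> P_inf"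
    using F O_inf_subring place_0[OF P_inf_place] by (auto simp: subring_0 subfield_intros)
  have sub: "P_inf \<subseteq> O_inf" using place_subset[OF P_inf_place] val_ring_P_inf by simp
  show "val_ring F P_inf = level F v_inf 0"
    unfolding val_ring_P_inf level_def using * O_inf_sub zero by blast
  show "P_inf = level F v_inf 1"
    unfolding level_def using * O_inf_sub sub zero by blast
qed (use F O_inf_subring val_ring_P_inf in auto)

lemma P_inf_discrete: "discrete_place F P_inf (valuation F P_inf)"
  using P_inf_discrete' by (rule discrete_place.valuation_discrete)

lemma valuation_P_inf:
  assumes "a \<in> A" "a \<noteq> 0"
  shows "valuation F P_inf a = - int (d a)"
  using discrete_place.valuation_eq[OF P_inf_discrete', of a] assms A_F v_inf_divide[of a 1] A
  by (simp add: subring_1 d_1)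

lemma place_degree_eq:
  assumes P: "P \<in> places \<iota> F" and B: "residue_basis \<iota> F P B"
  shows "place_degree \<iota> F P = card B"
  unfolding place_degree_def
proof (rule the_equality)
  note R = place_subring[OF P] place_const[OF P]
  fix n assume "\<exists>B. residue_basis \<iota> F P B \<and> card B = n"
  then obtain B' where B': "residue_basis \<iota> F P B'" "card B' = n" by auto
  have "CARD('k) ^ card B = CARD('k) ^ card B'"
    unfolding residue_basis_imp_system(2)[OF \<iota> B R place_0[OF P], symmetric]
      residue_basis_imp_system(2)[OF \<iota> B'(1) R place_0[OF P], symmetric]
    by (rule residue_system_card_unique[OF residue_basis_imp_system(1)[OF \<iota> B R place_0[OF P]]
        residue_basis_imp_system(1)[OF \<iota> B'(1) R place_0[OF P]] place_diff[OF P F]])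
  then show "n = card B" using B' card_ge_2 by simp
qed (use B in blast)

text \<open>Subtracting the constant supplied by \<open>d_lead\<close> lowers the degree of the
  numerator, so the residue field consists of the constants.\<close>

lemma place_degree_P_inf: "place_degree \<iota> F P_inf = 1"
proof -
  have "residue_basis \<iota> F P_inf {1}"
    unfolding residue_basis_def val_ring_P_inf
  proof (intro conjI ballI allI impI)
    show "{1} \<subseteq> O_inf" using O_inf_subring by (auto simp: subring_1)
  next
    fix z assume "z \<in> O_inf"
    then obtain a b where *: "a \<in> A" "b \<in> A" "b \<noteq> 0" "z = a / b" "d a \<le> d b"
      unfolding O_inf_def by auto
    obtain c where c: "a - \<iota> c * b = 0 \<or> d (a - \<iota> c * b) < d b"
    proof (cases "a \<noteq> 0 \<and> d a = d b")
      case True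
      then show ?thesis using d_lead[of a b] * that by auto
    next
      case False
      then show ?thesis using * by (intro that[of 0]) (auto simp: \<iota>_simps)
    qed
    have "(a - \<iota> c * b) / b \<in> P_inf" using * c by (intro P_infI A_intros)
    then have "z - (\<Sum>b\<in>{1}. \<iota> c * b) \<in> P_inf" using * by (simp add: diff_divide_distrib)
    then show "\<exists>a. z - (\<Sum>b\<in>{1}. \<iota> (a b) * b) \<in> P_inf" by (intro exI[of _ "\<lambda>_. c"])
  next
    fix a b assume "(\<Sum>b\<in>{1}. \<iota> (a b) * b) \<in> P_inf" and b: "b \<in> {1::'h}"
    then have "\<iota> (a 1) / 1 \<in> P_inf" by simp
    then have "\<iota> (a 1) = 0"
      by (subst (asm) P_inf_iff) (auto simp: const_mem subring_1[OF A] d_1)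
    then show "a b = 0" using b by (simp add: \<iota>_simps)
  qed simp
  from place_degree_eq[OF P_inf_place this] show ?thesis by simp
qed

subsection \<open>Every other place is centred on the ring\<close>

text \<open>Division with remainder by \<open>a\<close>: beyond the conductor the degree
  \<open>n - d a\<close> is attained, so a multiple of \<open>a\<close> can cancel the leading
  term.\<close>

lemma division_step:
  assumes a: "a \<in> A" "a \<noteq> 0"
  shows "\<exists>C. \<forall>n\<ge>C. \<forall>b\<in>filt (Suc n). \<exists>b'\<in>filt (Suc n - d a). b - a * b' \<in> filt n"
proof -
  obtain c where c: "\<And>n. n \<ge> c \<Longrightarrow> n \<in> degrees" using conductor by blast
  have "\<exists>b'\<in>filt (Suc n - d a). b - a * b' \<in> filt n"
    if b: "b \<in> filt (Suc n)" and n: "n \<ge> c + d a" for n b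
  proof (cases "b \<in> filt n")
    case True
    then show ?thesis using filt_0 by (intro bexI[of _ 0]) auto
  next
    case False
    then have b': "b \<in> A" "b \<noteq> 0" "d b = n" using b by (auto simp: filt_def)
    obtain e where e: "e \<in> A" "e \<noteq> 0" "d e = n - d a" using c n by (metis add_le_imp_le_diff degreesE)
    then have ae: "d (a * e) = n" "a * e \<noteq> 0" "a * e \<in> A" using a n by (auto simp: d_mult A_intros)
    with d_lead[of b "a * e"] b' obtain k where "b - \<iota> k * (a * e) = 0 \<or> d (b - \<iota> k * (a * e)) < n"
      by auto
    moreover have "b - \<iota> k * (a * e) \<in> A" using b' a e by (intro A_intros)
    moreover have "b - \<iota> k * (a * e) = b - a * (\<iota> k * e)" by (simp add: ac_simps)
    ultimately have "b - a * (\<iota> k * e) \<in> filt n"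
      by (simp add: filt_def)
    moreover have "\<iota> k * e \<in> filt (Suc n - d a)"
      using e n by (intro filt_const_mult) (auto simp: filt_def)
    ultimately show ?thesis by blast
  qed
  then show ?thesis by blast
qed

text \<open>Divisibility in a valuation ring is a total preorder, so a finite set has an element
  dividing all others.\<close>

lemma dominating_element:
  assumes R: "R \<in> valuation_rings \<iota> F" and "finite X" "X \<subseteq> F" "x \<in> X" "x \<noteq> 0"
  shows "\<exists>h\<in>X. h \<noteq> 0 \<and> (\<forall>y\<in>X. y / h \<in> R)"
proof -
  have sub: "is_subring R" and tot: "\<And>z. z \<in> F \<Longrightarrow> z \<in> R \<or> inverse z \<in> R"
    using R unfolding valuation_rings_def by auto
  have "X \<subseteq> F \<Longrightarrow> (\<forall>y\<in>X. y = 0) \<or> (\<exists>h\<in>X. h \<noteq> 0 \<and> (\<forall>y\<in>X. y / h \<in> R))"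
    using \<open>finite X\<close>
  proof (induction X rule: finite_induct)
    case (insert z X)
    show ?case
    proof (cases "z = 0")
      case True
      then show ?thesis using insert subring_0[OF sub] by auto
    next
      case z: False
      from insert consider "\<forall>y\<in>X. y = 0" | h where "h \<in> X" "h \<noteq> 0" "\<forall>y\<in>X. y / h \<in> R" by auto
      then show ?thesis
      proof cases
        case 1
        then show ?thesis
          using z subring_0[OF sub] subring_1[OF sub] by (intro disjI2 bexI[of _ z]) auto
      next
        case (2 h)
        then have "z / h \<in> F" using insert F by (auto intro!: subfield_divide)
        with tot consider "z / h \<in> R" | "h / z \<in> R" by (metis inverse_divide)
        then show ?thesis
        proof cases
          case 1
          then show ?thesis using 2 by (intro disjI2 bexI[of _ h]) auto
        next
          case hz: 2
          have "y / z \<in> R" if "y \<in> X" for y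
          proof -
            have "(y / h) * (h / z) \<in> R" using that 2 hz by (intro subring_mult[OF sub]) auto
            then show ?thesis using 2 by simp
          qed
          then show ?thesis
            using z subring_1[OF sub] by (intro disjI2 bexI[of _ z]) auto
        qed
      qed
    qed
  qed auto
  with assms show ?thesis by auto
qed

text \<open>By \<open>division_step\<close>, \<open>A\<close> is generated as a module over the
  powers of \<open>a\<close> by the finite set \<open>filt (Suc C)\<close>. If \<open>h\<close>
  dominates this set, all of \<open>A\<close> lies in \<open>h R\<close>.\<close>

lemma subset_valuation_ring:
  assumes R: "R \<in> valuation_rings \<iota> F" and a: "a \<in> A" "a \<in> R" "d a > 0"
  shows "A \<subseteq> R"
proof
  have sub: "is_subring R" using R unfolding valuation_rings_def by auto
  have "a \<noteq> 0" using a d_0 by auto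
  obtain C where C: "\<And>n b. b \<in> filt (Suc n) \<Longrightarrow> n \<ge> C \<Longrightarrow>
    \<exists>b'\<in>filt (Suc n - d a). b - a * b' \<in> filt n"
    using division_step[OF a(1) \<open>a \<noteq> 0\<close>] by blast
  have "1 \<in> filt (Suc C)" using A by (simp add: filt_def subring_1 d_1)
  then obtain h where h: "h \<in> filt (Suc C)" "h \<noteq> 0" "\<And>y. y \<in> filt (Suc C) \<Longrightarrow> y / h \<in> R"
    using dominating_element[OF R finite_filt, of "Suc C" 1] A_F filt_A
    by (metis one_neq_zero subsetI)
  have key: "b / h \<in> R" if "b \<in> filt n" for b n
    using that
  proof (induction n arbitrary: b rule: less_induct)
    case (less n)
    show ?case
    proof (cases "n \<le> Suc C")
      case True
      then show ?thesis using filt_mono[OF less.prems] h by auto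
    next
      case False
      then obtain m where m: "n = Suc m" "m \<ge> C" by (cases n) auto
      then obtain b' where b': "b' \<in> filt (n - d a)" "b - a * b' \<in> filt m"
        using C less.prems by auto
      have "b' / h \<in> R" "(b - a * b') / h \<in> R"
        using less.IH[OF _ b'(1)] less.IH[OF _ b'(2)] m a by auto
      then have "a * (b' / h) + (b - a * b') / h \<in> R" using sub a by (intro subring_intros)
      then show ?thesis by (simp add: diff_divide_distrib)
    qed
  qed
  fix b assume "b \<in> A"
  \<comment> \<open>\<open>h\<close> itself lies in \<open>A\<close>, so \<open>key\<close> applies
    to \<open>b * h\<close>, and the denominator \<open>h\<close> cancels.\<close>
  then have "b * h \<in> filt (Suc (d (b * h)))" using h filt_A by (intro mem_filt_Suc_d A_intros)
  from key[OF this] show "b \<in> R" using h by simp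
qed

text \<open>The same argument with \<open>inverse a\<close> in place of \<open>a\<close>: fractions
  \<open>y / a ^ k\<close> with \<open>d y\<close> at most \<open>k * d a\<close> reduce to the
  finite set \<open>X\<close> by division by \<open>a\<close>, hence all lie in \<open>h R\<close>
  for one such fraction \<open>h\<close>. Since \<open>z * h\<close> is again such a fraction,
  \<open>z\<close> lies in \<open>R\<close>.\<close>

lemma O_inf_subset_valuation_ring:
  assumes R: "R \<in> valuation_rings \<iota> F" and pole: "\<And>a. a \<in> A \<Longrightarrow> d a > 0 \<Longrightarrow> a \<notin> R"
  shows "O_inf \<subseteq> R"
proof
  have sub: "is_subring R" and tot: "\<And>z. z \<in> F \<Longrightarrow> z \<in> R \<or> inverse z \<in> R" and cR: "range \<iota> \<subseteq> R"
    using R unfolding valuation_rings_def by auto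
  fix z assume "z \<in> O_inf"
  then obtain b a where z: "b \<in> A" "a \<in> A" "a \<noteq> 0" "z = b / a" "d b \<le> d a"
    unfolding O_inf_def by auto
  show "z \<in> R"
  proof (cases "d a = 0")
    case True
    then obtain c e where "b = \<iota> c" "a = \<iota> e" using z d_0_imp_const by (metis imageE le_zero_eq)
    then have "z = \<iota> (c / e)" using z by (simp add: \<iota>_simps)
    then show ?thesis using cR by auto
  next
    case False
    then have D: "d a > 0" by simp
    have ia: "inverse a \<in> R" using pole[OF z(2) D] tot z A_F by auto
    obtain C where C: "\<And>n b. b \<in> filt (Suc n) \<Longrightarrow> n \<ge> C \<Longrightarrow>
      \<exists>b'\<in>filt (Suc n - d a). b - a * b' \<in> filt n"
      using division_step[OF z(2,3)] by blast
    define X where "X = (\<Union>k\<le>C. (\<lambda>y. y / a ^ k) ` filt (Suc (k * d a)))"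
    have "finite X" unfolding X_def using finite_filt by auto
    moreover have "X \<subseteq> F"
      unfolding X_def using filt_A A_F z(2) F by (auto intro!: subfield_intros)
    moreover have "1 \<in> X"
      unfolding X_def using A by (auto intro!: bexI[of _ 0] simp: filt_def subring_1 d_1 image_iff)
    ultimately obtain h where h: "h \<in> X" "h \<noteq> 0" "\<And>y. y \<in> X \<Longrightarrow> y / h \<in> R"
      using dominating_element[OF R, of X 1] by auto
    have key: "y / a ^ k / h \<in> R" if "y \<in> filt n" "n \<le> Suc (k * d a)" for y n k
      using that
    proof (induction n arbitrary: y k rule: less_induct)
      case (less n)
      show ?case
      proof (cases "n \<le> Suc (C * d a)")
        case small: True
        show ?thesis
        proof (cases "k \<le> C")
          case True
          then have "y / a ^ k \<in> X"
            unfolding X_def using filt_mono[OF less.prems] by blast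
          then show ?thesis using h by blast
        next
          case False
          have "y / a ^ C \<in> X"
            unfolding X_def using filt_mono[OF less.prems(1) small] by blast
          then have "y / a ^ C / h * inverse a ^ (k - C) \<in> R"
            using h ia by (intro subring_mult[OF sub] subring_power[OF sub])
          moreover have "a ^ k = a ^ C * a ^ (k - C)"
            using False by (simp flip: power_add)
          ultimately show ?thesis by (simp add: divide_simps ac_simps)
        qed
      next
        case False
        moreover have "C \<le> C * d a" using D by simp
        ultimately obtain m where m: "n = Suc m" "m \<ge> C" "m > 0" by (cases n) auto
        then obtain k' where k: "k = Suc k'" using less.prems by (cases k) auto
        obtain y' where y': "y' \<in> filt (n - d a)" "y - a * y' \<in> filt m"
          using C m less.prems by auto
        have "y' / a ^ k' / h \<in> R"
          using less.IH[OF _ y'(1), of k'] m D less.prems k by auto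
        moreover have "(y - a * y') / a ^ k / h \<in> R"
          using less.IH[OF _ y'(2), of k] m less.prems by auto
        moreover have "y / a ^ k / h = y' / a ^ k' / h + (y - a * y') / a ^ k / h"
          using z(3) k h(2) by (simp add: field_simps)
        ultimately show ?thesis using sub by (simp add: subring_add)
      qed
    qed
    obtain j h' where h': "h = h' / a ^ j" "h' \<in> filt (Suc (j * d a))"
      using h(1) unfolding X_def by auto
    have "b \<in> filt (Suc (d a))" using z by (simp add: filt_def)
    from filt_mult[OF this h'(2)] have "b * h' \<in> filt (Suc (Suc j * d a))" by simp
    from key[OF this order.refl] have "b * h' / a ^ Suc j / h \<in> R" .
    moreover have "b * h' / a ^ Suc j / h = z" using z h h' by (simp add: field_simps)
    ultimately show ?thesis by simp
  qed
qed

text \<open>If \<open>A\<close> is not contained in the ring, no nonconstant element of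
  \<open>A\<close> is, so the ring contains \<open>O_inf\<close>. A proper ring cannot be larger
  than \<open>O_inf\<close>, because one pole at infinity would generate elements of arbitrary pole
  order.\<close>

lemma place_cases:
  assumes P: "P \<in> places \<iota> F" and "P \<noteq> P_inf"
  shows "A \<subseteq> val_ring F P"
proof (rule ccontr)
  assume not: "\<not> A \<subseteq> val_ring F P"
  define R where "R = val_ring F P"
  have R: "R \<in> valuation_rings \<iota> F" "P = nonunits R"
    using place_valuation_ring[OF P] by (auto simp: R_def)
  have "a \<notin> R" if "a \<in> A" "d a > 0" for a
    using subset_valuation_ring[OF R(1) that(1) _ that(2)] not unfolding R_def by blast
  from O_inf_subset_valuation_ring[OF R(1) this] have sub: "O_inf \<subseteq> R" .
  interpret discrete_place F P_inf v_inf by (rule P_inf_discrete')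
  have Rs: "is_subring R" "R \<subseteq> F" "R \<noteq> F" using R(1) unfolding valuation_rings_def by auto
  have "R \<subseteq> O_inf"
  proof (rule ccontr)
    assume "\<not> R \<subseteq> O_inf"
    then obtain r where r: "r \<in> R" "r \<notin> O_inf" by auto
    then have r': "r \<in> F" "r \<noteq> 0" "v_inf r < 0"
      using Rs mem_val_ring[of r] val_ring_P_inf by auto
    have "y \<in> R" if "y \<in> F" for y
    proof (cases "y = 0")
      case False
      define n where "n = nat \<bar>v_inf y\<bar>"
      have "int n * v_inf r \<le> int n * (-1)" using r' by (intro mult_left_mono) auto
      then have "v_inf (y / r ^ n) \<ge> 0"
        using r' that False by (simp add: v_divide v_power subfield_intros[OF F] n_def)
      then have "y / r ^ n \<in> O_inf"
        using r' that by (simp add: mem_val_ring[unfolded val_ring_P_inf] subfield_intros[OF F])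
      then have "(y / r ^ n) * r ^ n \<in> R" using sub r Rs by (intro subring_intros) auto
      then show ?thesis using r' by simp
    qed (use Rs subring_0 in auto)
    with Rs show False by auto
  qed
  with sub have "P = P_inf" using R P_inf_eq by auto
  with \<open>P \<noteq> P_inf\<close> show False by simp
qed

end

locale normal_degree_ring = degree_ring \<iota> F A d
  for \<iota> :: "'k::{field,finite} \<Rightarrow> 'h::field" and F A d +
  assumes int_closed: "\<And>z. z \<in> F \<Longrightarrow> z \<in> adjoin A (inverse z) \<Longrightarrow> z \<in> A"
begin

text \<open>Where normality enters: an element outside \<open>A\<close> is not integral, so a
  valuation ring containing \<open>A\<close> avoids it. The place of this ring is not infinity,
  because \<open>O_inf\<close> does not contain \<open>A\<close>.\<close>

lemma no_other_poles_imp_mem_A: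
  assumes z: "z \<in> F" and "\<And>P. P \<in> places \<iota> F \<Longrightarrow> P \<noteq> P_inf \<Longrightarrow> z \<in> val_ring F P"
  shows "z \<in> A"
proof (rule ccontr)
  assume "z \<notin> A"
  then have "z \<notin> adjoin A (inverse z)" using int_closed z by blast
  from valuation_subring_exists[OF F A A_sub z this] obtain R where
    R: "is_subring R" "A \<subseteq> R" "R \<subseteq> F" "z \<notin> R" "\<forall>y\<in>F. y \<in> R \<or> inverse y \<in> R" by blast
  obtain a where a: "a \<in> A" "a \<notin> range \<iota>" by (rule nonconstant)
  have "R \<in> valuation_rings \<iota> F"
    unfolding valuation_rings_def using R z const_sub a by blast
  then have "nonunits R \<in> places \<iota> F" "val_ring F (nonunits R) = R"
    unfolding places_def using val_ring_nonunits by auto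
  moreover have "nonunits R \<noteq> P_inf"
  proof
    assume "nonunits R = P_inf"
    then have "R = O_inf" using calculation val_ring_P_inf by simp
    obtain a where a: "a \<in> A" "d a > 0" using nonconstant by metis
    then have "a / 1 \<in> O_inf" using R \<open>R = O_inf\<close> by auto
    then show False using O_inf_iff[of a 1] a A d_1 by (simp add: subring_1)
  qed
  ultimately show False using assms R by auto
qed

end

context degree_ring
begin

subsection \<open>The finite places are discrete\<close>

text \<open>If \<^term>\<open>Z\<close> is pairwise incongruent modulo \<^term>\<open>f\<close>, the sums of \<^term>\<open>N\<close> digits from
  \<^term>\<open>Z\<close> are pairwise distinct, and after clearing denominators they lie in \<^term>\<open>A\<close> and have degree
  at most \<^term>\<open>N * d f + C\<close>. Comparing cardinalities for large \<^term>\<open>N\<close> bounds \<^term>\<open>card Z\<close>.\<close>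

lemma card_incongruent_le:
  assumes R: "is_subring R" "A \<subseteq> R" "R \<subseteq> F" and f: "f \<in> A" "f \<noteq> 0"
    and Z: "finite Z" "incongruent R f Z"
  shows "card Z \<le> CARD('k) ^ d f"
proof -
  have ZF: "Z \<subseteq> F" using Z R unfolding incongruent_def by auto
  have "\<exists>b\<in>A. b \<noteq> 0 \<and> (\<forall>z\<in>Z. b * z \<in> A)"
    using Z(1) ZF
  proof (induction Z rule: finite_induct)
    case empty
    then show ?case using A by (intro bexI[of _ 1]) (auto simp: subring_1)
  next
    case (insert z Z)
    then obtain b where b: "b \<in> A" "b \<noteq> 0" "\<forall>z\<in>Z. b * z \<in> A" by auto
    obtain s t where st: "s \<in> A" "t \<in> A" "t \<noteq> 0" "z = s / t" using frac insert.prems by blast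
    have "(b * t) * y \<in> A" if "y \<in> insert z Z" for y
    proof (cases "y = z")
      case True
      then have "(b * t) * y = b * s" using st by simp
      moreover have "b * s \<in> A" using b st by (intro A_intros)
      ultimately show ?thesis by metis
    next
      case False
      then have "b * y \<in> A" using that b by auto
      then have "(b * y) * t \<in> A" using st by (simp add: subring_mult[OF A])
      then show ?thesis by (simp add: ac_simps)
    qed
    then show ?case using b st by (intro bexI[of _ "b * t"]) (auto simp: A_intros)
  qed
  then obtain b where b: "b \<in> A" "b \<noteq> 0" "\<forall>z\<in>Z. b * z \<in> A" by auto
  obtain C where "\<forall>n\<in>(\<lambda>z. d (b * z)) ` Z. n \<le> C"
    using finite_nat_set_iff_bounded_le[of "(\<lambda>z. d (b * z)) ` Z"] Z(1) by auto
  then have C: "b * z \<in> filt (Suc C)" if "z \<in> Z" for z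
    using that b by (auto simp: filt_def)
  have "card Z ^ N \<le> CARD('k) ^ Suc C * (CARD('k) ^ d f) ^ N" for N
  proof -
    have "b * y \<in> filt (N * d f + Suc C)" if "y \<in> digit_sums f Z N" for y
      using that
    proof (induction N arbitrary: y)
      case 0
      then show ?case using filt_0 by simp
    next
      case (Suc N)
      then obtain z x where zx: "y = z + f * x" "z \<in> Z" "x \<in> digit_sums f Z N" by auto
      have "f * (b * x) \<in> filt (d f + (N * d f + Suc C))"
        by (rule filt_mult[OF mem_filt_Suc_d[OF f(1)] Suc.IH[OF zx(3)]])
      moreover have "b * z \<in> filt (d f + (N * d f + Suc C))"
        using C[OF zx(2)] by (rule filt_mono) simp
      ultimately have "b * z + f * (b * x) \<in> filt (d f + (N * d f + Suc C))" by (intro filt_add)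
      then show ?case by (simp add: zx algebra_simps)
    qed
    then have "(\<lambda>y. b * y) ` digit_sums f Z N \<subseteq> filt (N * d f + Suc C)" by auto
    moreover have "inj_on (\<lambda>y. b * y) (digit_sums f Z N)" using b by (auto simp: inj_on_def)
    ultimately have "card (digit_sums f Z N) \<le> card (filt (N * d f + Suc C))"
      using finite_filt by (intro card_inj_on_le)
    also have "\<dots> \<le> CARD('k) ^ (N * d f + Suc C)" by (rule card_filt_le)
    also have "\<dots> = CARD('k) ^ Suc C * (CARD('k) ^ d f) ^ N"
      by (simp add: power_add ac_simps flip: power_mult)
    finally show ?thesis
      using digit_sums[OF R(1) _ f(2) Z, of N] R f by auto
  qed
  then show ?thesis by (rule power_le_const_mult_power) simp
qed

text \<open>Pigeonhole on \<open>card_incongruent_le\<close>. It takes the role of a chain condition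
  in the proofs that finite places are discrete, and later produces denominators in \<open>u\<close>
  alone.\<close>

lemma congruent_pair_in_sequence:
  fixes x :: "nat \<Rightarrow> 'h"
  assumes R: "is_subring R" "A \<subseteq> R" "R \<subseteq> F" and f: "f \<in> A" "f \<noteq> 0"
    and x: "\<And>i. x i \<in> R"
  shows "\<exists>i j r. i < j \<and> r \<in> R \<and> x i - x j = f * r"
proof (rule ccontr)
  assume not: "\<not> ?thesis"
  define n where "n = Suc (CARD('k) ^ d f)"
  have neq: "i = j" if "x i - x j = f * r" "r \<in> R" for i j r
  proof (rule ccontr)
    assume "i \<noteq> j"
    then consider "i < j" | "j < i" by linarith
    then show False
    proof cases
      case 2
      moreover have "x j - x i = f * (- r)" using that by (simp add: algebra_simps)
      ultimately show False using not that subring_uminus[OF R(1)] by blast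
    qed (use not that in blast)
  qed
  have "inj_on x {..<n}"
    using neq[of _ _ 0] subring_0[OF R(1)] by (auto simp: inj_on_def)
  then have "card (x ` {..<n}) = n" by (simp add: card_image)
  moreover have "incongruent R f (x ` {..<n})"
    unfolding incongruent_def using x neq by blast
  ultimately show False
    using card_incongruent_le[OF R f, of "x ` {..<n}"] by (simp add: n_def)
qed

definition finite_places :: "'h set set" where
  "finite_places = places \<iota> F - {P_inf}"

lemma finite_placeD:
  assumes "P \<in> finite_places"
  shows "P \<in> places \<iota> F" "is_subring (val_ring F P)" "A \<subseteq> val_ring F P" "val_ring F P \<subseteq> F"
  using assms place_cases[of P] place_subring[of P \<iota> F] place_val_ring_sub[of P \<iota> F]
  unfolding finite_places_def by auto

lemma finite_place_meets_A:
  assumes "P \<in> finite_places"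
  shows "\<exists>a\<in>A. a \<noteq> 0 \<and> a \<in> P"
proof -
  note P = finite_placeD[OF assms]
  obtain y where y: "y \<in> F" "y \<notin> val_ring F P" using place_proper[OF P(1)] P(4) by blast
  have "y \<noteq> 0" using y subring_0[OF P(2)] by auto
  have "inverse y \<in> val_ring F P" using place_total[OF P(1) y(1)] y by auto
  then have iy: "inverse y \<in> P"
    using place_unit_iff[OF P(1), of "inverse y"] y \<open>y \<noteq> 0\<close> by auto
  obtain a b where ab: "a \<in> A" "b \<in> A" "b \<noteq> 0" "y = a / b" using frac[OF y(1)] by blast
  then have "inverse y * a = b" using \<open>y \<noteq> 0\<close> by simp
  moreover have "inverse y * a \<in> P" using place_mult[OF P(1) iy] ab P(3) by blast
  ultimately show ?thesis using ab by metis
qed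

text \<open>If \<open>P\<close> were not principal, there would be a sequence in \<open>P\<close>
  with all \<open>x n / x (Suc n)\<close> in \<open>P\<close>. Two terms are congruent modulo a
  multiple of \<open>x 0\<close>; dividing by the later one, \<open>x j\<close>, puts both
  \<open>x i / x j\<close> and \<open>x i / x j - 1\<close> into \<open>P\<close>.\<close>

lemma finite_place_uniformizer:
  assumes "P \<in> finite_places"
  shows "\<exists>t. t \<noteq> 0 \<and> P = (\<lambda>r. t * r) ` val_ring F P"
proof (rule ccontr)
  assume not: "\<not> ?thesis"
  note P = finite_placeD[OF assms]
  obtain f where f: "f \<in> A" "f \<noteq> 0" "f \<in> P" using finite_place_meets_A[OF assms] by blast
  have step: "\<exists>t'. (t' \<in> P \<and> t' \<noteq> 0) \<and> t / t' \<in> P" if t: "t \<in> P \<and> t \<noteq> 0" for t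
  proof -
    have "(\<lambda>r. t * r) ` val_ring F P \<subseteq> P" using place_mult[OF P(1)] t by auto
    then obtain t' where t': "t' \<in> P" "t' \<notin> (\<lambda>r. t * r) ` val_ring F P"
      using not t by blast
    have "t' \<noteq> 0" using t' subring_0[OF P(2)] by force
    have n: "t' / t \<notin> val_ring F P"
    proof
      assume "t' / t \<in> val_ring F P"
      then have "t * (t' / t) \<in> (\<lambda>r. t * r) ` val_ring F P" by (rule imageI)
      then show False using t' t by simp
    qed
    have "t' / t \<in> F" using t t' P place_subset[OF P(1)] F by (auto intro!: subfield_divide)
    then have "t / t' \<in> val_ring F P" using place_total[OF P(1), of "t' / t"] n by simp
    then have "t / t' \<in> P"
      using place_unit_iff[OF P(1), of "t / t'"] n t \<open>t' \<noteq> 0\<close> by auto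
    then show ?thesis using t' \<open>t' \<noteq> 0\<close> by auto
  qed
  have "\<exists>x. \<forall>n. (x n \<in> P \<and> x n \<noteq> 0) \<and> x n / x (Suc n) \<in> P"
    by (rule dependent_nat_choice) (use f step in auto)
  then obtain x where x: "\<And>n. x n \<in> P" "\<And>n. x n \<noteq> 0" "\<And>n. x n / x (Suc n) \<in> P" by blast
  \<comment> \<open>The counting bound needs a modulus in \<open>A\<close>, so \<open>x 0\<close> is
    replaced by a multiple of it that lies there.\<close>
  obtain g where g: "g \<in> A" "g \<noteq> 0" "\<exists>r\<in>val_ring F P. g = x 0 * r"
  proof -
    obtain a b where ab: "a \<in> A" "b \<in> A" "b \<noteq> 0" "x 0 = a / b"
      using frac[of "x 0"] x(1)[of 0] place_subset[OF P(1)] P(4) by blast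
    then have "a = x 0 * b" "a \<noteq> 0" using x(2)[of 0] by auto
    then show thesis using that[of a] ab P(3) by blast
  qed
  have chain: "x i / x j \<in> P" if "i < j" for i j
    using that
  proof (induction j)
    case (Suc j)
    show ?case
    proof (cases "i = j")
      case False
      then have "x i / x j \<in> P" using Suc by auto
      then have "x i / x j * (x j / x (Suc j)) \<in> P"
        using place_mult[OF P(1)] x(3) place_subset[OF P(1)] by blast
      then show ?thesis using x(2) by simp
    qed (use x in auto)
  qed simp
  obtain i j r where ijr: "i < j" "r \<in> val_ring F P" "x i - x j = g * r"
    using congruent_pair_in_sequence[OF P(2-4) g(1,2), of x] x(1) place_subset[OF P(1)] by blast
  obtain s where s: "s \<in> val_ring F P" "g = x 0 * s" using g by auto
  have "x i - x j = x 0 * (s * r)" using ijr s by simp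
  then have "x i / x j - 1 = (x 0 / x j) * (s * r)"
    using x(2)[of j] by (simp add: field_simps)
  moreover have "(x 0 / x j) * (s * r) \<in> P"
  proof (rule place_mult[OF P(1)])
    show "x 0 / x j \<in> P" using chain[of 0 j] ijr by simp
    show "s * r \<in> val_ring F P" using s ijr by (intro subring_mult[OF P(2)])
  qed
  ultimately have "x i / x j - (x i / x j - 1) \<in> P"
    using chain[OF ijr(1)] place_diff[OF P(1) F] by metis
  then show False using place_1[OF P(1)] by simp
qed

text \<open>It remains to exclude that some nonzero \<open>f\<close> in \<open>A\<close> is
  divisible by all powers of \<open>t\<close>. Two powers of \<open>t\<close> are congruent modulo
  \<open>f\<close>, hence modulo the higher of the two; cancelling the lower one would give 1 in
  \<open>P\<close>.\<close>

lemma finite_place_discrete: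
  assumes "P \<in> finite_places"
  shows "discrete_place F P (valuation F P)"
proof -
  note P = finite_placeD[OF assms]
  obtain t where t: "t \<noteq> 0" "P = (\<lambda>r. t * r) ` val_ring F P"
    using finite_place_uniformizer[OF assms] by blast
  have "t * 1 \<in> P" by (subst t) (use subring_1[OF P(2)] in blast)
  then have tP: "t \<in> P" by simp
  then have tR: "t \<in> val_ring F P" using place_subset[OF P(1)] by auto
  have A_fact: "\<exists>n. \<exists>u\<in>val_ring F P - P. f = t ^ n * u" if f: "f \<in> A" "f \<noteq> 0" for f
  proof -
    have "\<exists>n. f \<notin> (\<lambda>r. t ^ n * r) ` val_ring F P"
    proof (rule ccontr)
      assume "\<not> ?thesis"
      then have all: "f \<in> (\<lambda>r. t ^ n * r) ` val_ring F P" for n by blast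
      obtain i j r where ijr: "i < j" "r \<in> val_ring F P" "t ^ i - t ^ j = f * r"
        using congruent_pair_in_sequence[OF P(2-4) f, of "\<lambda>i. t ^ i"] subring_power[OF P(2) tR] by blast
      obtain s where s: "s \<in> val_ring F P" "f = t ^ j * s" using all[of j] by auto
      have tj: "t ^ j = t ^ i * t ^ (j - i)" using ijr by (simp flip: power_add)
      have "t ^ i * (1 - t ^ (j - i)) = t ^ i * (t ^ (j - i) * (s * r))"
        using ijr(3) unfolding s(2) tj by (simp add: algebra_simps)
      then have "1 - t ^ (j - i) = t ^ (j - i) * (s * r)" using t by simp
      moreover have "t ^ (j - i) \<in> P"
      proof -
        have "t ^ (j - i) = t * t ^ (j - i - 1)" using ijr power_eq_if[of t "j - i"] by simp
        then show ?thesis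
          using place_mult[OF P(1) tP subring_power[OF P(2) tR], of "j - i - 1"] by metis
      qed
      moreover from this have "t ^ (j - i) * (s * r) \<in> P"
        using place_mult[OF P(1)] subring_mult[OF P(2)] ijr s by blast
      moreover have nP: "- a \<in> P" if "a \<in> P" for a
        using place_diff[OF P(1) F place_0[OF P(1)] that] by simp
      ultimately have "(1 - t ^ (j - i)) - (- (t ^ (j - i))) \<in> P"
        using place_diff[OF P(1) F] by metis
      then show False using place_1[OF P(1)] by simp
    qed
    then obtain n where n: "f \<notin> (\<lambda>r. t ^ n * r) ` val_ring F P"
      "\<And>m. m < n \<Longrightarrow> f \<in> (\<lambda>r. t ^ m * r) ` val_ring F P"
      using exists_least_iff[of "\<lambda>n. f \<notin> (\<lambda>r. t ^ n * r) ` val_ring F P"] by blast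
    have "n \<noteq> 0" using n(1) f(1) P(3) by (auto intro!: image_eqI[of _ _ f])
    then obtain m where m: "n = Suc m" by (cases n) auto
    obtain r where r: "r \<in> val_ring F P" "f = t ^ m * r" using n(2)[of m] m by auto
    have "r \<notin> P"
    proof
      assume "r \<in> P"
      then obtain r' where "r' \<in> val_ring F P" "r = t * r'" using t(2) by blast
      then show False using n(1) m r by (auto intro!: image_eqI[of _ _ r'])
    qed
    then show ?thesis using r by blast
  qed
  show ?thesis
  proof (rule discrete_placeI[OF P(1) F t])
    fix z assume "z \<in> F" "z \<noteq> 0"
    then obtain a b where ab: "a \<in> A" "b \<in> A" "b \<noteq> 0" "z = a / b" "a \<noteq> 0"
      using frac by (metis div_0)
    obtain n u where u: "u \<in> val_ring F P - P" "a = t ^ n * u" using A_fact ab by blast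
    obtain m w where w: "w \<in> val_ring F P - P" "b = t ^ m * w" using A_fact ab by blast
    have "u / w \<in> val_ring F P - P"
      using u w unfolding place_unit_iff[OF P(1)] by (auto simp: divide_inverse intro!: subring_mult[OF P(2)])
    moreover have "z = t powi (int n - int m) * (u / w)"
      using ab u w t by (simp add: power_int_diff)
    ultimately show "\<exists>n. \<exists>u\<in>val_ring F P - P. z = t powi n * u" by blast
  qed
qed

text \<open>The uniformizer \<open>t\<close> divides some nonzero \<open>f\<close> in
  \<open>A\<close>, so sets incongruent modulo \<open>t\<close> have bounded size, and a largest one
  represents the residue field.\<close>

lemma finite_place_residues:
  assumes "P \<in> finite_places"
  shows "\<exists>T. residue_system (val_ring F P) P T \<and> card T = CARD('k) ^ place_degree \<iota> F P"
    "place_degree \<iota> F P \<ge> 1"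
proof -
  note P = finite_placeD[OF assms]
  obtain t where t: "t \<noteq> 0" "P = (\<lambda>r. t * r) ` val_ring F P"
    using finite_place_uniformizer[OF assms] by blast
  obtain f where f: "f \<in> A" "f \<noteq> 0" "f \<in> P" using finite_place_meets_A[OF assms] by blast
  then obtain s where s: "f = t * s" "s \<in> val_ring F P" using t by blast
  have "incongruent (val_ring F P) f Z" if "incongruent (val_ring F P) t Z" for Z
    unfolding s(1) by (rule incongruent_mult[OF P(2) s(2) that])
  then have bound: "card Z \<le> CARD('k) ^ d f" if "finite Z" "incongruent (val_ring F P) t Z" for Z
    using that card_incongruent_le[OF P(2-4) f(1,2)] by blast
  have "\<exists>Z. finite Z \<and> incongruent (val_ring F P) t Z \<and>
      (\<forall>r\<in>val_ring F P. \<exists>z\<in>Z. r - z \<in> (\<lambda>r. t * r) ` val_ring F P)"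
    by (rule maximal_incongruent_set[OF P(2) bound])
  then obtain Z where "finite Z \<and> incongruent (val_ring F P) t Z \<and>
      (\<forall>r\<in>val_ring F P. \<exists>z\<in>Z. r - z \<in> (\<lambda>r. t * r) ` val_ring F P)" ..
  then have Z: "finite Z" "incongruent (val_ring F P) t Z"
    and reps: "\<forall>r\<in>val_ring F P. \<exists>z\<in>Z. r - z \<in> (\<lambda>r. t * r) ` val_ring F P" by simp_all
  have Z3: "\<exists>z\<in>Z. r - z \<in> P" if "r \<in> val_ring F P" for r
    by (subst t(2)) (rule reps[rule_format, OF that])
  from Z(2) have Z': "Z \<subseteq> val_ring F P" unfolding incongruent_def by blast
  have "\<exists>B. residue_basis \<iota> F P B"
    by (rule residue_basis_exists[OF \<iota> P(2) place_const[OF P(1)] place_diff[OF P(1) F] _ Z(1) Z' Z3])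
      (use place_mult[OF P(1)] in \<open>auto simp: mult.commute\<close>)
  then obtain B where B: "residue_basis \<iota> F P B" by blast
  from residue_basis_imp_system[OF \<iota> B P(2) place_const[OF P(1)] place_0[OF P(1)]]
  show "\<exists>T. residue_system (val_ring F P) P T \<and> card T = CARD('k) ^ place_degree \<iota> F P"
    using place_degree_eq[OF P(1) B] by metis
  show "place_degree \<iota> F P \<ge> 1"
  proof (rule ccontr)
    assume "\<not> ?thesis"
    then have "card B = 0" using place_degree_eq[OF P(1) B] by simp
    then have "B = {}" using B unfolding residue_basis_def by simp
    then have "1 \<in> P" using B subring_1[OF P(2)] unfolding residue_basis_def by auto
    then show False using place_1[OF P(1)] by simp
  qed
qed

subsection \<open>Zeros are bounded by the degree\<close>

lemma finite_place_A_nonneg: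
  assumes "P \<in> finite_places" "a \<in> A" "a \<noteq> 0"
  shows "valuation F P a \<ge> 0"
proof -
  interpret discrete_place F P "valuation F P" using finite_place_discrete assms by blast
  show ?thesis using finite_placeD(3)[OF assms(1)] assms mem_val_ring by blast
qed

text \<open>At each \<open>P\<close>, expansions in a uniformizer give
  \<open>CARD('k) ^ (n * deg P)\<close> elements incongruent modulo \<open>f\<close>, where
  \<open>n\<close> is the order of \<open>f\<close>. Weak approximation lifts every choice of one
  per place to the intersection \<open>R\<close> of the valuation rings, where all lifts are
  incongruent modulo \<open>f\<close>; their number is bounded by
  \<open>card_incongruent_le\<close>.\<close>

theorem zero_degree_le:
  assumes "finite W" "W \<subseteq> finite_places" and f: "f \<in> A" "f \<noteq> 0"
  shows "(\<Sum>P\<in>W. nat (valuation F P f) * place_degree \<iota> F P) \<le> d f"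
proof (cases "W = {}")
  case False
  let ?v = "valuation F" and ?n = "\<lambda>P. nat (valuation F P f)"
  have disc: "discrete_place F P (?v P)" if "P \<in> W" for P
    using that assms finite_place_discrete by blast
  have nonneg: "?v P f \<ge> 0" if "P \<in> W" for P using that assms finite_place_A_nonneg by blast
  define R where "R = (\<Inter>P\<in>W. val_ring F P)"
  have R: "is_subring R" "A \<subseteq> R" "R \<subseteq> F"
  proof -
    have W': "is_subring (val_ring F P)" "A \<subseteq> val_ring F P" "val_ring F P \<subseteq> F" if "P \<in> W" for P
      using finite_placeD[of P] that assms by auto
    show "is_subring R" unfolding is_subring_def R_def using W'(1) by (auto simp: subring_intros)
    show "A \<subseteq> R" "R \<subseteq> F" unfolding R_def using W'(2,3) False by blast+
  qed
  have "\<exists>Z. finite Z \<and> incongruent (val_ring F P) f Z \<and>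
      card Z = CARD('k) ^ (?n P * place_degree \<iota> F P)" if PW: "P \<in> W" for P
  proof -
    interpret discrete_place F P "?v P" using disc PW by blast
    note P = finite_placeD[of P]
    obtain t where t: "t \<in> F" "t \<noteq> 0" "?v P t = 1" using uniformizer by blast
    then have pe: "P = (\<lambda>r. t * r) ` val_ring F P" using prime_element_iff prime_element_def by metis
    have tR: "t \<in> val_ring F P" using t by (simp add: mem_val_ring)
    obtain T where T: "residue_system (val_ring F P) P T" "card T = CARD('k) ^ place_degree \<iota> F P"
      using finite_place_residues PW assms by blast
    then have "incongruent (val_ring F P) t T" "finite T"
      unfolding incongruent_def residue_system_def using pe by blast+
    note D = digit_sums[OF val_ring_subring tR t(2) this(2,1), of "?n P"]
    have "f \<in> level F (?v P) (int (?n P))"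
      using f A_F nonneg[OF PW] by (auto simp: level_def)
    then obtain r where r: "r \<in> val_ring F P" "f = t ^ ?n P * r"
      using level_factor[of f "?n P" t] t by blast
    have "incongruent (val_ring F P) f (digit_sums t T (?n P))"
      using D by (subst r(2)) (auto intro: incongruent_mult[OF val_ring_subring r(1)])
    then show ?thesis using D T(2) by (metis power_mult mult.commute)
  qed
  then obtain Z where Z: "\<And>P. P \<in> W \<Longrightarrow> finite (Z P)"
    "\<And>P. P \<in> W \<Longrightarrow> incongruent (val_ring F P) f (Z P)"
    "\<And>P. P \<in> W \<Longrightarrow> card (Z P) = CARD('k) ^ (?n P * place_degree \<iota> F P)" by metis
  \<comment> \<open>Precision \<open>N\<close>, at least the order of \<open>f\<close> at each
    place, makes the approximation errors multiples of \<open>f\<close> there.\<close>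
  obtain N where N: "\<And>P. P \<in> W \<Longrightarrow> ?n P \<le> N"
    using finite_nat_set_iff_bounded_le[of "?n ` W"] \<open>finite W\<close> by auto
  have "\<exists>y\<in>R. \<forall>P\<in>W. y - z P \<in> level F (?v P) (int N)" if z: "z \<in> Pi\<^sub>E W Z" for z
  proof -
    have zR: "z P \<in> val_ring F P" if "P \<in> W" for P
      using z that Z(2) unfolding incongruent_def by blast
    then obtain y where y: "y \<in> F" "\<forall>P\<in>W. y - z P \<in> level F (?v P) (int N)"
      using weak_approximation[OF \<open>finite W\<close> disc F, of z "int N"] finite_placeD(4) assms by blast
    have "y \<in> val_ring F P" if P: "P \<in> W" for P
    proof -
      interpret discrete_place F P "?v P" using disc P by blast
      have "y - z P \<in> val_ring F P"
        using y P level_mono[of "y - z P" "int N" 0] unfolding val_ring_eq by auto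
      then have "(y - z P) + z P \<in> val_ring F P" using zR[OF P] val_ring_subring by (intro subring_add)
      then show ?thesis by simp
    qed
    then show ?thesis using y unfolding R_def by blast
  qed
  then obtain h where h: "\<And>z. z \<in> Pi\<^sub>E W Z \<Longrightarrow> h z \<in> R"
    "\<And>z P. z \<in> Pi\<^sub>E W Z \<Longrightarrow> P \<in> W \<Longrightarrow> h z - z P \<in> level F (?v P) (int N)" by metis
  have key: "z = z'" if z: "z \<in> Pi\<^sub>E W Z" "z' \<in> Pi\<^sub>E W Z" and r: "r \<in> R" "h z - h z' = f * r" for z z' r
  proof (rule PiE_ext[OF z])
    fix P assume P: "P \<in> W"
    interpret discrete_place F P "?v P" using disc P by blast
    define y where "y = (h z - z P) - (h z' - z' P)"
    have eq: "z P - z' P = f * r - y"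
      using r by (simp add: y_def algebra_simps)
    have "y \<in> level F (?v P) (?v P f)"
      unfolding y_def using level_diff[OF h(2)[OF z(1) P] h(2)[OF z(2) P]] N[OF P] nonneg[OF P]
      by (rule_tac level_mono) auto
    then have "y / f \<in> val_ring F P"
      using level_divide[of _ "?v P f" f] f A_F unfolding val_ring_eq by auto
    moreover have "r \<in> val_ring F P" using r P unfolding R_def by blast
    ultimately have "r - y / f \<in> val_ring F P" using val_ring_subring by (intro subring_diff)
    moreover have "z P - z' P = f * (r - y / f)"
      using eq f by (simp add: right_diff_distrib)
    ultimately have "r - y / f \<in> val_ring F P" "z P - z' P = f * (r - y / f)" by simp_all
    then show "z P = z' P"
      using incongruentD[OF Z(2)[OF P]] z P by blast
  qed
  have "inj_on h (Pi\<^sub>E W Z)"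
    using key[of _ _ 0] subring_0[OF R(1)] by (auto simp: inj_on_def)
  then have "card (h ` Pi\<^sub>E W Z) = (\<Prod>P\<in>W. card (Z P))"
    using \<open>finite W\<close> by (simp add: card_image card_PiE)
  also have "\<dots> = CARD('k) ^ (\<Sum>P\<in>W. ?n P * place_degree \<iota> F P)"
    using Z(3) by (simp add: power_sum)
  finally have c: "card (h ` Pi\<^sub>E W Z) = CARD('k) ^ (\<Sum>P\<in>W. ?n P * place_degree \<iota> F P)" .
  have "incongruent R f (h ` Pi\<^sub>E W Z)"
    unfolding incongruent_def using h(1) key by blast
  moreover have "finite (h ` Pi\<^sub>E W Z)"
    using \<open>finite W\<close> Z(1) by (intro finite_imageI finite_PiE)
  ultimately have "CARD('k) ^ (\<Sum>P\<in>W. ?n P * place_degree \<iota> F P) \<le> CARD('k) ^ d f"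
    using card_incongruent_le[OF R f, of "h ` Pi\<^sub>E W Z"] c by simp
  then show ?thesis using card_ge_2 by (simp add: power_increasing_iff)
qed simp

lemma finite_zeros:
  assumes f: "f \<in> A" "f \<noteq> 0"
  shows "finite {P \<in> finite_places. valuation F P f > 0}"
proof (rule ccontr)
  assume "infinite {P \<in> finite_places. valuation F P f > 0}"
  then obtain W where W: "finite W" "card W = Suc (d f)" "W \<subseteq> {P \<in> finite_places. valuation F P f > 0}"
    using infinite_arbitrarily_large by blast
  have "card W \<le> (\<Sum>P\<in>W. nat (valuation F P f) * place_degree \<iota> F P)"
    unfolding card_eq_sum
  proof (rule sum_mono)
    fix P assume "P \<in> W"
    then have "nat (valuation F P f) \<ge> 1" "place_degree \<iota> F P \<ge> 1"
      using W(3) finite_place_residues(2) by auto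
    then show "1 \<le> nat (valuation F P f) * place_degree \<iota> F P"
      by (metis mult_le_mono mult_1)
  qed
  also have "\<dots> \<le> d f" using W by (intro zero_degree_le f) auto
  finally show False using W by simp
qed

text \<open>Powers of elements of \<open>A\<close> vanishing at the places are multiplied in one
  after another; values already reached cannot drop, as elements of \<open>A\<close> have no finite
  poles.\<close>

lemma multiple_with_zeros:
  assumes "finite W" "W \<subseteq> finite_places"
  shows "\<exists>f\<in>A. f \<noteq> 0 \<and> (\<forall>P\<in>W. valuation F P f \<ge> D P)"
  using assms
proof (induction W rule: finite_induct)
  case empty
  then show ?case using A by (intro bexI[of _ 1]) (auto simp: subring_1)
next
  case (insert P W)
  then obtain f where f: "f \<in> A" "f \<noteq> 0" "\<forall>P\<in>W. valuation F P f \<ge> D P" by auto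
  obtain a where a: "a \<in> A" "a \<noteq> 0" "a \<in> P" using finite_place_meets_A insert.prems by blast
  define n where "n = nat \<bar>D P\<bar>"
  have g: "f * a ^ n \<in> A" "f * a ^ n \<noteq> 0" using f a by (auto simp: A_intros)
  have eq: "valuation F Q (f * a ^ n) = valuation F Q f + int n * valuation F Q a"
    if Q: "Q \<in> finite_places" for Q
  proof -
    interpret discrete_place F Q "valuation F Q" using finite_place_discrete[OF Q] .
    show ?thesis using f a A_F F by (simp add: v_mult v_power subfield_intros)
  qed
  have "valuation F Q (f * a ^ n) \<ge> D Q" if "Q \<in> insert P W" for Q
  proof (cases "Q = P")
    case True
    have P: "P \<in> finite_places" using insert.prems by auto
    interpret discrete_place F P "valuation F P" using finite_place_discrete[OF P] .
    have "valuation F P a \<ge> 1" using a mem_place by auto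
    then have "int n * valuation F P a \<ge> int n * 1" by (intro mult_left_mono) auto
    then show ?thesis
      using eq[OF P] finite_place_A_nonneg[OF P f(1,2)] True by (simp add: n_def)
  next
    case False
    then have Q: "Q \<in> W" "Q \<in> finite_places" using that insert.prems by auto
    then have "int n * valuation F Q a \<ge> 0" using finite_place_A_nonneg[OF Q(2) a(1,2)] by simp
    then show ?thesis using eq[OF Q(2)] f(3) Q by fastforce
  qed
  then show ?case using g by blast
qed

text \<open>After division by \<open>t ^ k\<close> the residue class is defined, and two elements
  with the same class differ by one vanishing to order \<open>k + 1\<close>. So one more order of
  vanishing costs at most \<open>deg P\<close> dimensions.\<close>

lemma card_le_vanishing_once:
  assumes P: "P \<in> finite_places" and X: "X \<subseteq> level F (valuation F P) k" "finite X"
    and diff: "\<And>a b. a \<in> X \<Longrightarrow> b \<in> X \<Longrightarrow> a - b \<in> X"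
  shows "card X \<le> CARD('k) ^ place_degree \<iota> F P * card (X \<inter> level F (valuation F P) (k + 1))"
proof -
  interpret discrete_place F P "valuation F P" using finite_place_discrete[OF P] .
  obtain T where T: "residue_system (val_ring F P) P T" "card T = CARD('k) ^ place_degree \<iota> F P"
    using finite_place_residues P by blast
  obtain t where t: "t \<in> F" "t \<noteq> 0" "valuation F P t = 1" using uniformizer by blast
  have tk: "t powi n \<in> level F (valuation F P) n" for n
    using t F by (auto simp: level_def v_powi subfield_intros)
  have "a * t powi (- k) \<in> val_ring F P" if "a \<in> X" for a
    using level_mult[OF _ tk[of "-k"], of a k] that X unfolding val_ring_eq by auto
  then have "\<forall>a\<in>X. \<exists>s\<in>T. a * t powi (- k) - s \<in> P"
    using T unfolding residue_system_def by blast
  then obtain h where h: "\<And>a. a \<in> X \<Longrightarrow> h a \<in> T" "\<And>a. a \<in> X \<Longrightarrow> a * t powi (- k) - h a \<in> P"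
    by metis
  have "card X \<le> card T * card (X \<inter> level F (valuation F P) (k + 1))"
  proof (rule card_le_card_mult_fibre(2))
    show "finite T" using T unfolding residue_system_def by blast
    show "h ` X \<subseteq> T" using h by auto
    show "finite (X \<inter> level F (valuation F P) (k + 1))" using X by auto
    fix a b assume ab: "a \<in> X" "b \<in> X" "h a = h b"
    have "(a * t powi (- k) - h a) - (b * t powi (- k) - h b) \<in> level F (valuation F P) 1"
      using h ab level_diff place_eq by metis
    then have "(a - b) * t powi (- k) \<in> level F (valuation F P) 1"
      using ab by (simp add: algebra_simps)
    from level_mult[OF this tk[of k]] have "a - b \<in> level F (valuation F P) (k + 1)"
      using t by (simp add: power_int_minus add.commute mult.assoc)
    then show "a - b \<in> X \<inter> level F (valuation F P) (k + 1)" using diff ab by auto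
  qed
  then show ?thesis using T by simp
qed

lemma card_le_vanishing_at:
  assumes P: "P \<in> finite_places" and X: "X \<subseteq> A" "finite X"
    and diff: "\<And>a b. a \<in> X \<Longrightarrow> b \<in> X \<Longrightarrow> a - b \<in> X"
  shows "card X \<le> CARD('k) ^ (k * place_degree \<iota> F P) * card (X \<inter> level F (valuation F P) (int k))"
proof (induction k)
  case 0
  interpret discrete_place F P "valuation F P" using finite_place_discrete[OF P] .
  have "X \<subseteq> level F (valuation F P) 0"
    using X finite_placeD(3)[OF P] val_ring_eq by auto
  then show ?case by (simp add: Int_absorb2)
next
  case (Suc k)
  let ?L = "\<lambda>k. level F (valuation F P) k"
  interpret discrete_place F P "valuation F P" using finite_place_discrete[OF P] .
  have "card (X \<inter> ?L (int k)) \<le> CARD('k) ^ place_degree \<iota> F P * card (X \<inter> ?L (int k) \<inter> ?L (int k + 1))"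
    using X diff level_diff by (intro card_le_vanishing_once[OF P]) auto
  also have "X \<inter> ?L (int k) \<inter> ?L (int k + 1) = X \<inter> ?L (int (Suc k))"
    using level_mono[of _ "int k + 1" "int k"] by (auto simp: add.commute)
  finally have "CARD('k) ^ (k * place_degree \<iota> F P) * card (X \<inter> ?L (int k)) \<le>
    CARD('k) ^ (k * place_degree \<iota> F P) * (CARD('k) ^ place_degree \<iota> F P * card (X \<inter> ?L (int (Suc k))))"
    by (rule mult_left_mono) simp
  from order.trans[OF Suc this] show ?case by (simp add: power_add ac_simps)
qed

lemma card_le_vanishing:
  assumes "finite W" "W \<subseteq> finite_places" and X: "X \<subseteq> A" "finite X"
    and diff: "\<And>a b. a \<in> X \<Longrightarrow> b \<in> X \<Longrightarrow> a - b \<in> X"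
  shows "card X \<le> CARD('k) ^ (\<Sum>P\<in>W. k P * place_degree \<iota> F P) *
    card {a \<in> X. \<forall>P\<in>W. a \<in> level F (valuation F P) (int (k P))}"
  using assms(1,2)
proof (induction W rule: finite_induct)
  case (insert P W)
  let ?X = "{a \<in> X. \<forall>P\<in>W. a \<in> level F (valuation F P) (int (k P))}"
  have diff': "a - b \<in> ?X" if "a \<in> ?X" "b \<in> ?X" for a b
    using that diff discrete_place.level_diff[OF finite_place_discrete] insert.prems by blast
  have "card ?X \<le> CARD('k) ^ (k P * place_degree \<iota> F P) *
      card (?X \<inter> level F (valuation F P) (int (k P)))"
    using insert.prems X by (intro card_le_vanishing_at diff') auto
  also have "?X \<inter> level F (valuation F P) (int (k P)) =
      {a \<in> X. \<forall>P\<in>insert P W. a \<in> level F (valuation F P) (int (k P))}" by auto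
  finally have "CARD('k) ^ (\<Sum>P\<in>W. k P * place_degree \<iota> F P) * card ?X \<le>
    CARD('k) ^ (\<Sum>P\<in>W. k P * place_degree \<iota> F P) * (CARD('k) ^ (k P * place_degree \<iota> F P) *
    card {a \<in> X. \<forall>P\<in>insert P W. a \<in> level F (valuation F P) (int (k P))})"
    by (rule mult_left_mono) simp
  from order.trans[OF insert.IH this] show ?case
    using insert by (simp add: power_add ac_simps)
qed simp

subsection \<open>The genus\<close>

lemma place_discrete: "P \<in> places \<iota> F \<Longrightarrow> discrete_place F P (valuation F P)"
  using P_inf_discrete finite_place_discrete unfolding finite_places_def by blast

lemma riemann_roch_space_levels:
  "riemann_roch_space \<iota> F D = {z \<in> F. \<forall>P\<in>places \<iota> F. z \<in> level F (valuation F P) (- D P)}"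
  unfolding riemann_roch_space_def level_def by auto

lemma valuation_const_mem:
  assumes "P \<in> places \<iota> F"
  shows "\<iota> c \<in> level F (valuation F P) 0"
proof -
  interpret discrete_place F P "valuation F P" using place_discrete[OF assms] .
  show ?thesis using place_const[OF assms] val_ring_eq by auto
qed

lemma card_riemann_roch_space:
  assumes "finite (riemann_roch_space \<iota> F D)"
  shows "card (riemann_roch_space \<iota> F D) = CARD('k) ^ ell \<iota> F D"
  unfolding ell_def
proof (rule card_eq_power_dim[OF \<iota> assms])
  show "0 \<in> riemann_roch_space \<iota> F D"
    using F by (auto simp: riemann_roch_space_def subfield_intros)
next
  fix a b assume "a \<in> riemann_roch_space \<iota> F D" "b \<in> riemann_roch_space \<iota> F D"
  then show "a + b \<in> riemann_roch_space \<iota> F D"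
    using F discrete_place.level_add[OF place_discrete]
    by (auto simp: riemann_roch_space_levels subfield_intros)
next
  fix c a assume a: "a \<in> riemann_roch_space \<iota> F D"
  have "\<iota> c * a \<in> level F (valuation F P) (- D P)" if P: "P \<in> places \<iota> F" for P
    using discrete_place.level_mult[OF place_discrete[OF P] valuation_const_mem[OF P, of c], of a "- D P"]
      a P by (auto simp: riemann_roch_space_levels)
  then show "\<iota> c * a \<in> riemann_roch_space \<iota> F D"
    using F a A_F[OF const_mem] by (auto simp: riemann_roch_space_levels subfield_intros)
qed

end

context normal_degree_ring
begin

lemma levels_imp_mem_A:
  assumes "z \<in> F" "\<And>P. P \<in> finite_places \<Longrightarrow> z \<in> level F (valuation F P) 0"
  shows "z \<in> A"
  using assms no_other_poles_imp_mem_A discrete_place.val_ring_eq[OF finite_place_discrete]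
  unfolding finite_places_def by blast

lemma divisor_sub: "D \<in> divisors \<iota> F \<Longrightarrow> D P \<noteq> 0 \<Longrightarrow> P \<in> places \<iota> F"
  unfolding divisors_def by auto

text \<open>Multiplication by an \<open>f\<close> that clears the finite poles allowed by
  \<open>D\<close> embeds the space into a finite step of the filtration.\<close>

lemma finite_riemann_roch_space:
  assumes D: "D \<in> divisors \<iota> F"
  shows "finite (riemann_roch_space \<iota> F D)"
proof -
  let ?W = "{P \<in> finite_places. D P \<noteq> 0}"
  have "finite ?W" using D unfolding divisors_def by auto
  then obtain f where f: "f \<in> A" "f \<noteq> 0" "\<forall>P\<in>?W. valuation F P f \<ge> D P"
    using multiple_with_zeros[of ?W D] by blast
  have "f * z \<in> filt (nat (int (d f) + D P_inf + 1))" if z: "z \<in> riemann_roch_space \<iota> F D" for z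
  proof (cases "z = 0")
    case False
    have zF: "z \<in> F" using z unfolding riemann_roch_space_def by auto
    have lev: "z \<in> level F (valuation F P) (- D P)" if "P \<in> places \<iota> F" for P
      using z that unfolding riemann_roch_space_levels by auto
    have fzF: "f * z \<in> F" using f A_F zF F by (auto intro!: subfield_intros)
    have fzA: "f * z \<in> A"
    proof (rule levels_imp_mem_A[OF fzF])
      fix P assume P: "P \<in> finite_places"
      interpret discrete_place F P "valuation F P" using finite_place_discrete[OF P] .
      have "valuation F P f \<ge> D P"
        using f(3) P finite_place_A_nonneg[OF P f(1,2)] by (cases "D P = 0") auto
      then have "f \<in> level F (valuation F P) (D P)" using f A_F by (auto simp: level_def)
      from level_mult[OF this lev] show "f * z \<in> level F (valuation F P) 0"
        using P unfolding finite_places_def by auto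
    qed
    interpret discrete_place F P_inf "valuation F P_inf" by (rule P_inf_discrete)
    have "- int (d (f * z)) = - int (d f) + valuation F P_inf z"
      using valuation_P_inf[OF fzA] valuation_P_inf[OF f(1,2)] f False A_F zF by (simp add: v_mult)
    moreover have "valuation F P_inf z \<ge> - D P_inf"
      using lev[OF P_inf_place] False by (simp add: level_def)
    ultimately have "d (f * z) < nat (int (d f) + D P_inf + 1)" by linarith
    then show ?thesis using fzA by (simp add: filt_def)
  qed (simp add: filt_0)
  then have "(\<lambda>z. f * z) ` riemann_roch_space \<iota> F D \<subseteq> filt (nat (int (d f) + D P_inf + 1))" by auto
  moreover have "inj_on (\<lambda>z. f * z) (riemann_roch_space \<iota> F D)" using f by (auto simp: inj_on_def)
  ultimately show ?thesis using finite_filt by (meson finite_imageD finite_subset)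
qed

lemma div_degree_split:
  assumes D: "D \<in> divisors \<iota> F" and W: "finite W" "W \<subseteq> finite_places" "{P \<in> finite_places. D P \<noteq> 0} \<subseteq> W"
  shows "div_degree \<iota> F D = D P_inf + (\<Sum>P\<in>W. D P * int (place_degree \<iota> F P))"
proof -
  have "div_degree \<iota> F D = (\<Sum>P\<in>insert P_inf W. D P * int (place_degree \<iota> F P))"
    unfolding div_degree_def using W D divisor_sub[OF D]
    by (intro sum.mono_neutral_left) (auto simp: finite_places_def)
  also have "\<dots> = D P_inf + (\<Sum>P\<in>W. D P * int (place_degree \<iota> F P))"
    using W by (subst sum.insert) (auto simp: finite_places_def place_degree_P_inf)
  finally show ?thesis .
qed

text \<open>With \<open>f\<close> clearing the poles allowed by \<open>D\<close>, the quotients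
  \<open>a / f\<close> lie in the space of \<open>D\<close> when \<open>a\<close> has degree below
  \<open>N\<close> and vanishes to order \<open>k P\<close> on \<open>W\<close>. Vanishing
  conditions cost at most their degree, the filtration loses at most \<open>gaps\<close>, and the
  zeros of \<open>f\<close> have total degree at most \<open>d f\<close>.\<close>

theorem riemann_inequality:
  assumes D: "D \<in> divisors \<iota> F"
  shows "div_degree \<iota> F D - int (ell \<iota> F D) + 1 \<le> int gaps"
proof -
  let ?v = "valuation F" and ?deg = "place_degree \<iota> F"
  let ?W0 = "{P \<in> finite_places. D P \<noteq> 0}"
  have fin0: "finite ?W0" using D unfolding divisors_def by auto
  then obtain f where f: "f \<in> A" "f \<noteq> 0" "\<forall>P\<in>?W0. ?v P f \<ge> D P"
    using multiple_with_zeros[of ?W0 D] by blast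
  \<comment> \<open>The zeros of \<open>f\<close> outside the support of \<open>D\<close> are
    included, because dividing by \<open>f\<close> must not create poles there.\<close>
  define W where "W = ?W0 \<union> {P \<in> finite_places. ?v P f > 0}"
  have W: "finite W" "W \<subseteq> finite_places" "?W0 \<subseteq> W"
    unfolding W_def using fin0 finite_zeros[OF f(1,2)] by auto
  define k where "k P = nat (?v P f - D P)" for P
  have k: "int (k P) = ?v P f - D P" if "P \<in> W" for P
  proof (cases "D P = 0")
    case True
    then show ?thesis using finite_place_A_nonneg[OF _ f(1,2)] that W by (auto simp: k_def)
  next
    case False
    then show ?thesis using f(3) that W by (auto simp: k_def)
  qed
  \<comment> \<open>At infinity the condition on \<open>a / f\<close> reads
    \<open>d a \<le> D P_inf + d f\<close>; the 1 turns this into a strict bound, and a negative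
    bound is truncated to the trivial space.\<close>
  define N where "N = nat (D P_inf + int (d f) + 1)"
  define I where "I = {a \<in> filt N. \<forall>P\<in>W. a \<in> level F (?v P) (int (k P))}"
  have "a / f \<in> riemann_roch_space \<iota> F D" if a: "a \<in> I" for a
  proof (cases "a = 0")
    case True
    then show ?thesis using F by (auto simp: riemann_roch_space_def subfield_intros)
  next
    case False
    have a': "a \<in> A" "d a < N" using a False by (auto simp: I_def filt_def)
    have "?v P (a / f) \<ge> - D P" if P: "P \<in> places \<iota> F" for P
    proof -
      interpret discrete_place F P "?v P" using place_discrete[OF P] .
      have eq: "?v P (a / f) = ?v P a - ?v P f" using a' f False A_F by (simp add: v_divide)
      consider "P = P_inf" | "P \<in> W" | "P \<in> finite_places" "P \<notin> W"
        using P unfolding finite_places_def by auto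
      then show ?thesis
      proof cases
        case 1
        then show ?thesis using eq valuation_P_inf a' f False by (simp add: N_def)
      next
        case 2
        then have "?v P a \<ge> int (k P)" using a False by (auto simp: I_def level_def)
        then show ?thesis using eq k[OF 2] by simp
      next
        case 3
        then have "D P = 0" "?v P f \<le> 0" unfolding W_def by auto
        then show ?thesis using eq finite_place_A_nonneg[OF 3(1) a'(1) False] by simp
      qed
    qed
    then show ?thesis
      unfolding riemann_roch_space_def using a' f A_F F by (auto intro!: subfield_divide)
  qed
  then have sub: "(\<lambda>a. a / f) ` I \<subseteq> riemann_roch_space \<iota> F D" by auto
  have "inj_on (\<lambda>a. a / f) I" using f by (auto simp: inj_on_def)
  from card_inj_on_le[OF this sub finite_riemann_roch_space[OF D]]
  have "card I \<le> CARD('k) ^ ell \<iota> F D"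
    unfolding card_riemann_roch_space[OF finite_riemann_roch_space[OF D]] .
  moreover have "card (filt N) \<le> CARD('k) ^ (\<Sum>P\<in>W. k P * ?deg P) * card I"
    unfolding I_def by (rule card_le_vanishing[OF W(1,2) _ finite_filt filt_diff]) (use filt_A in blast)
  ultimately have "card (filt N) \<le> CARD('k) ^ (\<Sum>P\<in>W. k P * ?deg P) * CARD('k) ^ ell \<iota> F D"
    by (meson le_trans mult_le_mono2)
  then have "CARD('k) ^ card (degrees \<inter> {..<N}) \<le> CARD('k) ^ ((\<Sum>P\<in>W. k P * ?deg P) + ell \<iota> F D)"
    using card_filt[of N] by (simp add: power_add)
  then have "card (degrees \<inter> {..<N}) \<le> (\<Sum>P\<in>W. k P * ?deg P) + ell \<iota> F D"
    using card_ge_2 by (simp add: power_increasing_iff)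
  with card_degrees_ge[of N] have "N \<le> (\<Sum>P\<in>W. k P * ?deg P) + ell \<iota> F D + gaps" by simp
  then have "int N \<le> (\<Sum>P\<in>W. int (k P) * int (?deg P)) + int (ell \<iota> F D) + int gaps"
    by (simp flip: of_nat_sum of_nat_mult of_nat_add)
  moreover have "(\<Sum>P\<in>W. int (k P) * int (?deg P)) =
    (\<Sum>P\<in>W. ?v P f * int (?deg P)) - (\<Sum>P\<in>W. D P * int (?deg P))"
    unfolding sum_subtractf[symmetric] by (intro sum.cong refl) (simp add: k left_diff_distrib)
  moreover have "(\<Sum>P\<in>W. ?v P f * int (?deg P)) = int (\<Sum>P\<in>W. nat (?v P f) * ?deg P)"
    unfolding of_nat_sum using W finite_place_A_nonneg[OF _ f(1,2)] by (intro sum.cong) auto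
  moreover have "int (\<Sum>P\<in>W. nat (?v P f) * ?deg P) \<le> int (d f)"
    using zero_degree_le[OF W(1,2) f(1,2)] by (rule of_nat_mono)
  moreover have "int N \<ge> D P_inf + int (d f) + 1" by (simp add: N_def)
  ultimately show ?thesis
    unfolding div_degree_split[OF D W] by linarith
qed

text \<open>Attained by a multiple of infinity past the conductor: its space is a step of the
  filtration, and all gaps lie below.\<close>

lemma riemann_inequality_sharp:
  "\<exists>D\<in>divisors \<iota> F. int gaps = div_degree \<iota> F D - int (ell \<iota> F D) + 1"
proof -
  obtain c where c: "\<And>n. n \<ge> c \<Longrightarrow> n \<in> degrees" using conductor by blast
  define D where "D P = (if P = P_inf then int c else 0)" for P
  have D: "D \<in> divisors \<iota> F"
    unfolding divisors_def D_def using P_inf_place by auto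
  have "riemann_roch_space \<iota> F D = filt (Suc c)"
  proof (intro equalityI subsetI)
    fix z assume z: "z \<in> riemann_roch_space \<iota> F D"
    then have zF: "z \<in> F" and lev: "\<And>P. P \<in> places \<iota> F \<Longrightarrow> z \<in> level F (valuation F P) (- D P)"
      unfolding riemann_roch_space_levels by auto
    have zA: "z \<in> A"
    proof (rule levels_imp_mem_A[OF zF])
      fix P assume "P \<in> finite_places"
      then have "P \<in> places \<iota> F" "D P = 0" unfolding finite_places_def D_def by auto
      then show "z \<in> level F (valuation F P) 0" using lev[of P] by simp
    qed
    then show "z \<in> filt (Suc c)"
      using lev[OF P_inf_place] valuation_P_inf[OF zA]
      by (cases "z = 0") (auto simp: filt_def level_def D_def)
  next
    fix z assume z: "z \<in> filt (Suc c)"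
    then have zA: "z \<in> A" by (rule filt_A)
    have "valuation F P z \<ge> - D P" if "P \<in> places \<iota> F" "z \<noteq> 0" for P
      using that z valuation_P_inf[OF zA] finite_place_A_nonneg[OF _ zA]
      by (cases "P = P_inf") (auto simp: D_def filt_def finite_places_def)
    then show "z \<in> riemann_roch_space \<iota> F D"
      unfolding riemann_roch_space_def using A_F[OF zA] by auto
  qed
  then have "CARD('k) ^ ell \<iota> F D = CARD('k) ^ card (degrees \<inter> {..<Suc c})"
    using card_riemann_roch_space[OF finite_riemann_roch_space[OF D]] card_filt by simp
  then have "ell \<iota> F D = card (degrees \<inter> {..<Suc c})" using card_ge_2 by simp
  moreover have "Suc c = card (degrees \<inter> {..<Suc c}) + gaps"
    using c by (intro card_degrees_eq[of c]) auto
  moreover have "div_degree \<iota> F D = int c"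
    using div_degree_split[OF D, of "{}"] by (simp add: D_def finite_places_def)
  ultimately show ?thesis using D by (intro bexI[of _ D]) auto
qed

theorem genus_eq_gaps: "genus \<iota> F = int gaps"
  unfolding genus_def
  using riemann_inequality riemann_inequality_sharp by (intro Greatest_equality) auto

end

section \<open>Rings with a graded basis\<close>

text \<open>The linear span of the \<open>e s\<close> with \<open>s < n\<close> in \<open>S\<close>,
  built one index at a time so that finiteness and induction are available before independence is
  known.\<close>

primrec span_below :: "('k::field \<Rightarrow> 'h::field) \<Rightarrow> nat set \<Rightarrow> (nat \<Rightarrow> 'h) \<Rightarrow> nat \<Rightarrow> 'h set" where
  "span_below \<iota> S e 0 = {0}"
| "span_below \<iota> S e (Suc n) =
    (if n \<in> S then (\<lambda>(v, c). v + \<iota> c * e n) ` (span_below \<iota> S e n \<times> UNIV) else span_below \<iota> S e n)"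

declare span_below.simps(2) [simp del]

locale basis_filtration =
  fixes \<iota> :: "'k::{field,finite} \<Rightarrow> 'h::field" and S :: "nat set" and e :: "nat \<Rightarrow> 'h"
  assumes \<iota>: "const_embedding \<iota>"
begin

abbreviation V :: "nat \<Rightarrow> 'h set" where "V \<equiv> span_below \<iota> S e"

lemmas \<iota>_simps = const_embedding_simps[OF \<iota>]

lemma V_SucE:
  assumes "b \<in> V (Suc n)" "b \<in> V n \<Longrightarrow> thesis"
    "\<And>v c. n \<in> S \<Longrightarrow> v \<in> V n \<Longrightarrow> b = v + \<iota> c * e n \<Longrightarrow> thesis"
  shows thesis
  using assms by (auto simp: span_below.simps split: if_splits)

lemma V_SucI: "n \<in> S \<Longrightarrow> v \<in> V n \<Longrightarrow> v + \<iota> c * e n \<in> V (Suc n)"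
  by (auto simp: span_below.simps intro!: image_eqI[of _ _ "(v, c)"])

lemma V_0: "0 \<in> V n"
proof (induction n)
  case (Suc n)
  then show ?case using V_SucI[of n 0 0] by (cases "n \<in> S") (auto simp: span_below.simps \<iota>_simps)
qed simp

lemma V_Suc: "v \<in> V n \<Longrightarrow> v \<in> V (Suc n)"
  using V_SucI[of n v 0] by (cases "n \<in> S") (auto simp: span_below.simps \<iota>_simps)

lemma V_mono: "v \<in> V m \<Longrightarrow> m \<le> n \<Longrightarrow> v \<in> V n"
  by (induction n) (auto simp: le_Suc_eq intro: V_Suc)

lemma e_V: "s \<in> S \<Longrightarrow> e s \<in> V (Suc s)"
  using V_SucI[OF _ V_0, of s 1] by (simp add: \<iota>_simps)

lemma V_diff: "a \<in> V n \<Longrightarrow> b \<in> V n \<Longrightarrow> a - b \<in> V n"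
proof (induction n arbitrary: a b)
  case (Suc n)
  show ?case
  proof (cases "n \<in> S")
    case True
    then obtain v c v' c' where *: "v \<in> V n" "a = v + \<iota> c * e n" "v' \<in> V n" "b = v' + \<iota> c' * e n"
      using Suc.prems by (auto simp: span_below.simps)
    have "(v - v') + \<iota> (c - c') * e n \<in> V (Suc n)" using * Suc.IH True by (intro V_SucI)
    then show ?thesis unfolding * by (simp add: \<iota>_simps algebra_simps)
  qed (use Suc in \<open>auto simp: span_below.simps\<close>)
qed simp

lemma V_uminus: "a \<in> V n \<Longrightarrow> - a \<in> V n"
  using V_diff[OF V_0, of a n] by simp

lemma V_add: "a \<in> V n \<Longrightarrow> b \<in> V n \<Longrightarrow> a + b \<in> V n"
  using V_diff[OF _ V_uminus, of a n b] by simp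

lemma V_const: "a \<in> V n \<Longrightarrow> \<iota> c * a \<in> V n"
proof (induction n arbitrary: a)
  case (Suc n)
  from Suc.prems show ?case
  proof (rule V_SucE)
    fix v c' assume *: "n \<in> S" "v \<in> V n" "a = v + \<iota> c' * e n"
    then have "\<iota> c * v + \<iota> (c * c') * e n \<in> V (Suc n)" using Suc.IH by (intro V_SucI)
    then show ?thesis unfolding * by (simp add: \<iota>_simps algebra_simps)
  qed (use Suc.IH V_Suc in blast)
qed simp

lemma finite_V: "finite (V n)"
  by (induction n) (auto simp: span_below.simps)

end

text \<open>Up to lower terms the \<open>e s\<close> multiply like the elements of \<open>S\<close>:
  the associated graded ring is modelled on the monoid algebra of \<open>S\<close>. Independence is
  a separate step.\<close>

locale graded_basis = basis_filtration \<iota> S e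
  for \<iota> :: "'k::{field,finite} \<Rightarrow> 'h::field" and S e +
  assumes S_0: "0 \<in> S" and e_0: "e 0 = 1"
    and S_add: "\<And>s t. s \<in> S \<Longrightarrow> t \<in> S \<Longrightarrow> s + t \<in> S"
    and e_mult: "\<And>s t. s \<in> S \<Longrightarrow> t \<in> S \<Longrightarrow> e s * e t - e (s + t) \<in> span_below \<iota> S e (s + t)"
begin

lemma e_mult_V: "s \<in> S \<Longrightarrow> b \<in> V n \<Longrightarrow> e s * b \<in> V (s + n)"
proof (induction n arbitrary: b)
  case (Suc n)
  from Suc.prems(2) show ?case
  proof (rule V_SucE)
    assume "b \<in> V n"
    then show ?thesis using Suc V_Suc[of "e s * b" "s + n"] by simp
  next
    fix v c assume *: "n \<in> S" "v \<in> V n" "b = v + \<iota> c * e n"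
    have "e s * e n - e (s + n) \<in> V (Suc (s + n))"
      using e_mult[OF Suc.prems(1) *(1)] by (rule V_Suc)
    from V_add[OF this e_V[OF S_add]] have "e s * e n \<in> V (Suc (s + n))" using * Suc.prems by simp
    then have "e s * v + \<iota> c * (e s * e n) \<in> V (Suc (s + n))"
      using Suc.IH[OF Suc.prems(1) *(2)] by (intro V_add[OF V_Suc V_const])
    then show ?thesis unfolding * by (simp add: algebra_simps)
  qed
qed (simp add: V_0)

lemma V_mult: "a \<in> V m \<Longrightarrow> b \<in> V n \<Longrightarrow> a * b \<in> V (m + n)"
proof (induction m arbitrary: a)
  case (Suc m)
  from Suc.prems(1) show ?case
  proof (rule V_SucE)
    assume "a \<in> V m"
    then show ?thesis using Suc V_Suc[of "a * b" "m + n"] by simp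
  next
    fix v c assume *: "m \<in> S" "v \<in> V m" "a = v + \<iota> c * e m"
    have "v * b + \<iota> c * (e m * b) \<in> V (Suc (m + n))"
      using Suc.IH[OF *(2) Suc.prems(2)] e_mult_V[OF *(1) Suc.prems(2)]
      by (intro V_add V_const V_Suc)
    then show ?thesis unfolding * by (simp add: algebra_simps)
  qed
qed (simp add: V_0)

definition B :: "'h set" where "B = (\<Union>n. V n)"

lemma B_subring: "is_subring B"
  unfolding is_subring_def
proof (intro conjI ballI)
  show "1 \<in> B" using e_V[OF S_0] unfolding e_0 B_def by blast
next
  fix a b assume "a \<in> B" "b \<in> B"
  then obtain m n where mn: "a \<in> V m" "b \<in> V n" unfolding B_def by auto
  then have "a \<in> V (max m n)" "b \<in> V (max m n)" by (auto intro: V_mono)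
  then show "a - b \<in> B" unfolding B_def using V_diff by blast
  show "a * b \<in> B" unfolding B_def using V_mult[OF mn] by blast
qed

lemma const_B: "\<iota> c \<in> B"
  using V_SucI[OF S_0 V_0, of c] unfolding e_0 B_def by auto

lemma e_B: "s \<in> S \<Longrightarrow> e s \<in> B"
  using e_V unfolding B_def by blast

text \<open>A relation between basis elements makes all later basis elements redundant.\<close>

lemma dependent_imp_finite:
  assumes "s \<in> S" "e s \<in> V s" and "finite (- S)"
  shows "finite B"
proof -
  obtain c where c: "\<forall>n\<in>- S. n \<le> c" using assms finite_nat_set_iff_bounded_le by blast
  have drop: "V (Suc n) \<subseteq> V n" if n: "n \<ge> Suc (s + c)" for n
  proof (cases "n \<in> S")
    case True
    define t where "t = n - s"
    have t: "n = s + t" using n by (simp add: t_def)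
    have tS: "t \<in> S"
    proof (rule ccontr)
      assume "t \<notin> S"
      then have "t \<le> c" using c by auto
      with n show False by (simp add: t_def)
    qed
    have "e t * e s \<in> V n" using e_mult_V[OF tS assms(2)] t by (simp add: add.commute)
    from V_diff[OF this e_mult[OF tS assms(1), unfolded add.commute[of t] t[symmetric]]]
    have "e n \<in> V n" by simp
    then show ?thesis by (auto elim!: V_SucE intro!: V_add V_const)
  qed (simp add: span_below.simps)
  have "V n \<subseteq> V (Suc (s + c))" for n
  proof (induction n)
    case (Suc n)
    then show ?case
      using drop[of n] V_mono[of _ "Suc n" "Suc (s + c)"] by (cases "n \<ge> Suc (s + c)") auto
  qed (simp add: V_0)
  then have "B \<subseteq> V (Suc (s + c))" unfolding B_def by blast
  then show ?thesis using finite_V finite_subset by blast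
qed

text \<open>\<open>V (Suc n)\<close> is the first step that involves \<open>e n\<close>; hence the
  \<open>Suc\<close>, with which \<open>deg\<close> becomes the index of the leading basis
  element.\<close>

definition deg :: "'h \<Rightarrow> nat" where
  "deg b = (LEAST n. b \<in> V (Suc n))"

lemma deg_0: "deg 0 = 0"
  unfolding deg_def using V_0[of "Suc 0"] by (intro Least_eq_0)

end

locale independent_graded_basis = graded_basis \<iota> S e
  for \<iota> :: "'k::{field,finite} \<Rightarrow> 'h::field" and S e +
  assumes indep: "\<And>s. s \<in> S \<Longrightarrow> e s \<notin> span_below \<iota> S e s" and finite_gaps: "finite (- S)"
begin

lemma deg_eqI:
  assumes "n \<in> S" "c \<noteq> 0" "v \<in> V n"
  shows "deg (v + \<iota> c * e n) = n" "v + \<iota> c * e n \<notin> V n"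
proof -
  show not: "v + \<iota> c * e n \<notin> V n"
  proof
    assume "v + \<iota> c * e n \<in> V n"
    from V_const[OF V_diff[OF this assms(3)], of "inverse c"]
    have "\<iota> (inverse c) * (\<iota> c * e n) \<in> V n" by simp
    moreover have "\<iota> (inverse c) * (\<iota> c * e n) = e n"
      using assms(2) by (simp add: \<iota>_simps)
    ultimately have "e n \<in> V n" by simp
    with indep assms show False by blast
  qed
  show "deg (v + \<iota> c * e n) = n"
    unfolding deg_def
  proof (rule Least_equality)
    show "v + \<iota> c * e n \<in> V (Suc n)" using assms by (intro V_SucI)
    fix m assume m: "v + \<iota> c * e n \<in> V (Suc m)"
    show "n \<le> m"
    proof (rule ccontr)
      assume "\<not> n \<le> m"
      then have "v + \<iota> c * e n \<in> V n" using V_mono[OF m] by simp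
      with not show False by simp
    qed
  qed
qed

lemma leading_term:
  assumes "b \<in> B" "b \<noteq> 0"
  obtains v c where "deg b \<in> S" "c \<noteq> 0" "v \<in> V (deg b)" "b = v + \<iota> c * e (deg b)"
proof -
  from assms obtain m where "b \<in> V m" unfolding B_def by auto
  then have b: "b \<in> V (Suc (deg b))" unfolding deg_def
    by (intro LeastI[of "\<lambda>n. b \<in> V (Suc n)"] V_Suc)
  have nb: "b \<notin> V (deg b)"
  proof
    assume *: "b \<in> V (deg b)"
    then obtain k where k: "deg b = Suc k" using assms by (cases "deg b") auto
    with * have "deg b \<le> k" unfolding deg_def[of b] by (intro Least_le) simp
    with k show False by simp
  qed
  from b show thesis
  proof (rule V_SucE)
    fix v c assume *: "deg b \<in> S" "v \<in> V (deg b)" "b = v + \<iota> c * e (deg b)"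
    then have "c \<noteq> 0" using nb by (auto simp: \<iota>_simps)
    then show thesis using * that by blast
  qed (use nb in blast)
qed

lemma deg_in_S: "b \<in> B \<Longrightarrow> b \<noteq> 0 \<Longrightarrow> deg b \<in> S"
  by (erule (1) leading_term)

lemma e_nonzero: "s \<in> S \<Longrightarrow> e s \<noteq> 0"
  using indep V_0 by metis

lemma deg_e: "s \<in> S \<Longrightarrow> deg (e s) = s"
  using deg_eqI(1)[of s 1 0] V_0 by (simp add: \<iota>_simps)

lemma V_iff: "b \<in> V n \<longleftrightarrow> b \<in> B \<and> (b = 0 \<or> deg b < n)"
proof
  assume b: "b \<in> V n"
  show "b \<in> B \<and> (b = 0 \<or> deg b < n)"
  proof (intro conjI disjCI)
    show "b \<in> B" using b unfolding B_def by blast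
    assume "\<not> deg b < n"
    show "b = 0"
    proof (rule ccontr)
      assume "b \<noteq> 0"
      with \<open>b \<in> B\<close> obtain v c where "deg b \<in> S" "c \<noteq> 0" "v \<in> V (deg b)" "b = v + \<iota> c * e (deg b)"
        by (rule leading_term)
      then have "b \<notin> V (deg b)" using deg_eqI(2) by metis
      with V_mono[OF b] \<open>\<not> deg b < n\<close> show False by simp
    qed
  qed
next
  assume b: "b \<in> B \<and> (b = 0 \<or> deg b < n)"
  show "b \<in> V n"
  proof (cases "b = 0")
    case False
    then obtain v c where "deg b \<in> S" "c \<noteq> 0" "v \<in> V (deg b)" "b = v + \<iota> c * e (deg b)"
      using b leading_term by blast
    then have "b \<in> V (Suc (deg b))" using V_SucI by metis
    then show ?thesis using V_mono[of b "Suc (deg b)" n] b False by simp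
  qed (simp add: V_0)
qed

lemma deg_mult:
  assumes "a \<in> B" "a \<noteq> 0" "b \<in> B" "b \<noteq> 0"
  shows "deg (a * b) = deg a + deg b"
proof -
  obtain v c where a: "deg a \<in> S" "c \<noteq> 0" "v \<in> V (deg a)" "a = v + \<iota> c * e (deg a)"
    using assms leading_term by blast
  obtain v' c' where b: "deg b \<in> S" "c' \<noteq> 0" "v' \<in> V (deg b)" "b = v' + \<iota> c' * e (deg b)"
    using assms leading_term by blast
  define s t where st: "s = deg a" "t = deg b"
  define r where "r = v * v' + \<iota> c' * (e t * v) + \<iota> c * (e s * v') + \<iota> (c * c') * (e s * e t - e (s + t))"
  have "e t * v \<in> V (s + t)" using e_mult_V[of t v s] a b st by (simp add: add.commute)
  then have "r \<in> V (s + t)"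
    unfolding r_def using a b st V_mult e_mult_V e_mult by (intro V_add V_const) auto
  moreover have "a * b = r + \<iota> (c * c') * e (s + t)"
    by (subst a(4), subst b(4)) (simp add: r_def st \<iota>_simps algebra_simps)
  ultimately show ?thesis
    using deg_eqI(1)[of "s + t" "c * c'" r] a b st S_add by auto
qed

lemma deg_diff:
  assumes "a \<in> B" "b \<in> B"
  shows "deg (a - b) \<le> max (deg a) (deg b)"
proof -
  have "a \<in> V (Suc (max (deg a) (deg b)))" "b \<in> V (Suc (max (deg a) (deg b)))"
    using assms by (auto simp: V_iff)
  from V_diff[OF this] show ?thesis
    using deg_0 by (auto simp: V_iff)
qed

lemma deg_leading:
  assumes "a \<in> B" "a \<noteq> 0" "b \<in> B" "b \<noteq> 0" "deg a = deg b"
  shows "\<exists>c. a - \<iota> c * b = 0 \<or> deg (a - \<iota> c * b) < deg a"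
proof -
  obtain v c where a: "deg a \<in> S" "c \<noteq> 0" "v \<in> V (deg a)" "a = v + \<iota> c * e (deg a)"
    using assms leading_term by blast
  obtain v' c' where b: "deg b \<in> S" "c' \<noteq> 0" "v' \<in> V (deg b)" "b = v' + \<iota> c' * e (deg b)"
    using assms leading_term by blast
  define E where "E = e (deg b)"
  have k: "\<iota> (c / c') * \<iota> c' = \<iota> c" using b(2) by (simp add: \<iota>_simps)
  have "a - \<iota> (c / c') * b = (v + \<iota> c * E) - \<iota> (c / c') * (v' + \<iota> c' * E)"
    using a(4) b(4) assms(5) unfolding E_def by simp
  also have "\<dots> = v - \<iota> (c / c') * v'"
    unfolding distrib_left mult.assoc[symmetric] k by simp
  finally have "a - \<iota> (c / c') * b = v - \<iota> (c / c') * v'" .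
  moreover have "v - \<iota> (c / c') * v' \<in> V (deg a)"
    using a b assms by (intro V_diff V_const) auto
  ultimately show ?thesis using V_iff by metis
qed

lemma deg_image: "{n. \<forall>b\<in>B - {0}. deg b \<noteq> n} = - S"
  using deg_in_S e_B e_nonzero deg_e by fastforce

lemma deg_add_less:
  assumes "a \<in> B" "b \<in> B" "deg a < deg b"
  shows "a + b \<noteq> 0" "deg (a + b) = deg b"
proof -
  have ab: "a + b \<in> B" using assms B_subring by (simp add: subring_add)
  have "deg ((a + b) - a) \<le> max (deg (a + b)) (deg a)" using ab assms by (intro deg_diff)
  moreover have "deg (b - (- a)) \<le> max (deg b) (deg (- a))"
    using assms B_subring by (intro deg_diff) (auto simp: subring_uminus)
  moreover have "deg (0 - a) \<le> max (deg 0) (deg a)"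
    using assms B_subring by (intro deg_diff) (auto simp: subring_0)
  ultimately show "deg (a + b) = deg b" using assms deg_0 by (simp add: add.commute)
  with assms deg_0 show "a + b \<noteq> 0" by auto
qed

lemma sum_distinct_degrees:
  assumes "finite J" "J \<noteq> {}" "\<And>j. j \<in> J \<Longrightarrow> x j \<in> B" "\<And>j. j \<in> J \<Longrightarrow> x j \<noteq> 0"
    "inj_on (\<lambda>j. deg (x j)) J"
  shows "sum x J \<noteq> 0 \<and> (\<exists>j\<in>J. deg (sum x J) = deg (x j))"
  using assms
proof (induction J rule: finite_ne_induct)
  case (insert i J)
  then obtain j where j: "j \<in> J" "sum x J \<noteq> 0" "deg (sum x J) = deg (x j)" by (auto simp: inj_on_insert)
  have B: "x i \<in> B" "sum x J \<in> B" using insert B_subring by (auto intro: subring_sum)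
  have ne: "deg (x i) \<noteq> deg (x j)" using insert j unfolding inj_on_def by blast
  show ?case
  proof (cases "deg (x i) < deg (x j)")
    case True
    then show ?thesis using deg_add_less[OF B] j insert by auto
  next
    case False
    then show ?thesis using deg_add_less[OF B(2,1)] j ne insert by (auto simp: add.commute)
  qed
qed simp

end

section \<open>Evaluation of polynomials along a homomorphism\<close>

definition is_ring_hom :: "('a::comm_ring_1 \<Rightarrow> 'b::comm_ring_1) \<Rightarrow> bool" where
  "is_ring_hom f \<longleftrightarrow> f 1 = 1 \<and> (\<forall>a b. f (a + b) = f a + f b) \<and> (\<forall>a b. f (a * b) = f a * f b)"

text \<open>Applied twice, with \<open>\<iota>\<close> at \<open>u\<close> and then with the
  resulting homomorphism at \<open>w\<close>, it evaluates bivariate polynomials, represented as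
  \<open>'k poly poly\<close>.\<close>

definition eval_at :: "('a::comm_ring_1 \<Rightarrow> 'b::comm_ring_1) \<Rightarrow> 'b \<Rightarrow> 'a poly \<Rightarrow> 'b" where
  "eval_at f x r = poly (map_poly f r) x"

lemma ring_hom_0: "is_ring_hom f \<Longrightarrow> f 0 = 0"
  unfolding is_ring_hom_def by (metis add_cancel_right_left)

context
  fixes f :: "'a::comm_ring_1 \<Rightarrow> 'b::comm_ring_1"
  assumes f: "is_ring_hom f"
begin

lemma eval_at_0: "eval_at f x 0 = 0"
  by (simp add: eval_at_def)

lemma eval_at_pCons: "eval_at f x (pCons a r) = f a + x * eval_at f x r"
  using ring_hom_0[OF f] by (simp add: eval_at_def map_poly_pCons)

lemma eval_at_add: "eval_at f x (r + s) = eval_at f x r + eval_at f x s"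
  using f by (induction r s rule: poly_induct2)
    (auto simp: eval_at_0 eval_at_pCons is_ring_hom_def algebra_simps)

lemma eval_at_smult: "eval_at f x (smult a r) = f a * eval_at f x r"
  using f by (induction r) (auto simp: eval_at_0 eval_at_pCons is_ring_hom_def algebra_simps)

lemma eval_at_mult: "eval_at f x (r * s) = eval_at f x r * eval_at f x s"
  by (induction r)
    (auto simp: eval_at_0 eval_at_pCons eval_at_add eval_at_smult ring_hom_0[OF f] algebra_simps)

lemma eval_at_hom: "is_ring_hom (eval_at f x)"
  using f eval_at_add eval_at_mult
  by (auto simp: is_ring_hom_def one_pCons eval_at_pCons eval_at_0)

lemma eval_at_pcompose: "eval_at f x (r \<circ>\<^sub>p s) = eval_at f (eval_at f x s) r"
  by (induction r) (auto simp: eval_at_0 eval_at_pCons pcompose_pCons eval_at_add eval_at_mult)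

lemma eval_at_monom: "eval_at f x (monom a n) = f a * x ^ n"
  using ring_hom_0[OF f] by (simp add: eval_at_def map_poly_monom poly_monom)

lemma eval_at_sum:
  assumes "degree r < n"
  shows "eval_at f x r = (\<Sum>i<n. f (coeff r i) * x ^ i)"
proof -
  have d: "degree (map_poly f r) < n"
    using assms map_poly_degree_leq[of f r] ring_hom_0[OF f] by simp
  have z: "f (coeff r i) = 0" if "i > degree (map_poly f r)" for i
    using coeff_eq_0[OF that] ring_hom_0[OF f] by (simp add: coeff_map_poly)
  have "eval_at f x r = (\<Sum>i\<le>degree (map_poly f r). f (coeff r i) * x ^ i)"
    unfolding eval_at_def poly_altdef using ring_hom_0[OF f] by (simp add: coeff_map_poly)
  also have "\<dots> = (\<Sum>i<n. f (coeff r i) * x ^ i)"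
    using d z by (intro sum.mono_neutral_left) (auto simp: not_le)
  finally show ?thesis .
qed

end

lemma ring_hom_power: "is_ring_hom f \<Longrightarrow> f (a ^ n) = f a ^ n"
  by (induction n) (auto simp: is_ring_hom_def)

lemma ring_hom_uminus: "is_ring_hom f \<Longrightarrow> f (- a) = - f a"
  using ring_hom_0[of f] unfolding is_ring_hom_def by (metis add.right_inverse add_eq_0_iff)

lemma ring_hom_diff: "is_ring_hom f \<Longrightarrow> f (a - b) = f a - f b"
  using ring_hom_uminus[of f b] unfolding is_ring_hom_def by (metis add_uminus_conv_diff)

lemma const_embedding_ring_hom: "const_embedding \<iota> \<Longrightarrow> is_ring_hom \<iota>"
  unfolding const_embedding_def is_ring_hom_def by blast

section \<open>Characteristic \<open>p\<close> and Frobenius powers\<close>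

lemma CHAR_eq_prime:
  assumes "prime p" "of_nat p = (0 :: 'a::comm_ring_1)"
  shows "CHAR('a) = p"
proof -
  have "CHAR('a) dvd p" using assms of_nat_eq_0_iff_char_dvd by blast
  moreover have "CHAR('a) \<noteq> 1" using of_nat_CHAR[where ?'a = 'a] by (metis of_nat_1 zero_neq_one)
  ultimately show ?thesis using assms by (metis prime_nat_iff)
qed

text \<open>Translation by 1 permutes the field, so summing all elements before and after it shows
  that the cardinality vanishes in the field.\<close>

lemma of_nat_eq_0_of_card:
  assumes "CARD('k::{field,finite}) = p ^ n"
  shows "of_nat p = (0 :: 'k)"
proof -
  have "(\<Sum>x::'k\<in>UNIV. x) = (\<Sum>x::'k\<in>UNIV. x + 1)"
    by (rule sum.reindex_bij_witness[of _ "\<lambda>x. x + 1" "\<lambda>x. x - 1"]) auto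
  then have "of_nat CARD('k) = (0 :: 'k)" by (simp add: sum.distrib)
  then have "of_nat p ^ n = (0 :: 'k)" unfolding assms by simp
  then show ?thesis by simp
qed

lemma const_embedding_of_nat: "const_embedding \<iota> \<Longrightarrow> \<iota> (of_nat n) = of_nat n"
  by (induction n) (auto simp: const_embedding_simps)

lemma frobenius_add:
  fixes a b :: "'a::comm_ring_1"
  assumes "prime p" "of_nat p = (0 :: 'a)"
  shows "(a + b) ^ (p ^ n) = a ^ (p ^ n) + b ^ (p ^ n)"
  using CHAR_eq_prime[OF assms] assms(1) by (intro freshmans_dream') auto

lemma frobenius_sum:
  fixes f :: "'b \<Rightarrow> 'a::comm_ring_1"
  assumes "prime p" "of_nat p = (0 :: 'a)"
  shows "sum f I ^ (p ^ n) = (\<Sum>i\<in>I. f i ^ (p ^ n))"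
  using CHAR_eq_prime[OF assms] assms(1) by (intro freshmans_dream_sum') auto

lemma frobenius_diff:
  fixes a b :: "'a::comm_ring_1"
  assumes "prime p" "of_nat p = (0 :: 'a)"
  shows "(a - b) ^ (p ^ n) = a ^ (p ^ n) - b ^ (p ^ n)"
  using frobenius_add[OF assms, of "a - b" b n] by (simp add: algebra_simps)

text \<open>Reducing the numerator modulo the denominator, a proper fraction has arbitrarily negative degree
  after a large Frobenius power, which no fixed multiple can compensate.\<close>

lemma dvd_if_frobenius_powers_dvd:
  fixes r s t :: "'a::field poly"
  assumes p: "prime p" "of_nat p = (0 :: 'a)" and "s \<noteq> 0" "t \<noteq> 0"
    and dvd: "\<And>k. t ^ (p ^ (n * k)) dvd s * r ^ (p ^ (n * k))" and "n > 0"
  shows "t dvd r"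
proof (rule ccontr)
  assume not: "\<not> t dvd r"
  define r' where "r' = r mod t"
  have r': "r' \<noteq> 0" "degree r' < degree t"
    using not \<open>t \<noteq> 0\<close> degree_mod_less[of t r] unfolding r'_def by (auto simp: dvd_eq_mod_eq_0)
  \<comment> \<open>Any \<open>k\<close> with \<open>p ^ (n * k) > degree s\<close> would do;
    \<open>degree s\<close> itself suffices since \<open>k < 2 ^ k\<close>.\<close>
  define k where "k = degree s"
  define N where "N = p ^ (n * k)"
  have "of_nat p = (0 :: 'a poly)" using p by (simp add: of_nat_poly)
  then have eq: "r' ^ N = r ^ N - (t * (r div t)) ^ N"
    unfolding r'_def N_def minus_mult_div_eq_mod[symmetric] using p by (intro frobenius_diff)
  have "s * r' ^ N = s * r ^ N - t ^ N * (s * (r div t) ^ N)"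
    unfolding eq by (simp add: right_diff_distrib power_mult_distrib mult.left_commute)
  also have "t ^ N dvd \<dots>" using dvd[of k] unfolding N_def by (intro dvd_diff) auto
  finally have "degree (t ^ N) \<le> degree (s * r' ^ N)"
    using r' \<open>s \<noteq> 0\<close> by (intro dvd_imp_degree_le) auto
  then have "N * degree t \<le> degree s + N * degree r'"
    using r' \<open>s \<noteq> 0\<close> \<open>t \<noteq> 0\<close> by (simp add: degree_mult_eq degree_power_eq)
  moreover have "N * Suc (degree r') \<le> N * degree t" using r' by (intro mult_left_mono) auto
  ultimately have "N \<le> degree s" by simp
  moreover have "k < N"
  proof -
    have "k < 2 ^ k" by simp
    also have "2 ^ k \<le> p ^ k" using p prime_ge_2_nat by (intro power_mono) auto
    also have "p ^ k \<le> p ^ (n * k)"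
      using p prime_ge_1_nat \<open>n > 0\<close> by (intro power_increasing) auto
    finally show ?thesis by (simp add: N_def)
  qed
  ultimately show False by (simp add: k_def)
qed

section \<open>The affine coordinate ring of the Hermitian curve\<close>

text \<open>The interface to the function field: over finite constants, \<open>infinite_H\<close>
  provides the transcendence, and \<open>generated\<close> expresses that \<open>u\<close> and
  \<open>w\<close> generate the field.\<close>

locale hermitian_coordinates =
  fixes p r q :: nat and \<iota> :: "'k::{field,finite} \<Rightarrow> 'h::field" and u w :: 'h
  assumes p: "prime p" "odd p" and q: "q = p ^ r" "r > 0"
    and card_k: "CARD('k) = q ^ 2" and \<iota>: "const_embedding \<iota>"
    and curve: "w ^ q + w = u ^ (q + 1)"
    and infinite_H: "infinite (UNIV :: 'h set)"
    and generated: "\<And>R. is_subfield R \<Longrightarrow> range \<iota> \<subseteq> R \<Longrightarrow> u \<in> R \<Longrightarrow> w \<in> R \<Longrightarrow> R = UNIV"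
begin

lemma q_ge_3: "q \<ge> 3"
proof -
  have "p \<ge> 3" using p prime_ge_2_nat[of p] by (cases "p = 2") auto
  also have "p ^ 1 \<le> p ^ r" using q p prime_ge_1_nat[of p] by (intro power_increasing) auto
  finally show ?thesis using q by simp
qed

lemma odd_q: "odd q" using p q by simp

text \<open>The pole order \<open>q * i + (q + 1) * j\<close> with \<open>j < q\<close> has residue
  \<open>j\<close> modulo \<open>q\<close>, so \<open>s\<close> determines both exponents. The
  inequality says that \<open>i\<close> is nonnegative; \<open>mon\<close> decodes \<open>s\<close>
  accordingly.\<close>

definition S :: "nat set" where "S = {s. (q + 1) * (s mod q) \<le> s}"

definition mon :: "nat \<Rightarrow> 'h" where
  "mon s = u ^ ((s - (q + 1) * (s mod q)) div q) * w ^ (s mod q)"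

lemma S_pair: "j < q \<Longrightarrow> q * i + (q + 1) * j \<in> S"
  and mon_pair: "j < q \<Longrightarrow> mon (q * i + (q + 1) * j) = u ^ i * w ^ j"
proof -
  assume j: "j < q"
  have "(q * i + (q + 1) * j) mod q = (j + q * (i + j)) mod q" by (simp add: algebra_simps)
  also have "\<dots> = j" using j by simp
  finally have m: "(q * i + (q + 1) * j) mod q = j" .
  show "q * i + (q + 1) * j \<in> S" unfolding S_def using m by simp
  show "mon (q * i + (q + 1) * j) = u ^ i * w ^ j"
    unfolding mon_def m using j by simp
qed

lemma S_E:
  assumes "s \<in> S"
  obtains i j where "j < q" "s = q * i + (q + 1) * j"
proof -
  have le: "(q + 1) * (s mod q) \<le> s" using assms unfolding S_def by simp
  have "s - (q + 1) * (s mod q) = (s - s mod q) - q * (s mod q)" by simp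
  also have "s - s mod q = q * (s div q)" by (simp add: minus_mod_eq_mult_div)
  also have "q * (s div q) - q * (s mod q) = q * (s div q - s mod q)" by (simp add: diff_mult_distrib2)
  finally have "s = q * (s div q - s mod q) + (q + 1) * (s mod q)" using le by linarith
  then show thesis using that[of "s mod q"] q_ge_3 by simp
qed

sublocale basis_filtration \<iota> S mon
  by unfold_locales (rule \<iota>)

text \<open>When the exponent of \<open>w\<close> reaches \<open>q\<close>, it is reduced by
  \<open>w ^ q = u ^ (q + 1) - w\<close>. The first term has the same weight
  \<open>q * (q + 1)\<close> as \<open>w ^ q\<close>, and the second contributes only lower
  order.\<close>

lemma S_mon_add:
  assumes "s \<in> S" "t \<in> S"
  shows "s + t \<in> S" "mon s * mon t - mon (s + t) \<in> V (s + t)"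
proof -
  obtain i j i' j' where ij: "j < q" "s = q * i + (q + 1) * j"
    "j' < q" "t = q * i' + (q + 1) * j'" using assms by (elim S_E)
  have st: "s + t = q * (i + i') + (q + 1) * (j + j')" unfolding ij by (simp add: algebra_simps)
  have m: "mon s * mon t = u ^ (i + i') * w ^ (j + j')"
    unfolding ij mon_pair[OF ij(1)] mon_pair[OF ij(3)] by (simp add: power_add)
  have "s + t \<in> S \<and> mon s * mon t - mon (s + t) \<in> V (s + t)"
  proof (cases "j + j' < q")
    case True
    have "mon s * mon t = mon (s + t)" unfolding m st mon_pair[OF True] ..
    moreover have "s + t \<in> S" unfolding st by (rule S_pair[OF True])
    ultimately show ?thesis by (simp add: V_0)
  next
    case False
    define l where "l = j + j' - q"
    have l: "j + j' = q + l" "Suc l < q" using False ij unfolding l_def by auto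
    then have l': "l < q" by simp
    have "(q + 1) * (q + l) = q * (q + 1) + (q + 1) * l" by (simp add: algebra_simps)
    then have st': "s + t = q * (i + i' + (q + 1)) + (q + 1) * l"
      unfolding st l(1) by (simp only: add_mult_distrib2 add.assoc)
    have wq: "w ^ q = u ^ (q + 1) - w" using curve by (simp add: algebra_simps)
    have "mon s * mon t = u ^ (i + i' + (q + 1)) * w ^ l - u ^ (i + i') * w ^ Suc l"
      unfolding m l(1) power_add[of w] wq by (simp add: power_add algebra_simps)
    also have "u ^ (i + i' + (q + 1)) * w ^ l = mon (s + t)"
      unfolding st' mon_pair[OF l'] ..
    also have "u ^ (i + i') * w ^ Suc l = mon (q * (i + i') + (q + 1) * Suc l)"
      unfolding mon_pair[OF l(2)] ..
    finally have eq: "mon s * mon t - mon (s + t) = - mon (q * (i + i') + (q + 1) * Suc l)" by simp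
    have "(q + 1) * Suc l < (q + 1) * (q + l)" using q_ge_3 by (intro mult_strict_left_mono) auto
    then have "Suc (q * (i + i') + (q + 1) * Suc l) \<le> s + t" unfolding st l(1) by linarith
    then have "- mon (q * (i + i') + (q + 1) * Suc l) \<in> V (s + t)"
      by (intro V_uminus V_mono[OF e_V[OF S_pair[OF l(2)]]])
    then show ?thesis using eq S_pair[OF l', of "i + i' + (q + 1)"] unfolding st'[symmetric] by simp
  qed
  then show "s + t \<in> S" "mon s * mon t - mon (s + t) \<in> V (s + t)" by auto
qed

sublocale graded_basis \<iota> S mon
proof
  show "0 \<in> S" "mon 0 = 1" using S_pair[of 0 0] mon_pair[of 0 0] q_ge_3 by auto
qed (use S_mon_add in auto)

lemma finite_compl_S: "finite (- S)"
proof -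
  have "s \<in> S" if "s \<ge> (q + 1) * q" for s
  proof -
    have "(q + 1) * (s mod q) \<le> (q + 1) * q" using q_ge_3 by (intro mult_left_mono) auto
    then show ?thesis using that unfolding S_def by simp
  qed
  then have "- S \<subseteq> {..<(q + 1) * q}" by (auto simp: not_le[symmetric])
  then show ?thesis by (rule finite_subset) simp
qed

lemma u_B: "u \<in> B" and w_B: "w \<in> B"
  using e_B[OF S_pair[of 0 1]] e_B[OF S_pair[of 1 0]] mon_pair[of 0 1] mon_pair[of 1 0] q_ge_3
  by auto

text \<open>In a finite \<open>B\<close> the powers of each nonzero element repeat, so inverses are
  powers and \<open>B\<close> is a subfield, hence everything by \<open>generated\<close>.\<close>

lemma infinite_B: "infinite B"
proof
  assume fin: "finite B"
  note sub = subring_intros[OF B_subring]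
  have inv: "inverse a \<in> B" if a: "a \<in> B" for a
  proof (cases "a = 0")
    case False
    have "\<not> inj (\<lambda>n. a ^ n)"
    proof
      assume "inj (\<lambda>n. a ^ n)"
      moreover have "range (\<lambda>n. a ^ n) \<subseteq> B" using a by (auto intro: sub)
      ultimately show False using fin by (metis finite_imageD finite_subset infinite_UNIV_nat)
    qed
    then obtain m n where "m < n" "a ^ m = a ^ n" unfolding inj_def by (metis linorder_neqE_nat)
    moreover from this obtain k where "n = m + Suc k" using less_imp_Suc_add by auto
    ultimately have "a ^ m * 1 = a ^ m * (a * a ^ k)" by (simp add: power_add)
    then have "a * a ^ k = 1" using False by simp
    then have "inverse a = a ^ k" by (rule inverse_unique)
    then show ?thesis using a by (auto intro: sub)
  qed (simp add: sub)
  have "is_subfield B" unfolding is_subfield_def using inv sub by auto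
  then have "B = UNIV" using generated const_B u_B w_B by blast
  with fin infinite_H show False by simp
qed

text \<open>The monomials are independent because a relation would make \<open>B\<close> finite;
  irreducibility of the curve equation never has to be discussed.\<close>

sublocale independent_graded_basis \<iota> S mon
proof
  show "mon s \<notin> V s" if "s \<in> S" for s
    using dependent_imp_finite[OF that _ finite_compl_S] infinite_B by blast
qed (rule finite_compl_S)

lemma B_frac: "\<exists>a\<in>B. \<exists>b\<in>B. b \<noteq> 0 \<and> z = a / b"
proof -
  note sub = subring_intros[OF B_subring]
  define R where "R = {a / b | a b. a \<in> B \<and> b \<in> B \<and> b \<noteq> 0}"
  have R_I: "a / b \<in> R" if "a \<in> B" "b \<in> B" "b \<noteq> 0" for a b
    unfolding R_def using that by blast
  have B_R: "a \<in> R" if "a \<in> B" for a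
  proof -
    have "a / 1 \<in> R" using that sub by (intro R_I) auto
    then show ?thesis by simp
  qed
  have "is_subfield R"
    unfolding is_subfield_def
  proof (intro conjI ballI)
    show "1 \<in> R" using B_R sub by blast
    fix x assume "x \<in> R"
    then obtain a b where x: "x = a / b" "a \<in> B" "b \<in> B" "b \<noteq> 0" unfolding R_def by auto
    show "inverse x \<in> R"
    proof (cases "a = 0")
      case True
      then show ?thesis using x B_R sub by auto
    next
      case False
      have "inverse x = b / a" using x by simp
      then show ?thesis using R_I[of b a] x False by simp
    qed
    fix y assume "y \<in> R"
    then obtain c d where y: "y = c / d" "c \<in> B" "d \<in> B" "d \<noteq> 0" unfolding R_def by auto
    have "x - y = (a * d - c * b) / (b * d)" using x y by (simp add: diff_frac_eq)
    moreover have "a * d - c * b \<in> B" "b * d \<in> B" using x y by (auto intro: sub)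
    ultimately show "x - y \<in> R" using R_I[of "a * d - c * b" "b * d"] x y by simp
    have "x * y = (a * c) / (b * d)" using x y by simp
    moreover have "a * c \<in> B" using x y by (auto intro: sub)
    ultimately show "x * y \<in> R" using R_I[of "a * c" "b * d"] x y \<open>b * d \<in> B\<close> by simp
  qed
  then have "R = UNIV" using generated B_R const_B u_B w_B by blast
  then show ?thesis unfolding R_def by blast
qed

sublocale degree_ring \<iota> UNIV B deg
proof
  show "finite {n. \<forall>a\<in>B - {0}. deg a \<noteq> n}" unfolding deg_image by (rule finite_compl_S)
qed (use \<iota> B_subring const_B B_frac deg_mult deg_diff deg_0 deg_leading in
  \<open>auto simp: is_subfield_def\<close>)

lemma deg_u: "deg u = q" and deg_w: "deg w = q + 1" and u_nonzero: "u \<noteq> 0" and w_nonzero: "w \<noteq> 0"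
  using deg_e[OF S_pair[of 0 1]] deg_e[OF S_pair[of 1 0]] mon_pair[of 0 1] mon_pair[of 1 0] q_ge_3
    e_nonzero[OF S_pair[of 0 1]] e_nonzero[OF S_pair[of 1 0]]
  by auto

subsection \<open>Polynomial representation\<close>

lemma \<iota>_hom: "is_ring_hom \<iota>"
  using const_embedding_ring_hom[OF \<iota>] .

abbreviation ev1 :: "'k poly \<Rightarrow> 'h" where "ev1 \<equiv> eval_at \<iota> u"

lemma ev1_hom: "is_ring_hom ev1"
  by (rule eval_at_hom[OF \<iota>_hom])

abbreviation ev2 :: "'k poly poly \<Rightarrow> 'h" where "ev2 \<equiv> eval_at ev1 w"

lemma ev2_hom: "is_ring_hom ev2"
  by (rule eval_at_hom[OF ev1_hom])

lemma ev1_B: "ev1 a \<in> B"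
  by (induction a)
    (auto simp: eval_at_0[OF \<iota>_hom] eval_at_pCons[OF \<iota>_hom] const_B u_B intro!: subring_intros[OF B_subring])

lemma ev2_B: "ev2 a \<in> B"
  by (induction a)
    (auto simp: eval_at_0[OF ev1_hom] eval_at_pCons[OF ev1_hom] ev1_B w_B intro!: subring_intros[OF B_subring])

lemma ev1_nonzero: "a \<noteq> 0 \<Longrightarrow> ev1 a \<noteq> 0 \<and> deg (ev1 a) = q * degree a"
proof (induction a)
  case (pCons c a)
  show ?case
  proof (cases "a = 0")
    case True
    then show ?thesis
      using pCons by (simp add: eval_at_0[OF \<iota>_hom] eval_at_pCons[OF \<iota>_hom] d_const \<iota>_simps)
  next
    case False
    have uB: "u * ev1 a \<in> B" using u_B ev1_B by (intro subring_mult[OF B_subring])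
    have "deg (u * ev1 a) = q * Suc (degree a)"
      using pCons False u_B ev1_B u_nonzero by (subst deg_mult) (auto simp: deg_u)
    then have "deg (\<iota> c) < deg (u * ev1 a)" using q_ge_3 by (simp add: d_const)
    from deg_add_less[OF const_B uB this] show ?thesis
      using False \<open>deg (u * ev1 a) = q * Suc (degree a)\<close> by (simp add: eval_at_pCons[OF \<iota>_hom])
  qed
qed simp

text \<open>The nonzero terms have degrees congruent to their distinct exponents \<open>j\<close>
  modulo \<open>q\<close>, so leading terms cannot cancel.\<close>

lemma ev2_nonzero:
  assumes "a \<noteq> 0" "degree a < q"
  shows "ev2 a \<noteq> 0"
proof -
  define J where "J = {j. j < q \<and> coeff a j \<noteq> 0}"
  have "degree a \<in> J" using assms unfolding J_def by (simp add: leading_coeff_neq_0)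
  have eq: "ev2 a = (\<Sum>j\<in>J. ev1 (coeff a j) * w ^ j)"
    unfolding eval_at_sum[OF ev1_hom assms(2)] J_def
    by (intro sum.mono_neutral_right) (auto simp: eval_at_0[OF \<iota>_hom])
  have wj: "w ^ j \<in> B" "w ^ j \<noteq> 0" "deg (w ^ j) = (q + 1) * j" for j
    using w_B w_nonzero d_power[OF w_B w_nonzero, of j]
    by (auto simp: deg_w intro: subring_power[OF B_subring])
  have dj: "deg (ev1 (coeff a j) * w ^ j) = q * degree (coeff a j) + (q + 1) * j" if "j \<in> J" for j
    using that ev1_nonzero[of "coeff a j"] wj ev1_B unfolding J_def by (simp add: deg_mult)
  have "(\<Sum>j\<in>J. ev1 (coeff a j) * w ^ j) \<noteq> 0"
  proof (rule sum_distinct_degrees[THEN conjunct1])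
    show "finite J" unfolding J_def by simp
    show "J \<noteq> {}" using \<open>degree a \<in> J\<close> by auto
    show "ev1 (coeff a j) * w ^ j \<in> B" for j
      using wj ev1_B by (intro subring_mult[OF B_subring])
    show "ev1 (coeff a j) * w ^ j \<noteq> 0" if "j \<in> J" for j
      using that ev1_nonzero[of "coeff a j"] wj unfolding J_def by simp
    show "inj_on (\<lambda>j. deg (ev1 (coeff a j) * w ^ j)) J"
    proof (rule inj_onI)
      fix i j assume ij: "i \<in> J" "j \<in> J" "deg (ev1 (coeff a i) * w ^ i) = deg (ev1 (coeff a j) * w ^ j)"
      have m: "(q * n + (q + 1) * j) mod q = j" if "j < q" for n j
      proof -
        have "(q * n + (q + 1) * j) mod q = (j + q * (n + j)) mod q" by (simp add: algebra_simps)
        then show ?thesis using that by simp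
      qed
      show "i = j" using ij(3) m ij(1,2) unfolding dj[OF ij(1)] dj[OF ij(2)] J_def by (metis (mono_tags, lifting) mem_Collect_eq)
    qed
  qed
  then show ?thesis using eq by simp
qed

lemma ev2_inj:
  assumes "ev2 a = ev2 b" "degree a < q" "degree b < q"
  shows "a = b"
proof (rule ccontr)
  assume "a \<noteq> b"
  then have "ev2 (a - b) \<noteq> 0"
    using assms by (intro ev2_nonzero) (auto intro: degree_diff_less)
  then show False using assms ring_hom_diff[OF ev2_hom] by simp
qed

lemma B_ev2:
  assumes "b \<in> B"
  obtains a where "degree a < q" "b = ev2 a"
proof -
  have "\<exists>a. degree a < q \<and> b = ev2 a" if "b \<in> V n" for n
    using that
  proof (induction n arbitrary: b)
    case 0
    then show ?case using q_ge_3 by (intro exI[of _ 0]) (auto simp: eval_at_0[OF ev1_hom])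
  next
    case (Suc n)
    from Suc.prems show ?case
    proof (rule V_SucE)
      fix v c assume *: "n \<in> S" "v \<in> V n" "b = v + \<iota> c * mon n"
      then obtain a where a: "degree a < q" "v = ev2 a" using Suc.IH by blast
      obtain i j where ij: "j < q" "n = q * i + (q + 1) * j" using * by (elim S_E)
      have "ev2 (monom (monom c i) j) = \<iota> c * mon n"
        unfolding eval_at_monom[OF ev1_hom] eval_at_monom[OF \<iota>_hom] ij(2) mon_pair[OF ij(1)]
        by (simp add: mult.assoc)
      then have "b = ev2 (a + monom (monom c i) j)"
        unfolding eval_at_add[OF ev1_hom] using * a by simp
      moreover have "degree (a + monom (monom c i) j) < q"
        using a ij degree_monom_le[of "monom c i" j] by (intro degree_add_less) auto
      ultimately show ?case by blast
    qed (use Suc.IH in blast)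
  qed
  then show thesis using that assms unfolding B_def by blast
qed

subsection \<open>Integral closedness\<close>

lemma of_nat_p_k: "of_nat p = (0 :: 'k)"
  using card_k by (intro of_nat_eq_0_of_card[of _ "r * 2"]) (simp add: q power_mult)

lemma of_nat_p_h: "of_nat p = (0 :: 'h)"
  using of_nat_p_k const_embedding_of_nat[OF \<iota>, of p] by (simp add: \<iota>_simps)

lemma q_power: "q ^ k = p ^ (r * k)"
  by (simp add: q power_mult)

text \<open>This makes the passage from an element to its Frobenius powers triangular in the powers of
  \<^term>\<open>w\<close>.\<close>

lemma w_frobenius_power: "\<exists>E. w ^ (q ^ k) = ev1 E + (-1) ^ k * w"
proof (induction k)
  case 0
  show ?case by (intro exI[of _ 0]) (simp add: eval_at_0[OF \<iota>_hom])
next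
  case (Suc k)
  then obtain E where E: "w ^ (q ^ k) = ev1 E + (-1) ^ k * w" by blast
  have "w ^ (q ^ Suc k) = (w ^ (q ^ k)) ^ q" by (simp add: mult.commute flip: power_mult)
  also have "\<dots> = ev1 E ^ q + ((-1) ^ k * w) ^ q"
    unfolding E using frobenius_add[OF p(1) of_nat_p_h, of _ _ r] q(1) by simp
  also have "((-1) ^ k * w) ^ q = ((-1) ^ q) ^ k * w ^ q"
    by (simp add: power_mult_distrib mult.commute flip: power_mult)
  also have "(-1) ^ q = (-1 :: 'h)" using odd_q by simp
  also have "w ^ q = u ^ (q + 1) - w" using curve by (simp add: algebra_simps)
  also have "ev1 E ^ q + (-1) ^ k * (u ^ (q + 1) - w)
      = (ev1 E ^ q + (-1) ^ k * u ^ (q + 1)) + (-1) ^ Suc k * w" by (simp add: algebra_simps)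
  also have "ev1 E ^ q + (-1) ^ k * u ^ (q + 1) = ev1 (E ^ q + monom ((-1) ^ k) (q + 1))"
  proof -
    have "\<iota> ((-1) ^ k) = (-1) ^ k" by (simp add: \<iota>_simps)
    then show ?thesis
      by (simp add: eval_at_add[OF \<iota>_hom] ring_hom_power[OF ev1_hom] eval_at_monom[OF \<iota>_hom])
  qed
  finally show ?case by blast
qed

text \<open>With \<open>N = q ^ k\<close>, the power \<open>w ^ N\<close> is affine in
  \<open>w\<close> over \<open>K[u]\<close>. So the \<open>N\<close>-th power of
  \<open>ev2 P\<close> still has a representation of degree below \<open>q\<close> in
  \<open>w\<close>, which may be compared with that of \<open>a\<close>; undoing the affine
  substitution isolates the powers of the coefficients.\<close>

lemma frobenius_coefficients:
  assumes P: "degree P < q" and a: "a \<in> B" "a * ev1 t ^ (q ^ k) = ev1 s * ev2 P ^ (q ^ k)"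
  shows "t ^ (q ^ k) dvd s * coeff P j ^ (q ^ k)"
proof -
  define N where "N = q ^ k"
  have N: "N = p ^ (r * k)" unfolding N_def by (rule q_power)
  have N0: "N > 0" using N p prime_gt_0_nat by simp
  obtain E where E: "w ^ N = ev1 E + (-1) ^ k * w" unfolding N_def using w_frobenius_power by blast
  \<comment> \<open>\<open>L\<close> is the affine polynomial with value \<open>w ^ N\<close> at
    \<open>w\<close>, and \<open>L'\<close> is its inverse under composition, as
    \<open>(-1) ^ k\<close> is its own inverse.\<close>
  define L L' where "L = [:E, (-1) ^ k:]" and "L' = [:- ((-1) ^ k * E), (-1) ^ k:]"
  define P' where "P' = map_poly (\<lambda>c. c ^ N) P"
  have cP': "coeff P' i = coeff P i ^ N" for i unfolding P'_def using N0 by (simp add: coeff_map_poly)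
  have dP': "degree P' < q"
    using P map_poly_degree_leq[of "\<lambda>c. c ^ N" P] N0 unfolding P'_def by simp
  have sq: "(-1) ^ k * (-1) ^ k = (1 :: 'k poly)" by (simp flip: power_mult_distrib)
  have evL: "ev2 L = w ^ N"
    unfolding E L_def by (simp add: eval_at_pCons[OF ev1_hom] eval_at_0[OF ev1_hom]
      ring_hom_power[OF ev1_hom] ring_hom_uminus[OF ev1_hom] ev1_hom[unfolded is_ring_hom_def] mult.commute)
  have "ev2 (smult s (P' \<circ>\<^sub>p L)) = ev1 s * eval_at ev1 (w ^ N) P'"
    by (simp add: eval_at_smult[OF ev1_hom] eval_at_pcompose[OF ev1_hom] evL)
  also have "eval_at ev1 (w ^ N) P' = (\<Sum>i<q. ev1 (coeff P i) ^ N * (w ^ N) ^ i)"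
    unfolding eval_at_sum[OF ev1_hom dP'] cP' ring_hom_power[OF ev1_hom] ..
  also have "\<dots> = (\<Sum>i<q. ev1 (coeff P i) * w ^ i) ^ N"
    unfolding N frobenius_sum[OF p(1) of_nat_p_h]
    by (intro sum.cong) (auto simp: power_mult_distrib mult.commute simp flip: power_mult)
  also have "\<dots> = ev2 P ^ N" unfolding eval_at_sum[OF ev1_hom P] ..
  finally have 1: "ev2 (smult s (P' \<circ>\<^sub>p L)) = ev1 s * ev2 P ^ N" .
  obtain Q where Q: "degree Q < q" "a = ev2 Q" using a B_ev2 by blast
  have 2: "ev2 (smult (t ^ N) Q) = ev1 t ^ N * a"
    by (simp add: eval_at_smult[OF ev1_hom] ring_hom_power[OF ev1_hom] Q)
  have dL: "degree L \<le> 1" "degree L' \<le> 1" unfolding L_def L'_def by auto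
  have "smult s (P' \<circ>\<^sub>p L) = smult (t ^ N) Q"
  proof (rule ev2_inj)
    show "ev2 (smult s (P' \<circ>\<^sub>p L)) = ev2 (smult (t ^ N) Q)"
      unfolding 1 2 using a by (simp add: N_def mult.commute)
    have "degree (P' \<circ>\<^sub>p L) \<le> degree P' * 1"
      using degree_pcompose_le[of P' L] dL by (meson le_trans mult_le_mono2)
    then show "degree (smult s (P' \<circ>\<^sub>p L)) < q" using dP' degree_smult_le[of s "P' \<circ>\<^sub>p L"] by simp
    show "degree (smult (t ^ N) Q) < q" using Q degree_smult_le[of "t ^ N" Q] by simp
  qed
  then have "smult s (P' \<circ>\<^sub>p L) \<circ>\<^sub>p L' = smult (t ^ N) Q \<circ>\<^sub>p L'" by simp
  then have "smult s (P' \<circ>\<^sub>p (L \<circ>\<^sub>p L')) = smult (t ^ N) (Q \<circ>\<^sub>p L')"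
    by (simp add: pcompose_smult pcompose_assoc)
  moreover have "L \<circ>\<^sub>p L' = [:0, 1:]"
    unfolding L_def L'_def using sq by (simp add: pcompose_pCons algebra_simps flip: mult.assoc)
  ultimately have "smult s P' = smult (t ^ N) (Q \<circ>\<^sub>p L')" by (simp add: pcompose_idR)
  then have "coeff (smult s P') j = coeff (smult (t ^ N) (Q \<circ>\<^sub>p L')) j" by simp
  then show ?thesis unfolding coeff_smult cP' N_def by (metis dvd_triv_left)
qed

text \<open>Write \<open>z\<close> as \<open>ev2 P\<close> over a denominator \<open>t\<close> in
  \<open>K[u]\<close>. Integrality makes \<open>t ^ n\<close> a common denominator of all powers of
  \<open>z\<close>. Applied to the powers \<open>q ^ k\<close>, this forces \<open>t\<close> to
  divide every coefficient of \<open>P\<close>.\<close>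

lemma B_int_closed:
  assumes z: "z \<in> adjoin B (inverse z)"
  shows "z \<in> B"
proof (cases "z = 0")
  case False
  note sub = subring_intros[OF B_subring]
  obtain a b where ab: "a \<in> B" "b \<in> B" "b \<noteq> 0" "z = a / b" using B_frac by blast
  \<comment> \<open>Two powers of \<open>u\<close> are congruent modulo the denominator
    \<open>b\<close>, so \<open>b\<close> divides a nonzero polynomial in \<open>u\<close>
    alone.\<close>
  obtain i j c where ij: "i < j" "c \<in> B" "u ^ i - u ^ j = b * c"
    using congruent_pair_in_sequence[OF B_subring _ _ ab(2,3), of "\<lambda>n. u ^ n"] u_B sub by auto
  define t :: "'k poly" where "t = monom 1 i - monom 1 j"
  have evt: "ev1 t = u ^ i - u ^ j"
    unfolding t_def ring_hom_diff[OF ev1_hom] eval_at_monom[OF \<iota>_hom] by (simp add: \<iota>_simps)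
  have "coeff t i = 1" unfolding t_def using ij by simp
  then have t0: "t \<noteq> 0" by auto
  have tz: "ev1 t * z \<in> B"
  proof -
    have "ev1 t * z = c * a" unfolding evt ij(3) ab(4) using ab(3) by simp
    then show ?thesis using ab ij by (simp add: sub)
  qed
  obtain P where P: "degree P < q" "ev1 t * z = ev2 P" using tz B_ev2 by blast
  obtain f where f: "z = poly f (inverse z)" "\<And>i. coeff f i \<in> B" using z unfolding adjoin_def by auto
  define n where "n = degree f"
  have rec: "z ^ Suc (n + m) = (\<Sum>k\<le>n. coeff f k * z ^ (n + m - k))" for m
  proof -
    have "z ^ Suc (n + m) = z ^ (n + m) * poly f (inverse z)" using f(1) by simp
    also have "\<dots> = (\<Sum>k\<le>n. z ^ (n + m) * (coeff f k * inverse z ^ k))"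
      unfolding poly_altdef n_def sum_distrib_left ..
    also have "\<dots> = (\<Sum>k\<le>n. coeff f k * z ^ (n + m - k))"
      using False by (intro sum.cong) (auto simp: power_diff divide_simps)
    finally show ?thesis .
  qed
  \<comment> \<open>By \<open>rec\<close> every power of \<open>z\<close> is a combination over
    \<open>B\<close> of the powers up to \<open>n\<close>, and for these \<open>t ^ n\<close> clears
    denominators.\<close>
  have bd: "ev1 t ^ n * z ^ N \<in> B" for N
  proof (induction N rule: less_induct)
    case (less N)
    show ?case
    proof (cases "N \<le> n")
      case True
      then have "ev1 t ^ n = ev1 t ^ (n - N) * ev1 t ^ N" by (simp flip: power_add)
      then have "ev1 t ^ n * z ^ N = ev1 t ^ (n - N) * (ev1 t * z) ^ N"
        by (simp add: power_mult_distrib)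
      also have "\<dots> \<in> B"
        by (rule subring_mult[OF B_subring subring_power[OF B_subring ev1_B]
            subring_power[OF B_subring tz]])
      finally show ?thesis .
    next
      case False
      define m where "m = N - Suc n"
      have m: "N = Suc (n + m)" using False by (simp add: m_def)
      have "ev1 t ^ n * z ^ N = (\<Sum>k\<le>n. coeff f k * (ev1 t ^ n * z ^ (n + m - k)))"
        unfolding m rec sum_distrib_left by (intro sum.cong) (auto simp: ac_simps)
      also have "\<dots> \<in> B"
      proof (rule subring_sum[OF B_subring])
        fix k
        show "coeff f k * (ev1 t ^ n * z ^ (n + m - k)) \<in> B"
          by (rule subring_mult[OF B_subring f(2) less]) (simp add: m)
      qed
      finally show ?thesis .
    qed
  qed
  have "t dvd coeff P l" for l
  proof (rule dvd_if_frobenius_powers_dvd[OF p(1) of_nat_p_k _ t0])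
    show "t ^ n \<noteq> 0" using t0 by simp
    fix k
    show "t ^ (p ^ (r * k)) dvd t ^ n * coeff P l ^ (p ^ (r * k))"
      unfolding q_power[symmetric]
    proof (rule frobenius_coefficients[OF P(1) bd[of "q ^ k"]])
      show "ev1 t ^ n * z ^ q ^ k * ev1 t ^ q ^ k = ev1 (t ^ n) * ev2 P ^ q ^ k"
        unfolding P(2)[symmetric] ring_hom_power[OF ev1_hom] power_mult_distrib by (simp add: ac_simps)
    qed
  qed (rule q(2))
  then have "[:t:] dvd P" by (simp add: const_poly_dvd_iff)
  then obtain Q where "P = [:t:] * Q" by blast
  then have "ev2 P = ev1 t * ev2 Q" by (simp add: eval_at_smult[OF ev1_hom])
  then have "z = ev2 Q" using P(2) ev1_nonzero[OF t0] by simp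
  then show ?thesis using ev2_B by simp
qed (simp add: subring_0[OF B_subring])

end

section \<open>Counting the gaps\<close>

lemma card_congruent_below:
  fixes s q :: nat
  assumes "q > 0"
  shows "card {n. n < s \<and> n mod q = s mod q} = s div q"
proof -
  have "{n. n < s \<and> n mod q = s mod q} = (\<lambda>l. s mod q + q * l) ` {..<s div q}"
  proof (intro equalityI subsetI)
    fix n assume "n \<in> {n. n < s \<and> n mod q = s mod q}"
    then have n: "n < s" "n mod q = s mod q" by auto
    have "n = s mod q + q * (n div q)" unfolding n(2)[symmetric] by simp
    moreover have "n div q < s div q"
    proof (rule ccontr)
      assume "\<not> n div q < s div q"
      then have "q * (s div q) \<le> q * (n div q)" by simp
      then have "s \<le> n" using n(2) by (metis add_le_cancel_right mult_div_mod_eq)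
      with n show False by simp
    qed
    ultimately show "n \<in> (\<lambda>l. s mod q + q * l) ` {..<s div q}" by auto
  next
    fix n assume "n \<in> (\<lambda>l. s mod q + q * l) ` {..<s div q}"
    then obtain l where l: "l < s div q" "n = s mod q + q * l" by auto
    then have "q * l < q * (s div q)" using assms by simp
    then have "n < s" using l by (metis add_less_cancel_left mod_mult_div_eq)
    then show "n \<in> {n. n < s \<and> n mod q = s mod q}" using l by simp
  qed
  moreover have "inj_on (\<lambda>l. s mod q + q * l) {..<s div q}" using assms by (auto simp: inj_on_def)
  ultimately show ?thesis by (simp add: card_image)
qed

lemma card_multiples_below:
  fixes n d :: nat
  assumes "d > 0"
  shows "card {j. j \<le> n \<and> d dvd j} = Suc (n div d)"
proof -
  have "{j. j \<le> n \<and> d dvd j} = (\<lambda>l. d * l) ` {..n div d}"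
    using assms by (auto simp: dvd_def less_eq_div_iff_mult_less_eq mult.commute)
  moreover have "inj_on (\<lambda>l. d * l) {..n div d}" using assms by (auto simp: inj_on_def)
  ultimately show ?thesis by (simp add: card_image)
qed

text \<open>For each residue \<^term>\<open>j\<close> of the exponent of the second coordinate, \<^term>\<open>a j\<close> is the
  least admissible exponent of the first one, so that the \<^term>\<open>s j\<close> form an Apery set with respect
  to \<^term>\<open>q\<close>.\<close>

locale hermitian_semigroup =
  fixes q m :: nat
  assumes q: "q \<ge> 3" "odd q" and m: "m > 0" "m dvd 2 * (q - 1)"
begin

definition T :: "nat set" where
  "T = {n. \<exists>i j. j < q \<and> m dvd i + (q + 1) * j \<and> m * n = q * i + (q + 1) * j}"

definition a :: "nat \<Rightarrow> nat" where
  "a j = (m - ((q + 1) * j) mod m) mod m"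

definition s :: "nat \<Rightarrow> nat" where
  "s j = (q * a j + (q + 1) * j) div m"

lemma m_dvd_prod: "m dvd (q + 1) * (q - 1)"
proof -
  obtain l where "q = 2 * l + 1" using q(2) by (rule oddE)
  then have "(q + 1) * (q - 1) = 2 * (q - 1) * (l + 1)" by simp
  then show ?thesis using m by (metis dvd_mult2)
qed

text \<open>The difference to the hypothesis is \<open>(q - 1) * i\<close>. For even
  \<open>m\<close> the exponent \<open>i\<close> is even, since \<open>q + 1\<close> is, and
  \<open>m dvd 2 * (q - 1)\<close> applies; for odd \<open>m\<close> already
  \<open>m dvd q - 1\<close>.\<close>

lemma m_dvd_degree:
  assumes "m dvd i + (q + 1) * j"
  shows "m dvd q * i + (q + 1) * j"
proof -
  have "m dvd (q - 1) * i"
  proof (cases "even m")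
    case True
    then have "even (i + (q + 1) * j)" using assms by (meson dvd_trans)
    then obtain l where l: "i = 2 * l" using q by (auto elim: evenE)
    then have "(q - 1) * i = 2 * (q - 1) * l" by simp
    then show ?thesis using m by (metis dvd_mult2)
  next
    case False
    then have "coprime m 2" by simp
    then have "m dvd q - 1" using m by (simp add: coprime_dvd_mult_right_iff)
    then show ?thesis by simp
  qed
  then have "m dvd (q - 1) * i + (i + (q + 1) * j)" using assms by (rule dvd_add)
  moreover have "(q - 1) * i + (i + (q + 1) * j) = q * i + (q + 1) * j"
    using q by (cases q) auto
  ultimately show ?thesis by metis
qed

lemma a_less: "a j < m" using m by (simp add: a_def)

lemma a_dvd: "m dvd a j + (q + 1) * j"
proof -
  define k where "k = (q + 1) * j"
  have "(a j + k) mod m = ((m - k mod m) + k) mod m"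
    unfolding a_def k_def[symmetric] by (rule mod_add_left_eq)
  also have "\<dots> = ((m - k mod m) + k mod m) mod m" by (rule mod_add_right_eq[symmetric])
  also have "(m - k mod m) + k mod m = m" using m by (simp add: less_imp_le)
  finally show ?thesis unfolding k_def by (simp add: mod_eq_0_iff_dvd)
qed

lemma exponent_form:
  assumes "m dvd i + (q + 1) * j"
  obtains l where "i = a j + m * l"
proof -
  have "a j \<le> i"
  proof (rule ccontr)
    assume *: "\<not> a j \<le> i"
    have "m dvd (a j + (q + 1) * j) - (i + (q + 1) * j)" using a_dvd assms by (rule dvd_diff_nat)
    then have "m dvd a j - i" by simp
    then have "m \<le> a j - i" using * by (intro dvd_imp_le) auto
    then show False using a_less[of j] by simp
  qed
  moreover have "m dvd (i + (q + 1) * j) - (a j + (q + 1) * j)"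
    using assms a_dvd by (rule dvd_diff_nat)
  then have "m dvd i - a j" by simp
  then obtain l where "i - a j = m * l" by blast
  ultimately show thesis using that[of l] by simp
qed

lemma m_s: "m * s j = q * a j + (q + 1) * j"
  unfolding s_def using m_dvd_degree[OF a_dvd] by simp

lemma T_iff: "n \<in> T \<longleftrightarrow> (\<exists>j<q. \<exists>l. n = s j + q * l)"
proof
  assume "n \<in> T"
  then obtain i j where ij: "j < q" "m dvd i + (q + 1) * j" "m * n = q * i + (q + 1) * j"
    unfolding T_def by auto
  then obtain l where l: "i = a j + m * l" using exponent_form by blast
  have "m * n = m * (s j + q * l)"
    unfolding ij l distrib_left m_s by (simp add: algebra_simps)
  then show "\<exists>j<q. \<exists>l. n = s j + q * l" using m ij by auto
next
  assume "\<exists>j<q. \<exists>l. n = s j + q * l"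
  then obtain j l where jl: "j < q" "n = s j + q * l" by auto
  have "m * n = q * (a j + m * l) + (q + 1) * j"
    unfolding jl distrib_left m_s by (simp add: algebra_simps)
  moreover have "m dvd (a j + m * l) + (q + 1) * j"
    using a_dvd[of j] by (metis add.assoc add.commute dvd_add dvd_triv_left)
  ultimately show "n \<in> T" unfolding T_def using jl by blast
qed

lemma s_mod_inj: "inj_on (\<lambda>j. s j mod q) {..<q}"
proof (rule inj_onI)
  \<comment> \<open>Modulo \<open>q\<close> the number \<open>m * s j\<close> is \<open>j\<close>,
    so the \<open>s j\<close> represent each residue class once.\<close>
  have *: "(m * s j) mod q = j" if "j < q" for j
  proof -
    have "m * s j = j + q * (a j + j)" unfolding m_s by (simp add: algebra_simps)
    then show ?thesis using that by simp
  qed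
  fix i j assume ij: "i \<in> {..<q}" "j \<in> {..<q}" "s i mod q = s j mod q"
  then have "(m * s i) mod q = (m * s j) mod q" by (metis mod_mult_right_eq)
  then show "i = j" using * ij by simp
qed

lemma s_mod_image: "(\<lambda>j. s j mod q) ` {..<q} = {..<q}"
  using q by (intro card_subset_eq) (auto simp: card_image[OF s_mod_inj])

lemma compl_T: "- T = (\<Union>j<q. {n. n < s j \<and> n mod q = s j mod q})"
proof (intro equalityI subsetI)
  fix n assume n: "n \<in> - T"
  have "n mod q \<in> (\<lambda>j. s j mod q) ` {..<q}" unfolding s_mod_image using q by simp
  then obtain j where j: "j < q" "n mod q = s j mod q" by auto
  have "n < s j"
  proof (rule ccontr)
    assume "\<not> n < s j"
    then have "s j \<le> n" by simp
    then have "q dvd n - s j" using j by (simp add: mod_eq_dvd_iff_nat)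
    then obtain l where "n - s j = q * l" by blast
    then have "n = s j + q * l" using \<open>s j \<le> n\<close> by simp
    then show False using n j T_iff by blast
  qed
  then show "n \<in> (\<Union>j<q. {n. n < s j \<and> n mod q = s j mod q})" using j by blast
next
  fix n assume "n \<in> (\<Union>j<q. {n. n < s j \<and> n mod q = s j mod q})"
  then obtain j where j: "j < q" "n < s j" "n mod q = s j mod q" by auto
  show "n \<in> - T"
  proof
    assume "n \<in> T"
    then obtain j' l where jl: "j' < q" "n = s j' + q * l" using T_iff by blast
    then have "s j' mod q = s j mod q" using j by simp
    then have "j' = j" using s_mod_inj jl j unfolding inj_on_def by blast
    with jl j show False by simp
  qed
qed

lemma finite_compl_T: "finite (- T)"
  unfolding compl_T by auto

lemma card_compl_T_sum: "card (- T) = (\<Sum>j<q. s j div q)"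
proof -
  have "card (- T) = (\<Sum>j<q. card {n. n < s j \<and> n mod q = s j mod q})"
    unfolding compl_T
  proof (intro card_UN_disjoint ballI impI)
    fix i j assume "i \<in> {..<q}" "j \<in> {..<q}" "i \<noteq> j"
    then have "s i mod q \<noteq> s j mod q" using s_mod_inj unfolding inj_on_def by blast
    then show "{n. n < s i \<and> n mod q = s i mod q} \<inter> {n. n < s j \<and> n mod q = s j mod q} = {}" by auto
  qed auto
  also have "\<dots> = (\<Sum>j<q. s j div q)" using q by (simp add: card_congruent_below)
  finally show ?thesis .
qed

lemma double_sum_lessThan: "2 * (\<Sum>j<q. j) = q * (q - 1)"
  using Sum_Ico_nat[of 0 q] q by (simp add: lessThan_atLeast0 mult.commute)

text \<open>Selmer's formula for the Apery set \<open>s\<close>: the quotients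
  \<open>s j div q\<close> sum to the number of gaps, and the remainders are a permutation of
  \<open>0, ..., q - 1\<close>.\<close>

lemma card_compl_T_relation: "2 * m * card (- T) + m * (q - 1) = 2 * (\<Sum>j<q. a j) + (q + 1) * (q - 1)"
proof -
  have "(\<Sum>j<q. s j) = (\<Sum>j<q. q * (s j div q) + s j mod q)" by simp
  also have "\<dots> = q * card (- T) + (\<Sum>j<q. s j mod q)"
    unfolding card_compl_T_sum sum.distrib sum_distrib_left ..
  also have "(\<Sum>j<q. s j mod q) = (\<Sum>j<q. j)"
    using sum.reindex[OF s_mod_inj, of "\<lambda>x. x"] unfolding s_mod_image by simp
  finally have 1: "(\<Sum>j<q. s j) = q * card (- T) + (\<Sum>j<q. j)" .
  have "m * (\<Sum>j<q. s j) = q * (\<Sum>j<q. a j) + (q + 1) * (\<Sum>j<q. j)"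
    unfolding sum_distrib_left m_s sum.distrib ..
  then have "2 * (m * (q * card (- T) + (\<Sum>j<q. j))) = 2 * (q * (\<Sum>j<q. a j) + (q + 1) * (\<Sum>j<q. j))"
    unfolding 1 by simp
  then have "2 * m * q * card (- T) + m * (2 * (\<Sum>j<q. j)) =
      2 * q * (\<Sum>j<q. a j) + (q + 1) * (2 * (\<Sum>j<q. j))"
    by (simp add: algebra_simps)
  then have "q * (2 * m * card (- T) + m * (q - 1)) = q * (2 * (\<Sum>j<q. a j) + (q + 1) * (q - 1))"
    unfolding double_sum_lessThan by (simp add: algebra_simps)
  then show ?thesis using q by simp
qed

text \<open>Pair \<^term>\<open>j\<close> with \<^term>\<open>q - 1 - j\<close>.\<close>

lemma double_sum_a: "2 * (\<Sum>j<q. a j) = m * card {j. j < q \<and> \<not> m dvd (q + 1) * j}"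
proof -
  \<comment> \<open>As \<open>m dvd (q + 1) * (q - 1)\<close>, the weights of \<open>j\<close> and
    \<open>q - 1 - j\<close> are opposite modulo \<open>m\<close>. So the sum of the two values is a
    multiple of \<open>m\<close> below \<open>2 * m\<close>.\<close>
  have pair: "a j + a (q - 1 - j) = (if m dvd (q + 1) * j then 0 else m)" if j: "j < q" for j
  proof -
    have "(q + 1) * j + (q + 1) * (q - 1 - j) = (q + 1) * (q - 1)"
      using j by (subst add_mult_distrib2[symmetric]) simp
    moreover note m_dvd_prod
    moreover have "m dvd (a j + (q + 1) * j) + (a (q - 1 - j) + (q + 1) * (q - 1 - j))"
      by (rule dvd_add[OF a_dvd a_dvd])
    ultimately have "m dvd (a j + a (q - 1 - j)) + (q + 1) * (q - 1)"
      by (metis (no_types, lifting) add.assoc add.left_commute)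
    then have dv: "m dvd a j + a (q - 1 - j)"
      using m_dvd_prod by (simp add: dvd_add_left_iff)
    have a0: "a i = 0 \<longleftrightarrow> m dvd (q + 1) * i" for i
      using a_dvd[of i] a_less[of i] dvd_imp_le[of m "a i"]
      by (cases "a i = 0") (auto simp: dvd_add_left_iff)
    have dv': "m dvd (q + 1) * j \<longleftrightarrow> m dvd (q + 1) * (q - 1 - j)"
      using \<open>(q + 1) * j + (q + 1) * (q - 1 - j) = (q + 1) * (q - 1)\<close> m_dvd_prod
      by (metis dvd_add_left_iff dvd_add_right_iff)
    show ?thesis
    proof (cases "m dvd (q + 1) * j")
      case True
      then show ?thesis using a0 dv' by simp
    next
      case False
      then have "a j > 0" using a0[of j] by (metis gr0I)
      obtain l where l: "a j + a (q - 1 - j) = m * l" using dv by blast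
      then have "m * l < m * 2" "m * l > 0"
        using a_less[of j] a_less[of "q - 1 - j"] \<open>a j > 0\<close> by linarith+
      then have "l = 1" using m by simp
      then show ?thesis using l False by simp
    qed
  qed
  have "(\<Sum>j<q. a (q - 1 - j)) = (\<Sum>j<q. a j)"
    using sum.nat_diff_reindex[of a q] by simp
  then have "2 * (\<Sum>j<q. a j) = (\<Sum>j<q. a j + a (q - 1 - j))"
    by (simp add: sum.distrib)
  also have "\<dots> = (\<Sum>j<q. if m dvd (q + 1) * j then 0 else m)" using pair by simp
  also have "\<dots> = (\<Sum>j\<in>{j. j < q \<and> \<not> m dvd (q + 1) * j}. m)"
    by (intro sum.mono_neutral_cong_right) auto
  finally show ?thesis by simp
qed

text \<open>Only the \<open>j < q\<close> with \<open>m dvd (q + 1) * j\<close> remain to be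
  counted. For \<open>h = gcd m (q + 1)\<close> these are the multiples of
  \<open>m' = m div h\<close>; since \<open>m'\<close> divides \<open>q - 1\<close>, there are
  \<open>(q - 1) div m' + 1\<close> of them, 0 included.\<close>

theorem card_compl_T: "2 * m * card (- T) = (q - 1) * (q + 1 - gcd m (q + 1))"
proof -
  define h where "h = gcd m (q + 1)"
  have h: "h > 0" "h dvd m" "h dvd q + 1" using m unfolding h_def by auto
  define m' where "m' = m div h"
  have mm: "m = h * m'" using h unfolding m'_def by simp
  have m'0: "m' > 0" using m mm by (cases m') auto
  obtain k' where k': "q + 1 = h * k'" using h by blast
  have cop: "coprime m' k'"
    using gcd_mult_distrib_nat[of h m' k'] h unfolding mm[symmetric] k'[symmetric] h_def[symmetric]
    by (simp add: coprime_iff_gcd_eq_1)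
  have iff: "m dvd (q + 1) * j \<longleftrightarrow> m' dvd j" for j
    unfolding mm k' using h(1) cop by (simp add: mult.assoc coprime_dvd_mult_right_iff)
  have "m' dvd q - 1" using m_dvd_prod iff by simp
  then obtain n where n: "q - 1 = m' * n" by blast
  have "card {j. j \<le> q - 1 \<and> m' dvd j} = Suc n"
    using card_multiples_below[OF m'0, of "q - 1"] m'0 unfolding n by simp
  then have c: "card {j. j < q \<and> m dvd (q + 1) * j} = Suc n"
    unfolding iff using q by (simp add: less_eq_Suc_le[symmetric] Suc_diff_le less_Suc_eq_le[symmetric])
  have "{..<q} = {j. j < q \<and> m dvd (q + 1) * j} \<union> {j. j < q \<and> \<not> m dvd (q + 1) * j}" by auto
  then have "q = card ({j. j < q \<and> m dvd (q + 1) * j} \<union> {j. j < q \<and> \<not> m dvd (q + 1) * j})"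
    by (metis card_lessThan)
  also have "\<dots> = Suc n + card {j. j < q \<and> \<not> m dvd (q + 1) * j}"
    unfolding c[symmetric] by (intro card_Un_disjoint) auto
  finally have "q - 1 = n + card {j. j < q \<and> \<not> m dvd (q + 1) * j}" by simp
  then have "m * (q - 1) = m * n + 2 * (\<Sum>j<q. a j)"
    unfolding double_sum_a by (metis distrib_left)
  moreover have "m * n = h * (q - 1)" unfolding mm n by simp
  ultimately have "2 * m * card (- T) + h * (q - 1) = (q + 1) * (q - 1)"
    using card_compl_T_relation by linarith
  moreover have "h \<le> q + 1" using h by (intro dvd_imp_le) auto
  ultimately show ?thesis
    unfolding h_def[symmetric] by (metis add_diff_cancel_right' diff_mult_distrib mult.commute)
qed

text \<open>The gcd divides both \<open>2 * (q + 1)\<close> and \<open>2 * (q - 1)\<close>, hence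
  their difference 4.\<close>

lemma gcd_eq: "gcd m (q + 1) = (if odd m then 1 else if 4 dvd m \<and> q mod 4 = 3 then 4 else 2)"
proof -
  define h where "h = gcd m (q + 1)"
  have h: "h dvd m" "h dvd q + 1" unfolding h_def by auto
  have "h dvd 2 * (q + 1)" "h dvd 2 * (q - 1)"
    by (rule dvd_mult[OF h(2)], rule dvd_trans[OF h(1) m(2)])
  then have "h dvd 2 * (q + 1) - 2 * (q - 1)" by (rule dvd_diff_nat)
  also have "2 * (q + 1) - 2 * (q - 1) = 4" using q by simp
  finally have "h dvd 4" .
  then have "h \<le> 4" by (rule dvd_imp_le) simp
  then have "h \<in> {0, 1, 2, 3, 4}" by auto
  with \<open>h dvd 4\<close> have cases: "h = 1 \<or> h = 2 \<or> h = 4" by auto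
  have iff: "4 dvd q + 1 \<longleftrightarrow> q mod 4 = 3" by presburger
  show ?thesis
  proof (cases "odd m")
    case True
    then have "odd h" using h by (meson dvd_trans)
    then have "h = 1" using cases by auto
    then show ?thesis using True unfolding h_def by simp
  next
    case False
    then have "2 dvd h" using q unfolding h_def by simp
    moreover have "h = 4 \<longleftrightarrow> 4 dvd m \<and> 4 dvd q + 1"
      using h cases unfolding h_def by (metis gcd_greatest_iff dvd_refl \<open>h dvd 4\<close> dvd_antisym h_def)
    moreover from calculation have "h = 2 \<or> h = 4" using cases by auto
    ultimately show ?thesis using False iff unfolding h_def[symmetric] by auto
  qed
qed

end

section \<open>The fixed ring of a diagonal automorphism\<close>

lemma has_mult_order_dvd:
  assumes "has_mult_order b m"
  shows "b ^ k = 1 \<longleftrightarrow> m dvd k"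
proof
  assume k: "b ^ k = 1"
  have m: "m > 0" "b ^ m = 1" "\<And>j. 0 < j \<Longrightarrow> j < m \<Longrightarrow> b ^ j \<noteq> 1"
    using assms unfolding has_mult_order_def by auto
  have "b ^ k = (b ^ m) ^ (k div m) * b ^ (k mod m)"
    by (simp flip: power_mult power_add)
  then have "b ^ (k mod m) = 1" using k m by simp
  then have "k mod m = 0" using m(3)[of "k mod m"] m(1) by (cases "k mod m = 0") auto
  then show "m dvd k" by (simp add: mod_eq_0_iff_dvd)
next
  assume "m dvd k"
  then show "b ^ k = 1" using assms unfolding has_mult_order_def by (auto simp: power_mult)
qed

lemma has_mult_order_power_div:
  assumes b: "has_mult_order b n" and m: "m dvd n" "m > 0"
  shows "has_mult_order (b ^ (n div m)) m"
proof -
  have n: "n > 0" using b unfolding has_mult_order_def by simp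
  obtain l where l: "n = m * l" using m by blast
  then have "l > 0" using n by (cases l) auto
  have "(b ^ l) ^ k = 1 \<longleftrightarrow> m dvd k" for k
  proof -
    have "n dvd l * k \<longleftrightarrow> m dvd k" using \<open>l > 0\<close> by (simp add: l mult.commute[of m])
    then show ?thesis using has_mult_order_dvd[OF b, of "l * k"] by (simp add: power_mult)
  qed
  moreover have "n div m = l" using l m by simp
  ultimately show ?thesis
    unfolding has_mult_order_def using m by (auto dest: dvd_imp_le)
qed

lemma automorphism_simps:
  assumes "is_automorphism \<iota> \<tau>"
  shows "\<tau> (a + b) = \<tau> a + \<tau> b" "\<tau> (a * b) = \<tau> a * \<tau> b" "\<tau> (\<iota> c) = \<iota> c" "\<tau> 0 = 0" "\<tau> 1 = 1"
    "\<tau> (- a) = - \<tau> a" "\<tau> (a - b) = \<tau> a - \<tau> b" "\<tau> (inverse a) = inverse (\<tau> a)" "\<tau> (a / b) = \<tau> a / \<tau> b"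
    "\<tau> (a ^ n) = \<tau> a ^ n" "\<tau> a = 0 \<longleftrightarrow> a = 0"
proof -
  have add: "\<And>a b. \<tau> (a + b) = \<tau> a + \<tau> b" and mult: "\<And>a b. \<tau> (a * b) = \<tau> a * \<tau> b"
    and inj: "inj \<tau>"
    using assms unfolding is_automorphism_def bij_def by auto
  show "\<tau> (a + b) = \<tau> a + \<tau> b" "\<tau> (a * b) = \<tau> a * \<tau> b" by (rule add, rule mult)
  show "\<tau> (\<iota> c) = \<iota> c" using assms unfolding is_automorphism_def by simp
  have z: "\<tau> 0 = 0" using add[of 0 0] by (metis add.right_neutral add_left_cancel)
  show "\<tau> 0 = 0" by (rule z)
  have eq0: "\<tau> a = 0 \<longleftrightarrow> a = 0" for a using inj z by (metis injD)
  show "\<tau> a = 0 \<longleftrightarrow> a = 0" by (rule eq0)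
  have one: "\<tau> 1 = 1" using mult[of 1 1] eq0[of 1] by simp
  show "\<tau> 1 = 1" by (rule one)
  have neg: "\<tau> (- a) = - \<tau> a" for a using add[of a "- a"] z by (simp add: eq_neg_iff_add_eq_0 add.commute)
  show "\<tau> (- a) = - \<tau> a" by (rule neg)
  show "\<tau> (a - b) = \<tau> a - \<tau> b" using add[of a "- b"] neg[of b] by simp
  have inv: "\<tau> (inverse a) = inverse (\<tau> a)" for a
  proof (cases "a = 0")
    case False
    then have "\<tau> a * \<tau> (inverse a) = 1" using mult[of a "inverse a"] one by simp
    then show ?thesis by (metis inverse_unique)
  qed (simp add: z)
  show "\<tau> (inverse a) = inverse (\<tau> a)" by (rule inv)
  show "\<tau> (a / b) = \<tau> a / \<tau> b" by (simp add: divide_inverse mult inv)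
  show "\<tau> (a ^ n) = \<tau> a ^ n" by (induction n) (auto simp: one mult)
qed

lemma automorphism_funpow:
  assumes "is_automorphism \<iota> \<tau>"
  shows "is_automorphism \<iota> (\<tau> ^^ n)"
proof -
  have "bij (\<tau> ^^ n)" using assms unfolding is_automorphism_def by (intro bij_fn) auto
  moreover have "(\<forall>u v. (\<tau> ^^ n) (u + v) = (\<tau> ^^ n) u + (\<tau> ^^ n) v) \<and>
      (\<forall>u v. (\<tau> ^^ n) (u * v) = (\<tau> ^^ n) u * (\<tau> ^^ n) v) \<and> (\<forall>a. (\<tau> ^^ n) (\<iota> a) = \<iota> a)"
    by (induction n) (auto simp: automorphism_simps[OF assms])
  ultimately show ?thesis unfolding is_automorphism_def by blast
qed

lemma fixed_set_subfield:
  assumes "is_automorphism \<iota> \<tau>"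
  shows "is_subfield {z. \<tau> z = z}"
  unfolding is_subfield_def by (auto simp: automorphism_simps[OF assms])

lemma fixed_field_cyclic_group:
  assumes "is_automorphism \<iota> \<tau>"
  shows "fixed_field (cyclic_group \<tau>) = {z. \<tau> z = z}"
proof (intro equalityI subsetI)
  fix z assume "z \<in> fixed_field (cyclic_group \<tau>)"
  moreover have "\<tau> ^^ 1 \<in> cyclic_group \<tau>" unfolding cyclic_group_def by blast
  ultimately have "(\<tau> ^^ 1) z = z" unfolding fixed_field_def by blast
  then show "z \<in> {z. \<tau> z = z}" by simp
next
  fix z assume z: "z \<in> {z. \<tau> z = z}"
  have "inj \<tau>" using assms unfolding is_automorphism_def bij_def by auto
  then have "inv \<tau> (\<tau> z) = z" by (rule inv_f_f)
  moreover have tz: "\<tau> z = z" using z by simp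
  ultimately have iz: "inv \<tau> z = z" by metis
  have "(\<tau> ^^ n) z = z" "(inv \<tau> ^^ n) z = z" for n
    by (induction n) (use tz iz in auto)
  then show "z \<in> fixed_field (cyclic_group \<tau>)" unfolding fixed_field_def cyclic_group_def by auto
qed

text \<open>The factor of \<open>w\<close> is forced by that of \<open>u\<close> through the curve
  equation. Each \<open>u ^ i * w ^ j\<close> is then an eigenvector with eigenvalue
  \<open>\<beta> ^ (i + (q + 1) * j)\<close>.\<close>

locale diagonal_automorphism = hermitian_coordinates p r q \<iota> u w
  for p r q and \<iota> :: "'k::{field,finite} \<Rightarrow> 'h::field" and u w +
  fixes \<tau> :: "'h \<Rightarrow> 'h" and \<beta> :: 'k and m :: nat
  assumes aut: "is_automorphism \<iota> \<tau>"
    and \<tau>_u: "\<tau> u = \<iota> \<beta> * u" and \<tau>_w: "\<tau> w = \<iota> (\<beta> ^ (q + 1)) * w"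
    and order: "has_mult_order \<beta> m" and m_dvd: "m dvd 2 * (q - 1)"
begin

lemmas \<tau>_simps = automorphism_simps[OF aut]

lemma m_pos: "m > 0" using order unfolding has_mult_order_def by simp

sublocale semigroup: hermitian_semigroup q m
  by unfold_locales (use q_ge_3 odd_q m_pos m_dvd in auto)

lemma \<tau>_mon:
  assumes "j < q"
  shows "\<tau> (mon (q * i + (q + 1) * j)) = \<iota> (\<beta> ^ (i + (q + 1) * j)) * mon (q * i + (q + 1) * j)"
proof -
  have "\<tau> u ^ i = \<iota> (\<beta> ^ i) * u ^ i"
    unfolding \<tau>_u power_mult_distrib const_embedding_power[OF \<iota>] ..
  moreover have "\<tau> w ^ j = \<iota> (\<beta> ^ ((q + 1) * j)) * w ^ j"
    unfolding \<tau>_w power_mult_distrib power_mult const_embedding_power[OF \<iota>] ..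
  ultimately show ?thesis
    unfolding mon_pair[OF assms] \<tau>_simps power_add[of \<beta> i] const_embedding_mult[OF \<iota>]
    by (simp only: ac_simps)
qed

lemma \<tau>_V: "b \<in> V n \<Longrightarrow> \<tau> b \<in> V n"
proof (induction n arbitrary: b)
  case (Suc n)
  from Suc.prems show ?case
  proof (rule V_SucE)
    fix v c assume *: "n \<in> S" "v \<in> V n" "b = v + \<iota> c * mon n"
    obtain i j where ij: "j < q" "n = q * i + (q + 1) * j" using * by (elim S_E)
    have "\<tau> b = \<tau> v + \<iota> (c * \<beta> ^ (i + (q + 1) * j)) * mon n"
      unfolding * \<tau>_simps using \<tau>_mon[OF ij(1), of i] unfolding ij(2)[symmetric]
      by (simp add: \<iota>_simps ac_simps)
    then show ?thesis using V_SucI[OF *(1) Suc.IH[OF *(2)]] by simp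
  qed (use Suc.IH V_Suc in blast)
qed (simp add: \<tau>_simps)

lemma \<tau>_B: "b \<in> B \<Longrightarrow> \<tau> b \<in> B"
  unfolding B_def using \<tau>_V by blast

definition F_fix :: "'h set" where "F_fix = {z. \<tau> z = z}"

definition A_fix :: "'h set" where "A_fix = B \<inter> F_fix"

text \<open>\<open>m\<close> is the ramification index at infinity: degrees of fixed elements are
  multiples of \<open>m\<close>, and only after division by it do all large degrees occur.\<close>

definition d_fix :: "'h \<Rightarrow> nat" where "d_fix b = deg b div m"

lemma F_fix_subfield: "is_subfield F_fix"
  unfolding F_fix_def by (rule fixed_set_subfield[OF aut])

lemma A_fix_subring: "is_subring A_fix"
  using B_subring subfield_subring[OF F_fix_subfield] unfolding A_fix_def is_subring_def by auto

text \<open>The filtration is stable under \<open>\<tau>\<close>, so comparing leading terms of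
  \<open>b\<close> and \<open>\<tau> b\<close> shows that the leading monomial of a fixed element is
  itself fixed.\<close>

lemma deg_A_fix:
  assumes "b \<in> A_fix" "b \<noteq> 0"
  shows "\<exists>i j. j < q \<and> m dvd i + (q + 1) * j \<and> deg b = q * i + (q + 1) * j"
proof -
  define n where "n = deg b"
  obtain v c where b: "n \<in> S" "c \<noteq> 0" "v \<in> V n" "b = v + \<iota> c * mon n"
    using assms leading_term[of b] unfolding A_fix_def n_def by blast
  obtain i j where ij: "j < q" "n = q * i + (q + 1) * j" using b by (elim S_E)
  define \<chi> where "\<chi> = \<beta> ^ (i + (q + 1) * j)"
  have "\<tau> b = \<tau> v + \<iota> (c * \<chi>) * mon n"
    unfolding b(4) \<tau>_simps using \<tau>_mon[OF ij(1), of i] unfolding ij(2)[symmetric] \<chi>_def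
    by (simp add: \<iota>_simps ac_simps)
  moreover have "\<tau> b = b" using assms unfolding A_fix_def F_fix_def by simp
  ultimately have "(\<tau> v - v) + \<iota> (c * (\<chi> - 1)) * mon n = 0"
    using b(4) by (simp add: \<iota>_simps algebra_simps)
  moreover have "\<tau> v - v \<in> V n" using b \<tau>_V by (intro V_diff)
  ultimately have "c * (\<chi> - 1) = 0"
    using deg_eqI(2)[OF b(1), of "c * (\<chi> - 1)" "\<tau> v - v"] V_0 by metis
  then have "\<chi> = 1" using b by simp
  then have "m dvd i + (q + 1) * j" using has_mult_order_dvd[OF order] unfolding \<chi>_def by blast
  then show ?thesis using ij unfolding n_def by blast
qed

lemma m_dvd_deg: "b \<in> A_fix \<Longrightarrow> m dvd deg b"
  using deg_A_fix[of b] semigroup.m_dvd_degree deg_0 by (cases "b = 0") auto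

lemma mon_A_fix:
  assumes "j < q" "m dvd i + (q + 1) * j"
  shows "mon (q * i + (q + 1) * j) \<in> A_fix"
proof -
  have "\<beta> ^ (i + (q + 1) * j) = 1" using assms(2) has_mult_order_dvd[OF order] by blast
  from \<tau>_mon[OF assms(1), of i, unfolded this] show ?thesis
    using e_B[OF S_pair[OF assms(1)]] unfolding A_fix_def F_fix_def by (simp add: \<iota>_simps)
qed

lemma degrees_A_fix: "{n. \<forall>b\<in>A_fix - {0}. d_fix b \<noteq> n} = - semigroup.T"
proof -
  have "(\<exists>b\<in>A_fix - {0}. d_fix b = n) \<longleftrightarrow> n \<in> semigroup.T" for n
  proof
    assume "\<exists>b\<in>A_fix - {0}. d_fix b = n"
    then obtain b where b: "b \<in> A_fix" "b \<noteq> 0" "d_fix b = n" by blast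
    then have "deg b = m * n" using m_dvd_deg unfolding d_fix_def by auto
    then show "n \<in> semigroup.T" using deg_A_fix[OF b(1,2)] unfolding semigroup.T_def by auto
  next
    assume "n \<in> semigroup.T"
    then obtain i j where ij: "j < q" "m dvd i + (q + 1) * j" "m * n = q * i + (q + 1) * j"
      unfolding semigroup.T_def by auto
    have "deg (mon (m * n)) = m * n" "mon (m * n) \<noteq> 0"
      unfolding ij(3) using deg_e[OF S_pair[OF ij(1)]] e_nonzero[OF S_pair[OF ij(1)]] by auto
    then show "\<exists>b\<in>A_fix - {0}. d_fix b = n"
      using mon_A_fix[OF ij(1,2)] m_pos unfolding ij(3)[symmetric]
      by (intro bexI[of _ "mon (m * n)"]) (auto simp: d_fix_def)
  qed
  then show ?thesis by blast
qed

lemma \<tau>_power_id: "(\<tau> ^^ m) z = z"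
proof -
  have ut: "(\<tau> ^^ k) u = \<iota> (\<beta> ^ k) * u" "(\<tau> ^^ k) w = \<iota> (\<beta> ^ ((q + 1) * k)) * w" for k
    by (induction k) (auto simp: \<tau>_simps \<tau>_u \<tau>_w \<iota>_simps power_add ac_simps)
  have "\<beta> ^ m = 1" using order unfolding has_mult_order_def by simp
  moreover from this have "\<beta> ^ ((q + 1) * m) = 1" by (metis mult.commute power_mult power_one)
  ultimately have "(\<tau> ^^ m) u = u" "(\<tau> ^^ m) w = w"
    unfolding ut by (simp_all add: \<iota>_simps)
  then have "{z. (\<tau> ^^ m) z = z} = UNIV"
    using automorphism_simps(3)[OF automorphism_funpow[OF aut]]
    by (intro generated fixed_set_subfield[OF automorphism_funpow[OF aut]]) auto
  then show ?thesis by blast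
qed

text \<open>Expand the fraction so that its denominator becomes the norm, the product of the
  conjugates of \<open>b\<close>. The norm is fixed because \<open>\<tau>\<close> shifts the factors
  cyclically.\<close>

lemma A_fix_frac:
  assumes "z \<in> F_fix"
  shows "\<exists>a\<in>A_fix. \<exists>b\<in>A_fix. b \<noteq> 0 \<and> z = a / b"
proof -
  obtain a b where ab: "a \<in> B" "b \<in> B" "b \<noteq> 0" "z = a / b" using B_frac by blast
  define f where "f k = (\<tau> ^^ k) b" for k
  have f: "f k \<in> B" "f k \<noteq> 0" for k
    unfolding f_def using ab by (induction k) (auto simp: \<tau>_B \<tau>_simps)
  define N where "N = (\<Prod>k<m. f k)"
  have N: "N \<in> B" "N \<noteq> 0" unfolding N_def using f by (auto intro: subring_prod[OF B_subring])
  have \<tau>_prod: "\<tau> (prod f I) = (\<Prod>k\<in>I. \<tau> (f k))" if "finite I" for I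
    using that by (induction I rule: finite_induct) (auto simp: \<tau>_simps)
  have "\<tau> N = (\<Prod>k<m. f (Suc k))" unfolding N_def \<tau>_prod[OF finite_lessThan] by (simp add: f_def)
  moreover have "f 0 * (\<Prod>k<m. f (Suc k)) = (\<Prod>k<Suc m. f k)"
    unfolding prod.lessThan_Suc_shift ..
  moreover have "(\<Prod>k<Suc m. f k) = f 0 * N"
    unfolding N_def by (simp add: f_def \<tau>_power_id mult.commute)
  ultimately have "f 0 * \<tau> N = f 0 * N" by metis
  then have "\<tau> N = N" using f(2)[of 0] by simp
  then have NF: "N \<in> F_fix" unfolding F_fix_def by simp
  have "N = f 0 * (\<Prod>k\<in>{..<m} - {0}. f k)"
    unfolding N_def using m_pos by (intro prod.remove) auto
  then have "z * N = a * (\<Prod>k\<in>{..<m} - {0}. f k)" using ab by (simp add: f_def)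
  moreover have "(\<Prod>k\<in>{..<m} - {0}. f k) \<in> B" using f(1) by (intro subring_prod[OF B_subring])
  ultimately have "z * N \<in> B" using ab(1) by (simp add: subring_mult[OF B_subring])
  moreover have "z * N \<in> F_fix" using assms NF F_fix_subfield by (simp add: subfield_intros)
  ultimately have "z * N \<in> A_fix" "N \<in> A_fix" using N NF unfolding A_fix_def by auto
  then show ?thesis using N by (intro bexI[of _ "z * N"] bexI[of _ N]) auto
qed

sublocale fixed: normal_degree_ring \<iota> F_fix A_fix d_fix
proof
  show "const_embedding \<iota>" by (rule \<iota>)
  show "is_subfield F_fix" by (rule F_fix_subfield)
  show "is_subring A_fix" by (rule A_fix_subring)
  show "A_fix \<subseteq> F_fix" unfolding A_fix_def by blast
  show "range \<iota> \<subseteq> A_fix" unfolding A_fix_def F_fix_def using const_B by (auto simp: \<tau>_simps)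
  show "\<exists>a\<in>A_fix. \<exists>b\<in>A_fix. b \<noteq> 0 \<and> z = a / b" if "z \<in> F_fix" for z using A_fix_frac[OF that] .
  show "d_fix 0 = 0" by (simp add: d_fix_def deg_0)
  show "finite {n. \<forall>a\<in>A_fix - {0}. d_fix a \<noteq> n}"
    unfolding degrees_A_fix by (rule semigroup.finite_compl_T)
next
  fix a b assume ab: "a \<in> A_fix" "b \<in> A_fix"
  then have abB: "a \<in> B" "b \<in> B" unfolding A_fix_def by auto
  show "d_fix (a * b) = d_fix a + d_fix b" if "a \<noteq> 0" "b \<noteq> 0"
    unfolding d_fix_def deg_mult[OF abB(1) that(1) abB(2) that(2)]
    using m_dvd_deg[OF ab(1)] by (rule div_plus_div_distrib_dvd_left)
  have "d_fix (a - b) \<le> max (deg a) (deg b) div m"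
    unfolding d_fix_def using deg_diff[OF abB] by (rule div_le_mono)
  also have "max (deg a) (deg b) div m \<le> max (d_fix a) (d_fix b)"
    unfolding d_fix_def by (auto simp: max_def)
  finally show "d_fix (a - b) \<le> max (d_fix a) (d_fix b)" .
  assume nz: "a \<noteq> 0" "b \<noteq> 0" and eq: "d_fix a = d_fix b"
  have "deg a = deg b"
    using eq m_dvd_deg[OF ab(1)] m_dvd_deg[OF ab(2)] unfolding d_fix_def by (metis dvd_div_mult_self)
  with deg_leading[OF abB(1) nz(1) abB(2) nz(2)] obtain c
    where c: "a - \<iota> c * b = 0 \<or> deg (a - \<iota> c * b) < deg a" by blast
  have "\<iota> c \<in> A_fix" unfolding A_fix_def F_fix_def using const_B by (simp add: \<tau>_simps)
  then have "a - \<iota> c * b \<in> A_fix" using ab by (simp add: subring_intros[OF A_fix_subring])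
  then have "d_fix (a - \<iota> c * b) < d_fix a" if "deg (a - \<iota> c * b) < deg a"
    unfolding d_fix_def using m_dvd_deg[OF ab(1)] m_dvd_deg[of "a - \<iota> c * b"] that
    by (simp add: div_less_mono m_pos dvd_imp_mod_0)
  with c show "\<exists>c. a - \<iota> c * b = 0 \<or> d_fix (a - \<iota> c * b) < d_fix a" by blast
next
  fix z assume z: "z \<in> F_fix" "z \<in> adjoin A_fix (inverse z)"
  \<comment> \<open>Normality descends: integrality over \<open>A_fix\<close> implies integrality
    over \<open>B\<close>, and \<open>z\<close> is fixed.\<close>
  then have "z \<in> adjoin B (inverse z)" unfolding adjoin_def A_fix_def by blast
  then have "z \<in> B" by (rule B_int_closed)
  with z show "z \<in> A_fix" unfolding A_fix_def by blast
qed

theorem genus_fixed: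
  "2 * int m * genus \<iota> F_fix = (int q - 1) * (int q + 1 - int (gcd m (q + 1)))"
proof -
  have "degree_ring.degrees A_fix d_fix = semigroup.T"
    using degrees_A_fix unfolding fixed.degrees_def by blast
  then have "genus \<iota> F_fix = int (card (- semigroup.T))"
    using fixed.genus_eq_gaps unfolding fixed.gaps_def by simp
  moreover have "gcd m (q + 1) \<le> q + 1" by (rule gcd_le2_nat) simp
  then have "int ((q - 1) * (q + 1 - gcd m (q + 1))) = (int q - 1) * (int q + 1 - int (gcd m (q + 1)))"
    using q_ge_3 by (simp add: of_nat_diff)
  ultimately show ?thesis
    using semigroup.card_compl_T by (metis of_nat_mult of_nat_numeral)
qed

end

section \<open>Diagonal coordinates on the Hermitian function field\<close>

lemma finite_field_type_not_transcendental:
  fixes \<iota> :: "'k::field \<Rightarrow> 'h::field"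
  assumes \<iota>: "const_embedding \<iota>" and "finite (UNIV :: 'h set)"
  shows "\<not> transcendental_over \<iota> x"
proof
  assume tr: "transcendental_over \<iota> x"
  note hom = const_embedding_ring_hom[OF \<iota>]
  have "\<not> inj (\<lambda>n. x ^ n)"
  proof
    assume "inj (\<lambda>n. x ^ n)"
    then have "finite (UNIV :: nat set)" using assms(2) by (metis finite_imageD finite_subset subset_UNIV)
    then show False by simp
  qed
  then obtain i j where ij: "i \<noteq> j" "x ^ i = x ^ j" unfolding inj_def by blast
  have "eval_at \<iota> x (monom 1 i - monom 1 j) = 0"
    unfolding ring_hom_diff[OF eval_at_hom[OF hom]] eval_at_monom[OF hom]
    using ij \<iota> by (simp add: const_embedding_simps)
  moreover have "monom 1 i - monom 1 j \<noteq> (0 :: 'k poly)"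
    using ij by (simp add: monom_eq_iff')
  ultimately show False using tr unfolding transcendental_over_def eval_at_def by blast
qed

lemma transcendental_power_not_const:
  assumes \<iota>: "const_embedding \<iota>" and tr: "transcendental_over \<iota> x" and "n > 0"
  shows "x ^ n \<noteq> \<iota> a"
proof
  assume eq: "x ^ n = \<iota> a"
  note hom = const_embedding_ring_hom[OF \<iota>]
  have "eval_at \<iota> x (monom 1 n - [:a:]) = 0"
    unfolding ring_hom_diff[OF eval_at_hom[OF hom]] eval_at_monom[OF hom]
    using eq \<iota> by (simp add: const_embedding_simps eval_at_pCons[OF hom] eval_at_0[OF hom])
  moreover have "monom 1 n - [:a:] \<noteq> 0"
  proof
    assume "monom 1 n - [:a:] = 0"
    then have "coeff (monom 1 n - [:a:]) n = 0" by simp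
    with \<open>n > 0\<close> show False by (simp add: coeff_pCons split: nat.splits)
  qed
  ultimately show False using tr unfolding transcendental_over_def eval_at_def by blast
qed

text \<open>The eigenvalue on the new coordinate will be \<open>-\<delta>\<close>, whose order is
  therefore needed. A smaller odd exponent \<open>k\<close> would give \<open>n dvd k\<close> with
  \<open>n\<close> even.\<close>

lemma has_mult_order_uminus:
  fixes d :: "'a::field"
  assumes d: "has_mult_order d (2 * n)" and n: "even n" "n > 0"
  shows "d ^ n = -1" "has_mult_order (- d) (2 * n)"
proof -
  have "(d ^ n) ^ 2 = 1" using d unfolding has_mult_order_def by (simp add: power_mult[symmetric] mult.commute)
  moreover have "d ^ n \<noteq> 1" using has_mult_order_dvd[OF d, of n] n by (auto dest: dvd_imp_le)
  ultimately show "d ^ n = -1" by (simp add: power2_eq_1_iff)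
  have "(- d) ^ k \<noteq> 1" if k: "0 < k" "k < 2 * n" for k
  proof (cases "even k")
    case True
    then show ?thesis using d k unfolding has_mult_order_def by simp
  next
    case False
    show ?thesis
    proof
      assume "(- d) ^ k = 1"
      moreover have "(- d) ^ (2 * k) = ((- d) ^ k) ^ 2"
        by (subst mult.commute) (rule power_mult)
      ultimately have "d ^ (2 * k) = 1" by simp
      then have "2 * n dvd 2 * k" using has_mult_order_dvd[OF d] by blast
      then have "n dvd k" by simp
      with n False show False by (meson dvd_trans)
    qed
  qed
  moreover have "(- d) ^ (2 * n) = 1" using d unfolding has_mult_order_def by simp
  ultimately show "has_mult_order (- d) (2 * n)" 
    unfolding has_mult_order_def using n by (metis mult_pos_pos zero_less_numeral)
qed

text \<open>The points \<^term>\<open>(0, -\<delta>)\<close> and \<^term>\<open>(0, 1 / \<delta>)\<close> of the curve are fixed by \<^term>\<open>\<sigma>\<close>; the new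
  coordinates move them to the origin and to infinity. The assumption \<^term>\<open>q \<noteq> 3\<close> ensures
  \<^term>\<open>\<delta> + 1 / \<delta> \<noteq> 0\<close>.\<close>

lemma hermitian_diagonal_coordinates:
  fixes \<iota> :: "'k::{field,finite} \<Rightarrow> 'h::field" and x y :: 'h and \<delta> c :: 'k
  assumes p: "prime p" "odd p" and e: "e > 0" and q: "q = p ^ e" "q \<noteq> 3"
    and H: "hermitian_function_field q \<iota> x y"
    and \<delta>: "has_mult_order \<delta> (2 * (q - 1))" and c: "c = \<delta> - inverse \<delta>"
    and aut: "is_automorphism \<iota> \<sigma>"
    and \<sigma>_x: "\<sigma> x = x / (y + \<iota> c)" and \<sigma>_y: "\<sigma> y = 1 / (y + \<iota> c)"
  shows "\<exists>u w. hermitian_coordinates p e q \<iota> u w \<and>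
    \<sigma> u = \<iota> (- \<delta>) * u \<and> \<sigma> w = \<iota> ((- \<delta>) ^ (q + 1)) * w"
proof -
  have \<iota>: "const_embedding \<iota>" and card: "CARD('k) = q ^ 2" and tr: "transcendental_over \<iota> x"
    and curve: "y ^ q + y = x ^ (q + 1)" and hull: "is_subfield hull (range \<iota> \<union> {x, y}) = UNIV"
    using H unfolding hermitian_function_field_def by auto
  note \<iota>s = const_embedding_simps[OF \<iota>] and \<sigma>s = automorphism_simps[OF aut]
  have "p \<ge> 3" using p prime_ge_2_nat[of p] by (cases "p = 2") auto
  moreover have "p ^ 1 \<le> p ^ e" using e prime_ge_1_nat[OF p(1)] by (intro power_increasing) auto
  ultimately have "q \<ge> 3" using q by simp
  have "odd q" using p q by simp
  have "q - 1 > 0" "even (q - 1)" using \<open>q \<ge> 3\<close> \<open>odd q\<close> by auto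
  have \<delta>0: "\<delta> \<noteq> 0" using \<delta> \<open>q \<ge> 3\<close> unfolding has_mult_order_def
    by (auto simp: power_0_left)
  have \<delta>q: "\<delta> ^ q = - \<delta>"
  proof -
    have "\<delta> ^ Suc (q - 1) = - \<delta>"
      using has_mult_order_uminus(1)[OF \<delta> \<open>even (q - 1)\<close> \<open>q - 1 > 0\<close>] by simp
    then show ?thesis using \<open>q \<ge> 3\<close> by simp
  qed
  define s where "s = \<delta> + inverse \<delta>"
  have s0: "s \<noteq> 0"
  proof
    assume "s = 0"
    then have "\<delta> * s = 0" by simp
    then have "\<delta> ^ 2 = -1" using \<delta>0 unfolding s_def
      by (simp add: distrib_left power2_eq_square add_eq_0_iff2)
    then have "\<delta> ^ 4 = 1" by (simp add: power4_eq_xxxx power2_eq_square)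
    then have "2 * (q - 1) dvd 4" using has_mult_order_dvd[OF \<delta>] by blast
    then have "2 * (q - 1) \<le> 4" by (rule dvd_imp_le) simp
    with \<open>q \<ge> 3\<close> \<open>q \<noteq> 3\<close> show False by simp
  qed
  have "of_nat p = (0 :: 'k)"
    using card by (intro of_nat_eq_0_of_card[of _ "e * 2"]) (simp add: q power_mult)
  then have prime_p_h: "of_nat p = (0 :: 'h)"
    using const_embedding_of_nat[OF \<iota>, of p] by (simp add: \<iota>s)
  have frob: "(a + b) ^ q = a ^ q + b ^ q" "(a - b) ^ q = a ^ q - b ^ q" for a b :: 'h
    using frobenius_add[OF p(1) prime_p_h] frobenius_diff[OF p(1) prime_p_h] unfolding q(1) by auto
  have y_not_const: "y \<noteq> \<iota> a" for a
  proof
    assume "y = \<iota> a"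
    then have "x ^ (q + 1) = \<iota> (a ^ q + a)" using curve by (simp add: \<iota>s)
    then show False using transcendental_power_not_const[OF \<iota> tr] by (metis add_gr_0 zero_less_one)
  qed
  define D where "D = \<iota> \<delta>"
  have D: "D \<noteq> 0" "D ^ q = - D" unfolding D_def using \<delta>0 \<delta>q by (simp_all add: \<iota>s flip: const_embedding_power[OF \<iota>])
  \<comment> \<open>The inverse of \<open>\<delta> + 1 / \<delta>\<close>. It satisfies
    \<open>K ^ q = - K\<close>, so adding it to the second coordinate preserves the curve
    equation.\<close>
  define K where "K = \<iota> (inverse s)"
  have K: "K * (D + inverse D) = 1" unfolding K_def D_def using s0 by (simp add: s_def \<iota>s flip: const_embedding_add[OF \<iota>] const_embedding_inverse[OF \<iota>] const_embedding_mult[OF \<iota>])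
  have Kq: "K ^ q = - K"
  proof -
    have "(K * (D + inverse D)) ^ q = 1" unfolding K by simp
    then have "K ^ q * - (D + inverse D) = 1"
      unfolding power_mult_distrib frob power_inverse D by simp
    moreover have "- K * - (D + inverse D) = 1" by (simp only: minus_mult_minus K)
    ultimately have "K ^ q * - (D + inverse D) = - K * - (D + inverse D)" by metis
    moreover have "D + inverse D \<noteq> 0" using K by auto
    ultimately show ?thesis by (metis mult_right_cancel neg_equal_0_iff_equal)
  qed
  define Y where "Y = y - inverse D"
  have Y0: "Y \<noteq> 0" using y_not_const[of "inverse \<delta>"] unfolding Y_def D_def by (simp add: \<iota>s)
  have yc: "y + \<iota> c = Y + D" unfolding c Y_def D_def by (simp add: \<iota>s)
  have YD: "Y + D \<noteq> 0" using y_not_const[of "inverse \<delta> - \<delta>"] unfolding Y_def D_def by (simp add: \<iota>s algebra_simps)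
  \<comment> \<open>\<open>Y\<close> vanishes at \<open>(0, 1 / \<delta>)\<close>, which thus goes
    to infinity. At \<open>(0, -\<delta>)\<close> its value is
    \<open>-(\<delta> + 1 / \<delta>)\<close>, so adding \<open>K\<close> makes \<open>w\<close>
    vanish there.\<close>
  define u w where "u = x / Y" and "w = K + inverse Y"
  have \<sigma>_\<iota>: "\<sigma> D = D" "\<sigma> K = K" unfolding D_def K_def by (simp_all add: \<sigma>s)
  have \<sigma>Y: "\<sigma> Y = - Y / (D * (Y + D))"
  proof -
    have "\<sigma> Y = 1 / (y + \<iota> c) - inverse D" unfolding Y_def \<sigma>s \<sigma>_y \<sigma>_\<iota> ..
    then have "\<sigma> Y = 1 / (Y + D) - inverse D" unfolding yc .
    also have "\<dots> = - Y / (D * (Y + D))"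
      using D YD by (simp add: inverse_eq_divide diff_frac_eq mult.commute)
    finally show ?thesis .
  qed
  have "x / E / (- Y / (D * E)) = - D * (x / Y)" if "E \<noteq> 0" for E
    using that D Y0 by (simp add: field_simps)
  from this[OF YD] have "\<sigma> u = - D * u"
    unfolding u_def \<sigma>s \<sigma>_x \<sigma>Y yc .
  \<comment> \<open>This identity makes the constant term of \<open>\<sigma> w\<close> fit, so that
    \<open>w\<close> is an eigenvector.\<close>
  have KD: "K - D = - (D ^ 2) * K"
  proof -
    have "K * (D * D + inverse D * D) = K * (D + inverse D) * D"
      unfolding distrib_right[symmetric] mult.assoc ..
    also have "\<dots> = D" using K by simp
    finally have "K * (D * D) + K = D" using D by (simp add: distrib_left)
    then show ?thesis by (simp add: power2_eq_square algebra_simps)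
  qed
  have "inverse (- Y / (D * E)) = D * E * - inverse Y" if "E \<noteq> 0" for E
    using that D Y0 by (simp add: field_simps)
  from this[OF YD] have "\<sigma> w = K + D * (Y + D) * - inverse Y"
    unfolding w_def \<sigma>s \<sigma>Y \<sigma>_\<iota> by simp
  also have "\<dots> = (K - D) - D ^ 2 * inverse Y" using Y0 by (simp add: field_simps power2_eq_square)
  also have "\<dots> = - (D ^ 2) * w" unfolding KD w_def by (simp add: algebra_simps)
  finally have \<sigma>w: "\<sigma> w = - (D ^ 2) * w" .
  have \<delta>q1: "(- \<delta>) ^ (q + 1) = - (\<delta> ^ 2)"
    using \<open>odd q\<close> \<delta>q by (simp add: power2_eq_square)
  have "\<sigma> u = \<iota> (- \<delta>) * u" using \<open>\<sigma> u = - D * u\<close> unfolding D_def by (simp add: \<iota>s)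
  moreover have "\<sigma> w = \<iota> ((- \<delta>) ^ (q + 1)) * w" using \<sigma>w unfolding \<delta>q1 D_def by (simp add: \<iota>s)
  moreover have "hermitian_coordinates p e q \<iota> u w"
  proof
    have Yq: "Y ^ q = y ^ q + inverse D" unfolding Y_def frob power_inverse D by simp
    have sum: "Y ^ q + Y = x ^ (q + 1)" unfolding Yq curve[symmetric] by (simp add: Y_def)
    have "w ^ q + w = inverse (Y ^ q) + inverse Y" unfolding w_def frob Kq power_inverse by simp
    also have "\<dots> = (Y ^ q + Y) / (Y ^ q * Y)" using Y0 by (simp add: field_simps)
    also have "\<dots> = u ^ (q + 1)" unfolding sum u_def by (simp add: power_divide mult.commute)
    finally show "w ^ q + w = u ^ (q + 1)" .
    show "infinite (UNIV :: 'h set)" using finite_field_type_not_transcendental[OF \<iota>] tr by blast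
    fix R assume R: "is_subfield R" "range \<iota> \<subseteq> R" "u \<in> R" "w \<in> R"
    have "K \<in> R" "D \<in> R" using R unfolding K_def D_def by auto
    have "Y = inverse (w - K)" unfolding w_def by simp
    then have "Y \<in> R" using R \<open>K \<in> R\<close> by (simp add: subfield_intros)
    then have "y \<in> R" using R(1) \<open>D \<in> R\<close> subfield_intros(6)[OF R(1), of Y "inverse D"]
      by (simp add: Y_def subfield_intros)
    moreover have "x = u * Y" unfolding u_def using Y0 by simp
    then have "x \<in> R" using R \<open>Y \<in> R\<close> by (simp add: subfield_intros)
    ultimately have "is_subfield hull (range \<iota> \<union> {x, y}) \<subseteq> R" using R by (intro hull_minimal) auto
    then show "R = UNIV" unfolding hull by blast
  qed (use p e q card \<iota> in auto)
  ultimately show ?thesis by blast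
qed

theorem theorem4p4:
  fixes p e q m :: nat
    and \<iota> :: "'k::{field,finite} \<Rightarrow> 'h::field"
    and x y :: 'h
    and \<delta> c :: 'k
    and \<sigma> :: "'h \<Rightarrow> 'h"
    and \<G> :: "('h \<Rightarrow> 'h) set"
  assumes "prime p" and "odd p" and "e > 0" and "q = p ^ e" and "q \<noteq> 3"
    and "hermitian_function_field q \<iota> x y"
    and "has_mult_order \<delta> (2 * (q - 1))"
    and "c = \<delta> - inverse \<delta>"
    and "is_automorphism \<iota> \<sigma>"
    and "\<sigma> x = x / (y + \<iota> c)" and "\<sigma> y = 1 / (y + \<iota> c)"
    and "m > 0" and "m dvd 2 * (q - 1)"
    and "\<G> = cyclic_group (\<sigma> ^^ (2 * (q - 1) div m))"
  shows "real_of_int (genus \<iota> (fixed_field \<G>)) =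
    (if odd m then (real q ^ 2 - real q) / (2 * real m)
     else if 4 dvd m \<and> q mod 4 = 3 then (real q ^ 2 - 4 * real q + 3) / (2 * real m)
     else (real q ^ 2 - 2 * real q + 1) / (2 * real m))"
proof -
  define k where "k = 2 * (q - 1) div m"
  obtain u w where uw: "hermitian_coordinates p e q \<iota> u w"
    and \<sigma>: "\<sigma> u = \<iota> (- \<delta>) * u" "\<sigma> w = \<iota> ((- \<delta>) ^ (q + 1)) * w"
    using hermitian_diagonal_coordinates[OF assms(1-11)] by blast
  interpret hermitian_coordinates p e q \<iota> u w by (rule uw)
  have "even (q - 1)" "q - 1 > 0" using q_ge_3 odd_q by auto
  \<comment> \<open>\<open>-\<delta>\<close> has the full order \<open>2 * (q - 1)\<close>, so its
    power with exponent \<open>k\<close> has order exactly \<open>m\<close>.\<close>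
  note order = has_mult_order_power_div[OF has_mult_order_uminus(2)[OF assms(7) this] assms(13,12)]
  define b where "b = - \<delta>"
  note order = order[folded b_def] and \<sigma> = \<sigma>[folded b_def]
  have \<sigma>k: "(\<sigma> ^^ n) u = \<iota> (b ^ n) * u \<and> (\<sigma> ^^ n) w = \<iota> ((b ^ n) ^ (q + 1)) * w" for n
  proof (induction n)
    case (Suc n)
    have "\<sigma> ((\<sigma> ^^ n) u) = \<iota> (b ^ n) * (\<iota> b * u)"
      using Suc by (simp add: automorphism_simps(2,3)[OF assms(9)] \<sigma>)
    moreover have "\<sigma> ((\<sigma> ^^ n) w) = \<iota> ((b ^ n) ^ (q + 1)) * (\<iota> (b ^ (q + 1)) * w)"
      using Suc by (simp only: automorphism_simps(2,3)[OF assms(9)] \<sigma>)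
    ultimately show ?case
      by (simp add: const_embedding_mult[OF \<iota>] power_mult_distrib ac_simps)
  qed (simp add: const_embedding_1[OF \<iota>])
  interpret diagonal_automorphism p e q \<iota> u w "\<sigma> ^^ k" "b ^ k" m
    by unfold_locales
      (use automorphism_funpow[OF assms(9)] \<sigma>k[of k] order assms(13) in \<open>auto simp: k_def\<close>)
  have "fixed_field \<G> = F_fix"
    unfolding assms(14) k_def[symmetric] fixed_field_cyclic_group[OF aut] F_fix_def ..
  then have g: "2 * int m * genus \<iota> (fixed_field \<G>) = (int q - 1) * (int q + 1 - int (gcd m (q + 1)))"
    using genus_fixed by simp
  have "2 * real m * real_of_int (genus \<iota> (fixed_field \<G>)) =
      (real q - 1) * (real q + 1 - real (gcd m (q + 1)))"
    using arg_cong[OF g, of real_of_int] by simp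
  then have "real_of_int (genus \<iota> (fixed_field \<G>)) =
      (real q - 1) * (real q + 1 - real (gcd m (q + 1))) / (2 * real m)"
    using assms(12) by (simp add: field_simps)
  \<comment> \<open>With gcd 1, 4 and 2 the product becomes \<open>(q - 1) * q\<close>,
    \<open>(q - 1) * (q - 3)\<close> and \<open>(q - 1) * (q - 1)\<close>.\<close>
  then show ?thesis
    unfolding semigroup.gcd_eq by (auto simp: power2_eq_square algebra_simps)
qed

end
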